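(* Let $F(X_1,\ldots,X_n):=\sum_{k=0}^\infty\sum_{|\alpha|=k}X_\alpha\otimes A_{(\alpha)}$, $A_{(\alpha)}\in B(\mathcal{H})$, be a (universal) holomorphic function on $[B(\mathcal{X})^n]_{<1}$ with coefficients in $B(\mathcal{H})$ such that $F(0)\geq0$ and $$\mathrm{Re}\,F(X_1,\ldots,X_n)\leq I\quad\text{for any }(X_1,\ldots,X_n)\in[B(\mathcal{X})^n]_{<1}\text{ and any Hilbert space }\mathcal{X}.$$ Then (i) if $Y_1,\ldots,Y_n\in B(\mathcal{K})$ are bounded operators such that $\|[Y_1^*,\ldots,Y_n^*]\|\leq\frac13$, then $\|F(S_1\otimes Y_1,\ldots,S_n\otimes Y_n)\|\leq1$; (ii) $\sum_{|\alpha|=k}A_{(\alpha)}^*A_{(\alpha)}\leq4(I-A_{(0)})$ for any $k=1,2,\ldots$; (iii) $\left\|\sum_{|\alpha|=k}A_{(\alpha)}^*A_{(\alpha)}\right\|^{1/2}\leq2\|I-A_{(0)}\|$ for any $k=1,2,\ldots$; (iv) for $0\leq r<1$, $$\sum_{k=0}^\infty r^k\left(\sum_{|\alpha|=k}A_{(\alpha)}^*A_{(\alpha)}\right)^{1/2}\leq M(r)I,\quad M(r):=\begin{cases}1+\frac{r^2}{(1-r)^2}&\text{if }0\leq r\leq\frac12\\ \frac{2r}{1-r}&\text{if }\frac12<r<1;\end{cases}$$ (v) if $\|A_{(0)}\|<1$ and $0\leq r<1$, then $$A_{(0)}+\sum_{k=1}^\infty\sum_{|\alpha|=k}r^kA_{(\alpha)}^*(I-A_{(0)})^{-1}A_{(\alpha)}\leq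 K(r)I,\quad K(r):=\begin{cases}1&\text{if }0\leq r\leq\frac15\\ \frac{4r}{1-r}&\text{if }\frac15<r<1;\end{cases}$$ (vi) for $0\leq r\leq\frac13$, $$\sum_{k=0}^\infty r^k\left\|\sum_{|\alpha|=k}A_{(\alpha)}^*A_{(\alpha)}\right\|^{1/2}\leq\|A_{(0)}\|+\|I-A_{(0)}\|.$$
   Context: $\mathbb{F}_n^+$ is the unital free semigroup on $g_1,\dots,g_n$ with identity $g_0$; $|g_{i_1}\cdots g_{i_k}|=k$, $|g_0|=0$; for $\alpha=g_{i_1}\cdots g_{i_k}$, $X_\alpha:=X_{i_1}\cdots X_{i_k}$, $X_{g_0}:=I$. $H_n$ is an $n$-dimensional complex Hilbert space with orthonormal basis $e_1,\dots,e_n$; $F^2(H_n)=\bigoplus_{k\ge0}H_n^{\otimes k}$ (with $H_n^{\otimes0}=\mathbb{C}1$) is the full Fock space and $S_i\varphi=e_i\otimes\varphi$ are the left creation operators on it. $[B(\mathcal{X})^n]_{<1}:=\{(X_1,\ldots,X_n)\in B(\mathcal{X})^n:\|X_1X_1^*+\cdots+X_nX_n^*\|<1\}$. A family $\{A_{(\alpha)}\}_{\alpha\in\mathbb{F}_n^+}\subset B(\mathcal{H})$ defines a (universal) holomorphic function $F$ on $[B(\mathcal{X})^n]_{<1}$ with coefficients in $B(\mathcal{H})$ if $\sum_{k=0}^\infty\left(\sum_{|\alpha|=k}X_\alpha\otimes A_{(\alpha)}\right)$ converges in operator norm for every Hilbert space $\mathcal{X}$ and every $(X_1,\ldots,X_n)\in[B(\mathcal{X})^n]_{<1}$.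 $A_{(0)}:=A_{(g_0)}$; $F(0)\ge0$ means $A_{(0)}\ge0$; $\mathrm{Re}\,A=\frac12(A+A^* )$. $\mathcal{H},\mathcal{K}$ are Hilbert spaces; $[Y_1^*,\dots,Y_n^*]$ is the row operator, so $\|[Y_1^*,\dots,Y_n^*]\|=\|\sum_iY_i^*Y_i\|^{1/2}$; $F(S_1\otimes Y_1,\dots,S_n\otimes Y_n)=\sum_{k=0}^\infty\sum_{|\alpha|=k}S_\alpha\otimes Y_\alpha\otimes A_{(\alpha)}$ (norm-convergent in $k$). *)

theory Defs
  imports "HOL-Analysis.Analysis" "HOL-Library.Infinite_Typeclass"
begin

section \<open>Complex Hilbert spaces\<close>

text \<open>The complex inner product is antilinear in its first argument. Its real part is the inner
  product of \<^class>\<open>real_inner\<close>, so norm, topology and completeness are the library ones.\<close>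

class chilbert_space = real_inner + banach +
  fixes scaleC :: "complex \<Rightarrow> 'a \<Rightarrow> 'a" (infixr "*\<^sub>C" 75)
    and cinner :: "'a \<Rightarrow> 'a \<Rightarrow> complex"
  assumes scaleC_add_right: "c *\<^sub>C (x + y) = c *\<^sub>C x + c *\<^sub>C y"
    and scaleC_add_left: "(c + d) *\<^sub>C x = c *\<^sub>C x + d *\<^sub>C x"
    and scaleC_scaleC: "c *\<^sub>C d *\<^sub>C x = (c * d) *\<^sub>C x"
    and scaleR_scaleC: "r *\<^sub>R x = complex_of_real r *\<^sub>C x"
    and cinner_commute: "cinner x y = cnj (cinner y x)"
    and cinner_add_right: "cinner x (y + z) = cinner x y + cinner x z"
    and cinner_scaleC_right: "cinner x (c *\<^sub>C y) = c * cinner x y"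
    and inner_eq_Re_cinner: "inner x y = Re (cinner x y)"

lemma cinner_add_left: "cinner (x + y) z = cinner x z + cinner y z"
  by (metis cinner_add_right cinner_commute complex_cnj_add)

lemma cinner_scaleC_left: "cinner (c *\<^sub>C x) y = cnj c * cinner x y"
  by (metis cinner_scaleC_right cinner_commute complex_cnj_mult)

lemma cinner_zero_right [simp]: "cinner x 0 = 0"
  using cinner_add_right[of x 0 0] by simp

lemma cinner_zero_left [simp]: "cinner 0 x = 0"
  using cinner_add_left[of 0 0 x] by simp

lemma scaleC_one [simp]: "1 *\<^sub>C (x :: 'a :: chilbert_space) = x"
  using scaleR_scaleC[of 1 x] by simp

lemma scaleC_zero_left [simp]: "0 *\<^sub>C (x :: 'a :: chilbert_space) = 0"
  using scaleR_scaleC[of 0 x] by simp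

lemma scaleC_zero_right [simp]: "c *\<^sub>C 0 = (0 :: 'a :: chilbert_space)"
  using scaleC_add_right[of c 0 "0 :: 'a"] by simp

lemma scaleC_minus_one: "(-1) *\<^sub>C x = - x"
  using scaleR_scaleC[of "-1" x] by simp

lemma cinner_minus_right: "cinner x (- y) = - cinner x y"
  using cinner_scaleC_right[of x "-1" y] by (simp add: scaleC_minus_one)

lemma cinner_diff_right: "cinner x (y - z) = cinner x y - cinner x z"
  using cinner_add_right[of x y "- z"] by (simp add: cinner_minus_right)

lemma cinner_minus_left: "cinner (- x) y = - cinner x y"
  by (metis cinner_commute cinner_minus_right complex_cnj_minus)

lemma cinner_diff_left: "cinner (x - y) z = cinner x z - cinner y z"
  using cinner_add_left[of x "- y" z] by (simp add: cinner_minus_left)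

lemma cinner_self: "cinner x x = complex_of_real ((norm x)\<^sup>2)"
proof -
  have "Im (cinner x x) = 0"
    using cinner_commute[of x x] by (metis Reals_cnj_iff complex_is_Real_iff)
  moreover have "Re (cinner x x) = (norm x)\<^sup>2"
    by (simp add: power2_norm_eq_inner inner_eq_Re_cinner)
  ultimately show ?thesis
    by (simp add: complex_eq_iff)
qed

lemma norm_scaleC: "norm (c *\<^sub>C x) = cmod c * norm x"
proof -
  have "complex_of_real ((norm (c *\<^sub>C x))\<^sup>2) = c * cnj c * complex_of_real ((norm x)\<^sup>2)"
    by (metis cinner_self cinner_scaleC_left cinner_scaleC_right mult.assoc mult.commute)
  also have "c * cnj c = complex_of_real ((cmod c)\<^sup>2)"
    by (metis complex_norm_square of_real_power)
  finally have "(norm (c *\<^sub>C x))\<^sup>2 = (cmod c * norm x)\<^sup>2"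
    by (metis of_real_eq_iff of_real_mult power_mult_distrib)
  then show ?thesis
    by simp
qed

lemma cmod_cinner_le: "cmod (cinner x y) \<le> norm x * norm y"
proof (cases "cinner x y = 0")
  case False
  define c where "c = sgn (cnj (cinner x y))"
  have c: "cmod c = 1"
    using False by (simp add: c_def norm_sgn)
  have "c * cinner x y = complex_of_real (cmod (cinner x y))"
    using complex_norm_square[of "cinner x y"] False
    by (simp add: c_def sgn_eq power2_eq_square divide_eq_eq mult.commute)
  then have "cinner x (c *\<^sub>C y) = complex_of_real (cmod (cinner x y))"
    by (simp only: cinner_scaleC_right)
  then have "cmod (cinner x y) = inner x (c *\<^sub>C y)"
    by (simp add: inner_eq_Re_cinner)
  also have "\<dots> \<le> norm x * norm (c *\<^sub>C y)"
    by (rule norm_cauchy_schwarz)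
  finally show ?thesis
    by (simp add: norm_scaleC c)
qed simp

lemma cinner_eq_0_all: "(\<And>y. cinner y x = 0) \<Longrightarrow> x = 0"
  using cinner_self[of x] by simp

lemma cinner_sum_right: "cinner x (sum f A) = (\<Sum>a\<in>A. cinner x (f a))"
  by (induction A rule: infinite_finite_induct) (auto simp: cinner_add_right)

lemma cinner_sum_left: "cinner (sum f A) x = (\<Sum>a\<in>A. cinner (f a) x)"
  by (induction A rule: infinite_finite_induct) (auto simp: cinner_add_left)

lemma bounded_linear_cinner_right: "bounded_linear (cinner x)"
proof (rule bounded_linear_intro[where K = "norm x"])
  show "norm (cinner x y) \<le> norm y * norm x" for y
    using cmod_cinner_le[of x y] by (simp only: mult.commute)
qed (simp_all add: cinner_add_right scaleR_scaleC cinner_scaleC_right scaleR_conv_of_real)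

lemma bounded_linear_scaleC_right: "bounded_linear (scaleC c)"
  by (rule bounded_linear_intro[where K = "cmod c"])
     (simp_all add: scaleC_add_right scaleR_scaleC scaleC_scaleC norm_scaleC mult.commute)

instantiation complex :: chilbert_space
begin
definition scaleC_complex :: "complex \<Rightarrow> complex \<Rightarrow> complex" where
  "scaleC_complex = (*)"
definition cinner_complex :: "complex \<Rightarrow> complex \<Rightarrow> complex" where
  "cinner_complex x y = cnj x * y"
instance
  by standard
     (auto simp: scaleC_complex_def cinner_complex_def algebra_simps scaleR_conv_of_real
        inner_complex_def)
end

section \<open>Hilbert direct sums\<close>

lemma sq_norm_add_le: "(norm (a + b))\<^sup>2 \<le> 2 * (norm (a :: 'v :: real_inner))\<^sup>2 + 2 * (norm b)\<^sup>2"
proof -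
  have "(norm (a + b))\<^sup>2 + (norm (a - b))\<^sup>2 = 2 * (norm a)\<^sup>2 + 2 * (norm b)\<^sup>2"
    by (simp add: power2_norm_eq_inner inner_add_left inner_add_right inner_diff_left
        inner_diff_right)
  moreover have "0 \<le> (norm (a - b))\<^sup>2"
    by (rule zero_le_power2)
  ultimately show ?thesis
    by linarith
qed

text \<open>\<open>('i, 'v) l2\<close> is the Hilbert direct sum of \<open>'i\<close>-many copies of \<open>'v\<close>;
  in particular \<open>'i ell2\<close> has an orthonormal basis indexed by \<open>'i\<close>.\<close>

typedef (overloaded) ('i, 'v :: chilbert_space) l2 =
  "{f :: 'i \<Rightarrow> 'v. (\<lambda>i. (norm (f i))\<^sup>2) summable_on UNIV}"
  morphisms l2_nth Abs_l2
  by (rule exI[of _ "\<lambda>_. 0"]) simp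

type_synonym 'i ell2 = "('i, complex) l2"

setup_lifting type_definition_l2

lemma l2_summable: "(\<lambda>i. (norm (l2_nth f i))\<^sup>2) summable_on A"
  using l2_nth[of f] summable_on_subset_banach by blast

lemma abs_summable_cinner:
  "(\<lambda>i. norm (cinner (l2_nth f i) (l2_nth g i))) summable_on UNIV"
proof (rule Infinite_Sum.abs_summable_on_comparison_test')
  show "(\<lambda>i. (norm (l2_nth f i))\<^sup>2 + (norm (l2_nth g i))\<^sup>2) summable_on UNIV"
    by (intro summable_on_add l2_summable)
  fix i
  have "cmod (cinner (l2_nth f i) (l2_nth g i)) \<le> norm (l2_nth f i) * norm (l2_nth g i)"
    by (rule cmod_cinner_le)
  also have "\<dots> \<le> (norm (l2_nth f i))\<^sup>2 + (norm (l2_nth g i))\<^sup>2"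
    using sum_squares_bound[of "norm (l2_nth f i)" "norm (l2_nth g i)"]
      mult_nonneg_nonneg[OF norm_ge_zero[of "l2_nth f i"] norm_ge_zero[of "l2_nth g i"]]
    by linarith
  finally show "norm (cinner (l2_nth f i) (l2_nth g i)) \<le> \<dots>" .
qed

lemma summable_cinner: "(\<lambda>i. cinner (l2_nth f i) (l2_nth g i)) summable_on UNIV"
  by (rule Infinite_Sum.abs_summable_summable[OF abs_summable_cinner])

instantiation l2 :: (type, chilbert_space) real_vector
begin

lift_definition zero_l2 :: "('a, 'b) l2" is "\<lambda>_. 0" by simp

lift_definition plus_l2 :: "('a, 'b) l2 \<Rightarrow> ('a, 'b) l2 \<Rightarrow> ('a, 'b) l2" is
  "\<lambda>f g i. f i + g i"
proof -
  fix f g :: "'a \<Rightarrow> 'b"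
  assume "(\<lambda>i. (norm (f i))\<^sup>2) summable_on UNIV" "(\<lambda>i. (norm (g i))\<^sup>2) summable_on UNIV"
  then have "(\<lambda>i. 2 * (norm (f i))\<^sup>2 + 2 * (norm (g i))\<^sup>2) summable_on UNIV"
    by (intro summable_on_add summable_on_cmult_right)
  then show "(\<lambda>i. (norm (f i + g i))\<^sup>2) summable_on UNIV"
    by (rule summable_on_comparison_test) (auto simp: sq_norm_add_le)
qed

lift_definition uminus_l2 :: "('a, 'b) l2 \<Rightarrow> ('a, 'b) l2" is "\<lambda>f i. - f i" by simp

definition minus_l2 :: "('a, 'b) l2 \<Rightarrow> ('a, 'b) l2 \<Rightarrow> ('a, 'b) l2" where
  "minus_l2 f g = f + - g"

lift_definition scaleR_l2 :: "real \<Rightarrow> ('a, 'b) l2 \<Rightarrow> ('a, 'b) l2" is "\<lambda>r f i. r *\<^sub>R f i"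
  by (simp add: power_mult_distrib summable_on_cmult_right)

instance
proof
  fix f g h :: "('a, 'b) l2" and r s :: real
  show "f + g + h = f + (g + h)" by transfer (simp add: add.assoc)
  show "f + g = g + f" by transfer (simp add: add.commute)
  show "0 + f = f" by transfer simp
  show "- f + f = 0" by transfer simp
  show "f - g = f + - g" by (rule minus_l2_def)
  show "r *\<^sub>R (f + g) = r *\<^sub>R f + r *\<^sub>R g" by transfer (simp add: scaleR_add_right)
  show "(r + s) *\<^sub>R f = r *\<^sub>R f + s *\<^sub>R f" by transfer (simp add: scaleR_add_left)
  show "r *\<^sub>R s *\<^sub>R f = (r * s) *\<^sub>R f" by transfer simp
  show "1 *\<^sub>R f = f" by transfer simp
qed

end

lemma l2_nth_minus: "l2_nth (f - g) i = l2_nth f i - l2_nth g i"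
  unfolding minus_l2_def plus_l2.rep_eq uminus_l2.rep_eq by simp

lemmas l2_nth_simps = zero_l2.rep_eq plus_l2.rep_eq uminus_l2.rep_eq scaleR_l2.rep_eq l2_nth_minus

instantiation l2 :: (type, chilbert_space) real_inner
begin

definition norm_l2 :: "('a, 'b) l2 \<Rightarrow> real" where
  "norm_l2 f = sqrt (\<Sum>\<^sub>\<infinity>i. (norm (l2_nth f i))\<^sup>2)"

lemma norm_l2_sq: "(norm f)\<^sup>2 = (\<Sum>\<^sub>\<infinity>i. (norm (l2_nth f i))\<^sup>2)"
  unfolding norm_l2_def by (simp add: infsum_nonneg)

lemma norm_l2_nth_le: "norm (l2_nth f i) \<le> norm f"
proof -
  have "(\<Sum>j\<in>{i}. (norm (l2_nth f j))\<^sup>2) \<le> (\<Sum>\<^sub>\<infinity>i. (norm (l2_nth f i))\<^sup>2)"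
    by (rule finite_sum_le_infsum) (auto simp: l2_summable)
  then show ?thesis
    by (simp add: norm_l2_def infsum_nonneg real_le_rsqrt)
qed

definition sgn_l2 :: "('a, 'b) l2 \<Rightarrow> ('a, 'b) l2" where
  "sgn_l2 f = f /\<^sub>R norm f"

definition dist_l2 :: "('a, 'b) l2 \<Rightarrow> ('a, 'b) l2 \<Rightarrow> real" where
  "dist_l2 f g = norm (f - g)"

definition uniformity_l2 :: "(('a, 'b) l2 \<times> ('a, 'b) l2) filter" where
  "uniformity_l2 = (INF e\<in>{0<..}. principal {(x, y). dist x y < e})"

definition open_l2 :: "('a, 'b) l2 set \<Rightarrow> bool" where
  "open_l2 U = (\<forall>x\<in>U. \<forall>\<^sub>F (x', y) in uniformity. x' = x \<longrightarrow> y \<in> U)"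

definition inner_l2 :: "('a, 'b) l2 \<Rightarrow> ('a, 'b) l2 \<Rightarrow> real" where
  "inner_l2 f g = Re (\<Sum>\<^sub>\<infinity>i. cinner (l2_nth f i) (l2_nth g i))"

instance
proof
  fix f g h :: "('a, 'b) l2" and r :: real
  show "dist f g = norm (f - g)" by (rule dist_l2_def)
  show "sgn f = f /\<^sub>R norm f" by (rule sgn_l2_def)
  show "uniformity = (INF e\<in>{0<..}. principal {(x, y :: ('a, 'b) l2). dist x y < e})"
    by (rule uniformity_l2_def)
  show "open U = (\<forall>x\<in>U. \<forall>\<^sub>F (x', y) in uniformity. x' = x \<longrightarrow> y \<in> U)" for U :: "('a, 'b) l2 set"
    by (rule open_l2_def)
  have "(\<Sum>\<^sub>\<infinity>i. cinner (l2_nth f i) (l2_nth g i)) = cnj (\<Sum>\<^sub>\<infinity>i. cinner (l2_nth g i) (l2_nth f i))"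
    by (subst infsum_cnj[symmetric]) (rule infsum_cong, rule cinner_commute)
  then show "inner f g = inner g f"
    by (simp add: inner_l2_def)
  show "inner (f + g) h = inner f h + inner g h"
    by (simp add: inner_l2_def l2_nth_simps cinner_add_left infsum_add summable_cinner)
  show "inner (r *\<^sub>R f) g = r * inner f g"
    by (simp add: inner_l2_def l2_nth_simps scaleR_scaleC cinner_scaleC_left
        infsum_cmult_right summable_cinner)
  have *: "inner f f = (\<Sum>\<^sub>\<infinity>i. (norm (l2_nth f i))\<^sup>2)"
  proof -
    have "(\<Sum>\<^sub>\<infinity>i. cinner (l2_nth f i) (l2_nth f i)) =
        complex_of_real (\<Sum>\<^sub>\<infinity>i. (norm (l2_nth f i))\<^sup>2)"
      unfolding cinner_self
      by (rule infsumI[OF has_sum_bounded_linear[OF bounded_linear_of_real has_sum_infsum[OF l2_summable]]])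
    then show ?thesis
      by (simp add: inner_l2_def)
  qed
  show "0 \<le> inner f f"
    unfolding * by (rule infsum_nonneg) simp
  show "norm f = sqrt (inner f f)"
    unfolding * norm_l2_def ..
  show "inner f f = 0 \<longleftrightarrow> f = 0"
  proof
    assume "inner f f = 0"
    then have "norm f = 0"
      unfolding * norm_l2_def by simp
    then have "l2_nth f i = 0" for i
      using norm_l2_nth_le[of f i] by simp
    then show "f = 0"
      by (metis l2_nth_inject zero_l2.rep_eq ext)
  next
    assume "f = 0"
    then show "inner f f = 0"
      unfolding * by (simp add: l2_nth_simps)
  qed
qed

end

instantiation l2 :: (type, chilbert_space) chilbert_space
begin

lift_definition scaleC_l2 :: "complex \<Rightarrow> ('a, 'b) l2 \<Rightarrow> ('a, 'b) l2" is "\<lambda>c f i. c *\<^sub>C f i"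
  by (simp add: norm_scaleC power_mult_distrib summable_on_cmult_right)

definition cinner_l2 :: "('a, 'b) l2 \<Rightarrow> ('a, 'b) l2 \<Rightarrow> complex" where
  "cinner_l2 f g = (\<Sum>\<^sub>\<infinity>i. cinner (l2_nth f i) (l2_nth g i))"

instance
proof
  fix f g h :: "('a, 'b) l2" and c d :: complex and r :: real
  show "c *\<^sub>C (f + g) = c *\<^sub>C f + c *\<^sub>C g"
    by transfer (simp add: scaleC_add_right)
  show "(c + d) *\<^sub>C f = c *\<^sub>C f + d *\<^sub>C f"
    by transfer (simp add: scaleC_add_left)
  show "c *\<^sub>C d *\<^sub>C f = (c * d) *\<^sub>C f"
    by transfer (simp add: scaleC_scaleC)
  show "r *\<^sub>R f = complex_of_real r *\<^sub>C f"
    by transfer (simp add: scaleR_scaleC)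
  show "cinner f g = cnj (cinner g f)"
    unfolding cinner_l2_def
    by (subst infsum_cnj[symmetric]) (rule infsum_cong, rule cinner_commute)
  show "cinner f (g + h) = cinner f g + cinner f h"
    by (simp add: cinner_l2_def l2_nth_simps cinner_add_right infsum_add summable_cinner)
  show "cinner f (c *\<^sub>C g) = c * cinner f g"
    by (simp add: cinner_l2_def scaleC_l2.rep_eq cinner_scaleC_right
        infsum_cmult_right summable_cinner)
  show "inner f g = Re (cinner f g)"
    by (simp add: inner_l2_def cinner_l2_def)
next
  fix X :: "nat \<Rightarrow> ('a, 'b) l2"
  assume X: "Cauchy X"
  have "Cauchy (\<lambda>n. l2_nth (X n) i)" for i
  proof (rule metric_CauchyI)
    fix e :: real assume "0 < e"
    with X obtain N where "\<forall>m\<ge>N. \<forall>n\<ge>N. dist (X m) (X n) < e"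
      by (auto dest: metric_CauchyD)
    then show "\<exists>M. \<forall>m\<ge>M. \<forall>n\<ge>M. dist (l2_nth (X m) i) (l2_nth (X n) i) < e"
      by (metis dist_norm l2_nth_minus norm_l2_nth_le order.strict_trans1)
  qed
  then have "\<exists>l. (\<lambda>n. l2_nth (X n) i) \<longlonglongrightarrow> l" for i
    by (metis Cauchy_convergent convergent_def)
  then obtain f where f: "\<And>i. (\<lambda>n. l2_nth (X n) i) \<longlonglongrightarrow> f i"
    by metis
  have fin: "(\<Sum>i\<in>F. (norm (l2_nth (X m) i - f i))\<^sup>2) \<le> e\<^sup>2"
    if N: "\<forall>m\<ge>N. \<forall>n\<ge>N. dist (X m) (X n) < e" and "m \<ge> N" and "finite F" for e N m F
  proof (rule LIMSEQ_le_const2)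
    show "(\<lambda>n. \<Sum>i\<in>F. (norm (l2_nth (X m) i - l2_nth (X n) i))\<^sup>2)
        \<longlonglongrightarrow> (\<Sum>i\<in>F. (norm (l2_nth (X m) i - f i))\<^sup>2)"
      by (intro tendsto_intros f)
    have "(\<Sum>i\<in>F. (norm (l2_nth (X m) i - l2_nth (X n) i))\<^sup>2) \<le> e\<^sup>2" if "n \<ge> N" for n
    proof -
      have "(\<Sum>i\<in>F. (norm (l2_nth (X m - X n) i))\<^sup>2) \<le> (norm (X m - X n))\<^sup>2"
        unfolding norm_l2_sq using \<open>finite F\<close>
        by (intro finite_sum_le_infsum) (auto simp: l2_summable)
      also have "\<dots> \<le> e\<^sup>2"
        using N \<open>m \<ge> N\<close> \<open>n \<ge> N\<close> by (intro power_mono) (auto simp: dist_norm less_imp_le)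
      finally show ?thesis
        by (simp add: l2_nth_minus)
    qed
    then show "\<exists>N. \<forall>n\<ge>N. (\<Sum>i\<in>F. (norm (l2_nth (X m) i - l2_nth (X n) i))\<^sup>2) \<le> e\<^sup>2"
      by blast
  qed
  have sm: "(\<lambda>i. (norm (l2_nth (X m) i - f i))\<^sup>2) summable_on UNIV"
    if "\<forall>m\<ge>N. \<forall>n\<ge>N. dist (X m) (X n) < e" and "m \<ge> N" for e N m
    using fin[OF that]
    by (intro nonneg_bounded_partial_sums_imp_summable_on[where C = "e\<^sup>2"])
       (auto intro: eventually_finite_subsets_at_top_weakI)
  obtain N1 where N1: "\<forall>m\<ge>N1. \<forall>n\<ge>N1. dist (X m) (X n) < 1"
    using X by (meson metric_CauchyD zero_less_one)
  define g where "g = X N1 - Abs_l2 (\<lambda>i. l2_nth (X N1) i - f i)"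
  have g: "l2_nth g i = f i" for i
    using sm[OF N1 order_refl] by (simp add: g_def l2_nth_minus Abs_l2_inverse)
  have "X \<longlonglongrightarrow> g"
  proof (rule metric_LIMSEQ_I)
    fix e :: real assume e: "0 < e"
    then obtain N where N: "\<forall>m\<ge>N. \<forall>n\<ge>N. dist (X m) (X n) < e / 2"
      using metric_CauchyD[OF X, of "e / 2"] by auto
    have "dist (X m) g < e" if m: "m \<ge> N" for m
    proof -
      have "(norm (X m - g))\<^sup>2 \<le> (e / 2)\<^sup>2"
        unfolding norm_l2_sq l2_nth_minus g
        by (rule infsum_le_finite_sums[OF sm[OF N m]]) (use fin[OF N m] in auto)
      then have "norm (X m - g) \<le> e / 2"
        using e by (simp add: power2_le_iff_abs_le)
      then show ?thesis
        using e by (simp add: dist_norm)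
    qed
    then show "\<exists>N. \<forall>m\<ge>N. dist (X m) g < e"
      by blast
  qed
  then show "convergent X"
    by (auto simp: convergent_def)
qed

end

section \<open>Closed subspaces and orthonormal bases\<close>

definition hilbert_subspace :: "'a :: chilbert_space set \<Rightarrow> bool" where
  "hilbert_subspace M \<longleftrightarrow> closed M \<and> 0 \<in> M \<and> (\<forall>x\<in>M. \<forall>y\<in>M. x + y \<in> M) \<and>
     (\<forall>c. \<forall>x\<in>M. c *\<^sub>C x \<in> M)"

lemma hilbert_subspace_UNIV: "hilbert_subspace UNIV"
  by (simp add: hilbert_subspace_def)

lemma hilbert_subspace_sum:
  assumes "hilbert_subspace M" "\<And>i. i \<in> A \<Longrightarrow> f i \<in> M"
  shows "sum f A \<in> M"
  using assms(2) by (induction A rule: infinite_finite_induct)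
    (use assms(1) in \<open>auto simp: hilbert_subspace_def\<close>)

lemma hilbert_subspace_has_sum:
  assumes M: "hilbert_subspace M" and f: "\<And>i. i \<in> A \<Longrightarrow> f i \<in> M" and s: "(f has_sum s) A"
  shows "s \<in> M"
proof (rule Lim_in_closed_set)
  show "closed M"
    using M by (simp add: hilbert_subspace_def)
  show "\<forall>\<^sub>F F in finite_subsets_at_top A. sum f F \<in> M"
    by (intro eventually_finite_subsets_at_top_weakI hilbert_subspace_sum[OF M]) (auto intro: f)
  show "(sum f \<longlongrightarrow> s) (finite_subsets_at_top A)"
    using s by (simp add: has_sum_def)
qed simp

definition orthonormal :: "'a :: chilbert_space set \<Rightarrow> bool" where
  "orthonormal B \<longleftrightarrow> (\<forall>x\<in>B. \<forall>y\<in>B. cinner x y = (if x = y then 1 else 0))"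

text \<open>Orthonormal bases of the closed subspace \<open>M\<close>, as maximal orthonormal subsets.\<close>

definition is_onb :: "'a :: chilbert_space set \<Rightarrow> 'a set \<Rightarrow> bool" where
  "is_onb M B \<longleftrightarrow> B \<subseteq> M \<and> orthonormal B \<and> (\<forall>x\<in>M. (\<forall>e\<in>B. cinner e x = 0) \<longrightarrow> x = 0)"

lemma onb_exists:
  fixes M :: "'a :: chilbert_space set"
  assumes M: "hilbert_subspace M"
  shows "\<exists>B. is_onb M B"
proof -
  let ?A = "{B. B \<subseteq> M \<and> orthonormal B}"
  have "\<exists>B\<in>?A. \<forall>X\<in>?A. B \<subseteq> X \<longrightarrow> X = B"
  proof (rule subset_Zorn_nonempty)
    show "?A \<noteq> {}"
      by (auto simp: orthonormal_def intro: exI[of _ "{}"])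
    fix C assume C: "C \<noteq> {}" "subset.chain ?A C"
    have "orthonormal (\<Union>C)"
      unfolding orthonormal_def
    proof (intro ballI)
      fix x y assume "x \<in> \<Union>C" "y \<in> \<Union>C"
      then obtain S T where ST: "S \<in> C" "T \<in> C" "x \<in> S" "y \<in> T"
        by blast
      then have "S \<subseteq> T \<or> T \<subseteq> S"
        using C(2) by (auto simp: subset_chain_def)
      then obtain U where "U \<in> C" "x \<in> U" "y \<in> U"
        using ST by blast
      moreover from this have "orthonormal U"
        using C(2) by (auto simp: subset_chain_def)
      ultimately show "cinner x y = (if x = y then 1 else 0)"
        by (simp add: orthonormal_def)
    qed
    moreover have "\<Union>C \<subseteq> M"
      using C(2) by (auto simp: subset_chain_def)
    ultimately show "\<Union>C \<in> ?A"
      by simp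
  qed
  then obtain B where B: "B \<subseteq> M" "orthonormal B"
      and mx: "\<And>X. X \<subseteq> M \<Longrightarrow> orthonormal X \<Longrightarrow> B \<subseteq> X \<Longrightarrow> X = B"
    by auto
  have "x = 0" if "x \<in> M" and x: "\<forall>e\<in>B. cinner e x = 0" for x
  proof (rule ccontr)
    assume "x \<noteq> 0"
    define u where "u = complex_of_real (inverse (norm x)) *\<^sub>C x"
    have "norm u = 1"
      using \<open>x \<noteq> 0\<close> by (simp add: u_def norm_scaleC norm_inverse)
    then have u: "cinner u u = 1"
      by (simp add: cinner_self)
    have uB: "cinner e u = 0" "cinner u e = 0" if "e \<in> B" for e
      using x that cinner_commute[of u e] by (auto simp: u_def cinner_scaleC_right)
    have "orthonormal (insert u B)"
      using B(2) u uB by (auto simp: orthonormal_def)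
    moreover have "u \<in> M"
      using M \<open>x \<in> M\<close> by (auto simp: u_def hilbert_subspace_def)
    ultimately have "u \<in> B"
      using mx[of "insert u B"] B(1) by blast
    then show False
      using u uB by auto
  qed
  with B show ?thesis
    by (auto simp: is_onb_def)
qed

lemma cinner_orthonormal_sums:
  assumes "orthonormal B" "finite F" "F \<subseteq> B"
  shows "cinner (\<Sum>e\<in>F. c e *\<^sub>C e) (\<Sum>e\<in>F. d e *\<^sub>C e) = (\<Sum>e\<in>F. cnj (c e) * d e)"
proof -
  have "cinner (\<Sum>e\<in>F. c e *\<^sub>C e) (\<Sum>e\<in>F. d e *\<^sub>C e) =
      (\<Sum>e\<in>F. \<Sum>e'\<in>F. cnj (c e') * (d e * cinner e' e))"
    by (simp add: cinner_sum_left cinner_sum_right cinner_scaleC_left cinner_scaleC_right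
        sum_distrib_left mult_ac)
  also have "\<dots> = (\<Sum>e\<in>F. \<Sum>e'\<in>F. if e' = e then cnj (c e') * d e else 0)"
    using assms by (intro sum.cong refl) (auto simp: orthonormal_def subset_iff)
  also have "\<dots> = (\<Sum>e\<in>F. cnj (c e) * d e)"
    using assms by (intro sum.cong refl) simp
  finally show ?thesis .
qed

lemma norm_orthonormal_sum:
  assumes "orthonormal B" "finite F" "F \<subseteq> B"
  shows "(norm (\<Sum>e\<in>F. c e *\<^sub>C e))\<^sup>2 = (\<Sum>e\<in>F. (cmod (c e))\<^sup>2)"
proof -
  have "complex_of_real ((norm (\<Sum>e\<in>F. c e *\<^sub>C e))\<^sup>2) = complex_of_real (\<Sum>e\<in>F. (cmod (c e))\<^sup>2)"
    using cinner_orthonormal_sums[OF assms, of c c]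
    by (simp only: cinner_self of_real_sum complex_norm_square mult.commute)
  then show ?thesis
    by (simp only: of_real_eq_iff)
qed

lemma bessel:
  assumes "orthonormal B" "finite F" "F \<subseteq> B"
  shows "(\<Sum>e\<in>F. (cmod (cinner e x))\<^sup>2) \<le> (norm x)\<^sup>2"
proof -
  define v where "v = (\<Sum>e\<in>F. cinner e x *\<^sub>C e)"
  have nv: "(norm v)\<^sup>2 = (\<Sum>e\<in>F. (cmod (cinner e x))\<^sup>2)"
    unfolding v_def by (rule norm_orthonormal_sum[OF assms])
  have "cinner v x = (\<Sum>e\<in>F. complex_of_real ((cmod (cinner e x))\<^sup>2))"
    unfolding v_def cinner_sum_left cinner_scaleC_left
    by (intro sum.cong refl) (simp only: complex_norm_square mult.commute)
  then have "inner v x = (norm v)\<^sup>2"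
    by (simp add: inner_eq_Re_cinner nv flip: of_real_sum of_real_power)
  then have "(norm v)\<^sup>2 \<le> norm v * norm x"
    using norm_cauchy_schwarz[of v x] by simp
  then have "norm v \<le> norm x"
    by (cases "v = 0") (auto simp: power2_eq_square)
  then show ?thesis
    unfolding nv[symmetric] by (simp add: power_mono)
qed

lemma summable_on_CauchyI:
  fixes f :: "'i \<Rightarrow> 'v :: banach"
  assumes "\<And>e. e > 0 \<Longrightarrow> \<exists>F0. finite F0 \<and> F0 \<subseteq> A \<and>
     (\<forall>F. finite F \<and> F \<subseteq> A - F0 \<longrightarrow> norm (sum f F) < e)"
  shows "f summable_on A"
proof -
  have "\<exists>P. eventually P (finite_subsets_at_top A) \<and>
      (\<forall>F F'. P F \<and> P F' \<longrightarrow> dist (sum f F) (sum f F') < e)" if e: "e > 0" for e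
  proof -
    obtain F0 where F0: "finite F0" "F0 \<subseteq> A"
        and F: "\<And>F. finite F \<Longrightarrow> F \<subseteq> A - F0 \<Longrightarrow> norm (sum f F) < e / 2"
      using assms[of "e / 2"] e by auto
    define P where "P F \<longleftrightarrow> finite F \<and> F0 \<subseteq> F \<and> F \<subseteq> A" for F
    have "eventually P (finite_subsets_at_top A)"
      unfolding eventually_finite_subsets_at_top P_def using F0 by blast
    moreover have "dist (sum f F1) (sum f F2) < e" if "P F1" "P F2" for F1 F2
    proof -
      have *: "dist (sum f F') (sum f F0) < e / 2" if "P F'" for F'
      proof -
        have "sum f F' - sum f F0 = sum f (F' - F0)"
          using that by (subst sum_diff) (auto simp: P_def)
        then show ?thesis
          using F[of "F' - F0"] that by (auto simp: dist_norm P_def)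
      qed
      show ?thesis
        using *[OF that(1)] *[OF that(2)] by (rule dist_triangle_half_l)
    qed
    ultimately show ?thesis
      by blast
  qed
  then have "cauchy_filter (filtermap (sum f) (finite_subsets_at_top A))"
    by (simp add: cauchy_filter_metric_filtermap)
  moreover have "complete (UNIV :: 'v set)"
    by (meson Cauchy_convergent UNIV_I complete_def convergent_def)
  ultimately obtain L where "(sum f \<longlongrightarrow> L) (finite_subsets_at_top A)"
    using complete_uniform[where S = UNIV] by (force simp add: filterlim_def)
  then show ?thesis
    using summable_on_def has_sum_def by blast
qed

lemma summable_on_tail:
  fixes f :: "'i \<Rightarrow> real"
  assumes f: "f summable_on A" and nn: "\<And>i. f i \<ge> 0" and e: "e > 0"
  shows "\<exists>F0. finite F0 \<and> F0 \<subseteq> A \<and> (\<forall>F. finite F \<and> F \<subseteq> A - F0 \<longrightarrow> sum f F < e)"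
proof -
  obtain F0 where F0: "finite F0" "F0 \<subseteq> A" "dist (sum f F0) (infsum f A) \<le> e / 2"
    using infsum_finite_approximation[OF f, of "e / 2"] e by auto
  have "sum f F < e" if "finite F" "F \<subseteq> A - F0" for F
  proof -
    have "sum f F0 + sum f F = sum f (F0 \<union> F)"
      using that F0 by (subst sum.union_disjoint) auto
    also have "\<dots> \<le> infsum f A"
      using that F0 by (intro finite_sum_le_infsum f) (auto simp: nn)
    finally show ?thesis
      using F0(3) e unfolding dist_real_def by linarith
  qed
  with F0 show ?thesis
    by blast
qed

lemma orthonormal_summable:
  assumes B: "orthonormal B" and c: "(\<lambda>e. (cmod (c e))\<^sup>2) summable_on B"
  shows "(\<lambda>e. c e *\<^sub>C e) summable_on B"
proof (rule summable_on_CauchyI)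
  fix e :: real assume e: "e > 0"
  obtain F0 where F0: "finite F0" "F0 \<subseteq> B"
      and F: "\<And>F. finite F \<Longrightarrow> F \<subseteq> B - F0 \<Longrightarrow> (\<Sum>e\<in>F. (cmod (c e))\<^sup>2) < e\<^sup>2"
    using summable_on_tail[OF c, of "e\<^sup>2"] e by auto
  have "norm (\<Sum>e\<in>F. c e *\<^sub>C e) < e" if "finite F" "F \<subseteq> B - F0" for F
  proof -
    have "(norm (\<Sum>e\<in>F. c e *\<^sub>C e))\<^sup>2 < e\<^sup>2"
      using F[OF that] that by (subst norm_orthonormal_sum[OF B]) auto
    then show ?thesis
      using e by (simp add: power2_less_imp_less)
  qed
  with F0 show "\<exists>F0. finite F0 \<and> F0 \<subseteq> B \<and>
      (\<forall>F. finite F \<and> F \<subseteq> B - F0 \<longrightarrow> norm (\<Sum>e\<in>F. c e *\<^sub>C e) < e)"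
    by blast
qed

lemma bessel_summable:
  assumes "orthonormal B"
  shows "(\<lambda>e. (cmod (cinner e x))\<^sup>2) summable_on B"
  by (rule nonneg_bounded_partial_sums_imp_summable_on[where C = "(norm x)\<^sup>2"])
     (auto intro!: eventually_finite_subsets_at_top_weakI bessel[OF assms])

lemma cinner_orthonormal_has_sum:
  assumes B: "orthonormal B" and s: "((\<lambda>e. c e *\<^sub>C e) has_sum s) B" and e: "e \<in> B"
  shows "cinner e s = c e"
proof -
  have "((\<lambda>e'. cinner e (c e' *\<^sub>C e')) has_sum cinner e s) B"
    by (rule has_sum_bounded_linear[OF bounded_linear_cinner_right s])
  moreover have "((\<lambda>e'. cinner e (c e' *\<^sub>C e')) has_sum c e) B"
  proof (rule has_sum_finite_neutralI[where B = "{e}"])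
    show "c e = (\<Sum>e'\<in>{e}. cinner e (c e' *\<^sub>C e'))"
      using B e by (simp add: cinner_scaleC_right orthonormal_def)
    show "cinner e (c e' *\<^sub>C e') = 0" if "e' \<in> B - {e}" for e'
      using B e that by (auto simp: cinner_scaleC_right orthonormal_def)
  qed (use e in auto)
  ultimately show ?thesis
    by (rule has_sum_unique)
qed

lemma onb_expansion:
  assumes M: "hilbert_subspace M" and B: "is_onb M B" and x: "x \<in> M"
  shows "((\<lambda>e. cinner e x *\<^sub>C e) has_sum x) B"
proof -
  have o: "orthonormal B" and "B \<subseteq> M"
    using B by (auto simp: is_onb_def)
  have "(\<lambda>e. cinner e x *\<^sub>C e) summable_on B"
    by (intro orthonormal_summable bessel_summable o)
  then obtain s where s: "((\<lambda>e. cinner e x *\<^sub>C e) has_sum s) B"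
    by (auto simp: summable_on_def)
  have "s \<in> M"
    by (rule hilbert_subspace_has_sum[OF M _ s])
       (use M \<open>B \<subseteq> M\<close> in \<open>auto simp: hilbert_subspace_def\<close>)
  then have "x - s \<in> M"
    using M x unfolding hilbert_subspace_def
    by (metis add_uminus_conv_diff scaleC_minus_one)
  moreover have "\<forall>e\<in>B. cinner e (x - s) = 0"
    by (simp add: cinner_diff_right cinner_orthonormal_has_sum[OF o s])
  ultimately have "x - s = 0"
    using B by (auto simp: is_onb_def)
  with s show ?thesis
    by simp
qed

lemma parseval:
  assumes M: "hilbert_subspace M" and B: "is_onb M B" and y: "y \<in> M"
  shows "((\<lambda>e. cinner x e * cinner e y) has_sum cinner x y) B"
proof -
  have "((\<lambda>e. cinner x (cinner e y *\<^sub>C e)) has_sum cinner x y) B"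
    by (rule has_sum_bounded_linear[OF bounded_linear_cinner_right onb_expansion[OF M B y]])
  then show ?thesis
    by (simp add: cinner_scaleC_right mult.commute)
qed

text \<open>A fixed orthonormal basis of the whole space, used only to construct tensor products.\<close>

definition onb :: "'a :: chilbert_space set" where
  "onb = (SOME B. is_onb UNIV B)"

lemma is_onb_onb: "is_onb UNIV (onb :: 'a :: chilbert_space set)"
  unfolding onb_def by (rule someI_ex[OF onb_exists[OF hilbert_subspace_UNIV]])

lemma orthonormal_onb: "orthonormal onb"
  by (rule is_onb_onb[unfolded is_onb_def, THEN conjunct2, THEN conjunct1])

lemmas onb_expansion' = onb_expansion[OF hilbert_subspace_UNIV is_onb_onb UNIV_I]
lemmas parseval' = parseval[OF hilbert_subspace_UNIV is_onb_onb UNIV_I]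

section \<open>Tensor products of Hilbert spaces\<close>

text \<open>The Hilbert tensor product is modelled by the families \<open>(f e)\<close> indexed by an orthonormal
  basis of \<open>'a\<close>, with \<open>x \<otimes> y\<close> represented by \<open>\<lambda>e. \<langle>e, x\<rangle> y\<close>. The model is characterised,
  up to unitary equivalence, by the lemmas \<open>cinner_tensor\<close> and \<open>tensor_total\<close> below.\<close>

typedef (overloaded) ('a :: chilbert_space, 'b :: chilbert_space) htensor =
  "{f :: ('a, 'b) l2. \<forall>e. e \<notin> onb \<longrightarrow> l2_nth f e = 0}"
  morphisms l2_of_htensor Abs_htensor
  by (rule exI[of _ 0]) (simp add: l2_nth_simps)

setup_lifting type_definition_htensor

instantiation htensor :: (chilbert_space, chilbert_space) real_vector
begin

lift_definition zero_htensor :: "('a, 'b) htensor" is 0 by (simp add: l2_nth_simps)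
lift_definition plus_htensor :: "('a, 'b) htensor \<Rightarrow> ('a, 'b) htensor \<Rightarrow> ('a, 'b) htensor" is "(+)"
  by (simp add: l2_nth_simps)
lift_definition minus_htensor :: "('a, 'b) htensor \<Rightarrow> ('a, 'b) htensor \<Rightarrow> ('a, 'b) htensor" is "(-)"
  by (simp add: l2_nth_simps)
lift_definition uminus_htensor :: "('a, 'b) htensor \<Rightarrow> ('a, 'b) htensor" is uminus
  by (simp add: l2_nth_simps)
lift_definition scaleR_htensor :: "real \<Rightarrow> ('a, 'b) htensor \<Rightarrow> ('a, 'b) htensor" is scaleR
  by (simp add: l2_nth_simps)

instance
proof
  fix f g h :: "('a, 'b) htensor" and r s :: real
  show "f + g + h = f + (g + h)" by transfer (simp add: add.assoc)
  show "f + g = g + f" by transfer (simp add: add.commute)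
  show "0 + f = f" by transfer simp
  show "- f + f = 0" by transfer simp
  show "f - g = f + - g" by transfer simp
  show "r *\<^sub>R (f + g) = r *\<^sub>R f + r *\<^sub>R g" by transfer (simp add: scaleR_add_right)
  show "(r + s) *\<^sub>R f = r *\<^sub>R f + s *\<^sub>R f" by transfer (simp add: scaleR_add_left)
  show "r *\<^sub>R s *\<^sub>R f = (r * s) *\<^sub>R f" by transfer simp
  show "1 *\<^sub>R f = f" by transfer simp
qed

end

instantiation htensor :: (chilbert_space, chilbert_space) real_inner
begin

lift_definition norm_htensor :: "('a, 'b) htensor \<Rightarrow> real" is norm .
lift_definition sgn_htensor :: "('a, 'b) htensor \<Rightarrow> ('a, 'b) htensor" is sgn
  by (simp add: sgn_div_norm l2_nth_simps)
lift_definition dist_htensor :: "('a, 'b) htensor \<Rightarrow> ('a, 'b) htensor \<Rightarrow> real" is dist .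
lift_definition inner_htensor :: "('a, 'b) htensor \<Rightarrow> ('a, 'b) htensor \<Rightarrow> real" is inner .

definition uniformity_htensor :: "(('a, 'b) htensor \<times> ('a, 'b) htensor) filter" where
  "uniformity_htensor = (INF e\<in>{0<..}. principal {(x, y). dist x y < e})"

definition open_htensor :: "('a, 'b) htensor set \<Rightarrow> bool" where
  "open_htensor U = (\<forall>x\<in>U. \<forall>\<^sub>F (x', y) in uniformity. x' = x \<longrightarrow> y \<in> U)"

instance
proof
  fix f g h :: "('a, 'b) htensor" and r :: real
  show "dist f g = norm (f - g)" by transfer (rule dist_norm)
  show "sgn f = f /\<^sub>R norm f" by transfer (rule sgn_div_norm)
  show "uniformity = (INF e\<in>{0<..}. principal {(x, y :: ('a, 'b) htensor). dist x y < e})"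
    by (rule uniformity_htensor_def)
  show "open U = (\<forall>x\<in>U. \<forall>\<^sub>F (x', y) in uniformity. x' = x \<longrightarrow> y \<in> U)"
    for U :: "('a, 'b) htensor set"
    by (rule open_htensor_def)
  show "inner f g = inner g f" by transfer (rule inner_commute)
  show "inner (f + g) h = inner f h + inner g h" by transfer (rule inner_add_left)
  show "inner (r *\<^sub>R f) g = r * inner f g" by transfer simp
  show "0 \<le> inner f f" by transfer simp
  show "inner f f = 0 \<longleftrightarrow> f = 0" by transfer simp
  show "norm f = sqrt (inner f f)" by transfer (rule norm_eq_sqrt_inner)
qed

end

instantiation htensor :: (chilbert_space, chilbert_space) chilbert_space
begin

lift_definition scaleC_htensor :: "complex \<Rightarrow> ('a, 'b) htensor \<Rightarrow> ('a, 'b) htensor" is scaleC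
  by (simp add: scaleC_l2.rep_eq)
lift_definition cinner_htensor :: "('a, 'b) htensor \<Rightarrow> ('a, 'b) htensor \<Rightarrow> complex" is cinner .

instance
proof
  fix f g h :: "('a, 'b) htensor" and r :: real and c d :: complex
  show "c *\<^sub>C (f + g) = c *\<^sub>C f + c *\<^sub>C g" by transfer (rule scaleC_add_right)
  show "(c + d) *\<^sub>C f = c *\<^sub>C f + d *\<^sub>C f" by transfer (rule scaleC_add_left)
  show "c *\<^sub>C d *\<^sub>C f = (c * d) *\<^sub>C f" by transfer (rule scaleC_scaleC)
  show "r *\<^sub>R f = complex_of_real r *\<^sub>C f" by transfer (rule scaleR_scaleC)
  show "cinner f g = cnj (cinner g f)" by transfer (rule cinner_commute)
  show "cinner f (g + h) = cinner f g + cinner f h" by transfer (rule cinner_add_right)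
  show "cinner f (c *\<^sub>C g) = c * cinner f g" by transfer (rule cinner_scaleC_right)
  show "inner f g = Re (cinner f g)" by transfer (rule inner_eq_Re_cinner)
next
  fix X :: "nat \<Rightarrow> ('a, 'b) htensor"
  assume X: "Cauchy X"
  have d: "dist (l2_of_htensor f) (l2_of_htensor g) = dist f g" for f g :: "('a, 'b) htensor"
    by (simp add: dist_htensor.rep_eq)
  have "Cauchy (\<lambda>n. l2_of_htensor (X n))"
    using X unfolding Cauchy_def d .
  then obtain g where g: "(\<lambda>n. l2_of_htensor (X n)) \<longlonglongrightarrow> g"
    by (metis Cauchy_convergent convergent_def)
  have "l2_nth g e = 0" if "e \<notin> onb" for e
  proof -
    have "norm (l2_nth g e) \<le> dist (l2_of_htensor (X n)) g" for n
      using norm_l2_nth_le[of "l2_of_htensor (X n) - g" e] l2_of_htensor[of "X n"] that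
      by (simp add: dist_norm l2_nth_minus)
    moreover have "(\<lambda>n. dist (l2_of_htensor (X n)) g) \<longlonglongrightarrow> 0"
      using g by (rule tendsto_dist_iff[THEN iffD1])
    ultimately have "norm (l2_nth g e) \<le> 0"
      by (intro LIMSEQ_le_const) auto
    then show ?thesis
      by simp
  qed
  then have "l2_of_htensor (Abs_htensor g) = g"
    by (simp add: Abs_htensor_inverse)
  then have "dist (X n) (Abs_htensor g) = dist (l2_of_htensor (X n)) g" for n
    by (simp add: d[symmetric])
  then have "X \<longlonglongrightarrow> Abs_htensor g"
    using g by (simp add: tendsto_dist_iff[of X] tendsto_dist_iff[of "\<lambda>n. l2_of_htensor (X n)"])
  then show "convergent X"
    by (auto simp: convergent_def)
qed

end

lift_definition tensor_l2 :: "'a :: chilbert_space \<Rightarrow> 'b :: chilbert_space \<Rightarrow> ('a, 'b) l2" is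
  "\<lambda>x y e. if e \<in> onb then cinner e x *\<^sub>C y else 0"
proof -
  fix x :: 'a and y :: 'b
  have "(\<lambda>e. (cmod (cinner e x))\<^sup>2 * (norm y)\<^sup>2) summable_on onb"
    by (intro summable_on_cmult_left bessel_summable orthonormal_onb)
  then show "(\<lambda>e. (norm (if e \<in> onb then cinner e x *\<^sub>C y else 0))\<^sup>2) summable_on UNIV"
    by (rule summable_on_cong_neutral[THEN iffD1, rotated -1])
       (auto simp: norm_scaleC power_mult_distrib)
qed

lift_definition tensor ::
    "'a :: chilbert_space \<Rightarrow> 'b :: chilbert_space \<Rightarrow> ('a, 'b) htensor" (infixl "\<otimes>" 70)
  is tensor_l2
  by (simp add: tensor_l2.rep_eq)

abbreviation htensor_nth :: "('a :: chilbert_space, 'b :: chilbert_space) htensor \<Rightarrow> 'a \<Rightarrow> 'b" where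
  "htensor_nth f \<equiv> l2_nth (l2_of_htensor f)"

lemma htensor_nth_tensor: "htensor_nth (x \<otimes> y) e = (if e \<in> onb then cinner e x *\<^sub>C y else 0)"
  by (simp add: tensor.rep_eq tensor_l2.rep_eq)

lemma htensor_nth_not_onb: "e \<notin> onb \<Longrightarrow> htensor_nth f e = 0"
  using l2_of_htensor[of f] by simp

lemma htensor_eqI: "(\<And>e. htensor_nth f e = htensor_nth g e) \<Longrightarrow> f = g"
  by (metis l2_nth_inject l2_of_htensor_inject ext)

lemma htensor_nth_simps:
  "htensor_nth 0 e = 0"
  "htensor_nth (f + g) e = htensor_nth f e + htensor_nth g e"
  "htensor_nth (f - g) e = htensor_nth f e - htensor_nth g e"
  "htensor_nth (r *\<^sub>R f) e = r *\<^sub>R htensor_nth f e"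
  "htensor_nth (c *\<^sub>C f) e = c *\<^sub>C htensor_nth f e"
  by (simp_all add: zero_htensor.rep_eq plus_htensor.rep_eq minus_htensor.rep_eq
      scaleR_htensor.rep_eq scaleC_htensor.rep_eq l2_nth_simps scaleC_l2.rep_eq)

lemma htensor_nth_sum: "htensor_nth (sum f A) e = (\<Sum>a\<in>A. htensor_nth (f a) e)"
  by (induction A rule: infinite_finite_induct) (auto simp: htensor_nth_simps)

lemma tensor_add_left: "(x + x') \<otimes> y = x \<otimes> y + x' \<otimes> y"
  by (rule htensor_eqI)
     (auto simp: htensor_nth_tensor htensor_nth_simps cinner_add_right scaleC_add_left)

lemma tensor_add_right: "x \<otimes> (y + y') = x \<otimes> y + x \<otimes> y'"
  by (rule htensor_eqI) (auto simp: htensor_nth_tensor htensor_nth_simps scaleC_add_right)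

lemma tensor_scaleC_left: "(c *\<^sub>C x) \<otimes> y = c *\<^sub>C (x \<otimes> y)"
  by (rule htensor_eqI)
     (auto simp: htensor_nth_tensor htensor_nth_simps cinner_scaleC_right scaleC_scaleC)

lemma tensor_scaleC_right: "x \<otimes> (c *\<^sub>C y) = c *\<^sub>C (x \<otimes> y)"
  by (rule htensor_eqI)
     (auto simp: htensor_nth_tensor htensor_nth_simps scaleC_scaleC mult.commute)

lemma cinner_tensor: "cinner (x \<otimes> y) (x' \<otimes> y') = cinner x x' * cinner y y'"
proof -
  have "((\<lambda>e. cinner x e * cinner e x' * cinner y y') has_sum cinner x x' * cinner y y') onb"
    by (rule has_sum_cmult_left[OF parseval'])
  then have "((\<lambda>e. cinner (htensor_nth (x \<otimes> y) e) (htensor_nth (x' \<otimes> y') e))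
      has_sum cinner x x' * cinner y y') UNIV"
    by (rule has_sum_cong_neutral[THEN iffD1, rotated -1])
       (auto simp: htensor_nth_tensor cinner_scaleC_left cinner_scaleC_right
          cinner_commute[symmetric])
  then show ?thesis
    by (simp add: cinner_htensor.rep_eq cinner_l2_def infsumI)
qed

lemma norm_tensor: "norm (x \<otimes> y) = norm x * norm y"
proof -
  have "complex_of_real ((norm (x \<otimes> y))\<^sup>2) = complex_of_real ((norm x * norm y)\<^sup>2)"
    by (simp only: cinner_self[symmetric] cinner_tensor power_mult_distrib of_real_mult)
  then have "(norm (x \<otimes> y))\<^sup>2 = (norm x * norm y)\<^sup>2"
    by (simp only: of_real_eq_iff)
  then show ?thesis
    by simp
qed

lemma bounded_linear_tensor_left: "bounded_linear (\<lambda>x. x \<otimes> y)"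
  by (rule bounded_linear_intro[where K = "norm y"])
     (simp_all add: tensor_add_left scaleR_scaleC tensor_scaleC_left norm_tensor)

lemma norm_htensor_sq: "(norm f)\<^sup>2 = (\<Sum>\<^sub>\<infinity>e. (norm (htensor_nth f e))\<^sup>2)"
  by (simp add: norm_htensor.rep_eq norm_l2_sq)

lemma htensor_has_sum: "((\<lambda>e. e \<otimes> htensor_nth f e) has_sum f) onb"
  unfolding has_sum_def
proof (rule metric_tendsto_imp_tendsto)
  let ?g = "\<lambda>e. (norm (htensor_nth f e))\<^sup>2"
  have g: "?g summable_on A" for A
    by (rule l2_summable)
  have I: "infsum ?g onb = infsum ?g UNIV"
    by (rule infsum_cong_neutral) (auto simp: htensor_nth_not_onb)
  have "((\<lambda>F. sum ?g F) \<longlongrightarrow> infsum ?g UNIV) (finite_subsets_at_top onb)"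
    using has_sum_infsum[OF g, of onb] by (simp add: has_sum_def I)
  then show "((\<lambda>F. sqrt (infsum ?g UNIV - sum ?g F)) \<longlongrightarrow> sqrt (infsum ?g UNIV - infsum ?g UNIV))
      (finite_subsets_at_top onb)"
    by (intro tendsto_intros)
  have "dist (\<Sum>e\<in>F. e \<otimes> htensor_nth f e) f = sqrt (infsum ?g UNIV - sum ?g F)"
    if F: "finite F" "F \<subseteq> onb" for F
  proof -
    have n: "htensor_nth (f - (\<Sum>e\<in>F. e \<otimes> htensor_nth f e)) e =
        (if e \<in> F then 0 else htensor_nth f e)" for e
    proof -
      have "(\<Sum>e'\<in>F. htensor_nth (e' \<otimes> htensor_nth f e') e) =
          (\<Sum>e'\<in>F. if e' = e then htensor_nth f e else 0)"
        using F orthonormal_onb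
        by (intro sum.cong refl) (auto simp: htensor_nth_tensor orthonormal_def subset_iff
            htensor_nth_not_onb)
      then show ?thesis
        using F by (simp add: htensor_nth_simps htensor_nth_sum)
    qed
    have "(norm (f - (\<Sum>e\<in>F. e \<otimes> htensor_nth f e)))\<^sup>2 =
        (\<Sum>\<^sub>\<infinity>e. (norm (if e \<in> F then 0 else htensor_nth f e))\<^sup>2)"
      unfolding norm_htensor_sq n ..
    also have "\<dots> = infsum ?g (UNIV - F)"
      by (rule infsum_cong_neutral) auto
    also have "\<dots> = infsum ?g UNIV - sum ?g F"
      using F by (subst infsum_Diff) (auto simp: g)
    finally have "sqrt (infsum ?g UNIV - sum ?g F) = norm (f - (\<Sum>e\<in>F. e \<otimes> htensor_nth f e))"
      by (rule real_sqrt_unique) simp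
    then show ?thesis
      by (simp only: dist_norm norm_minus_commute)
  qed
  then show "\<forall>\<^sub>F F in finite_subsets_at_top onb. dist (\<Sum>e\<in>F. e \<otimes> htensor_nth f e) f \<le>
      dist (sqrt (infsum ?g UNIV - sum ?g F)) (sqrt (infsum ?g UNIV - infsum ?g UNIV))"
    by (intro eventually_finite_subsets_at_top_weakI) (simp add: dist_real_def)
qed

text \<open>Finite sums of elementary tensors are dense.\<close>

lemma tensor_total:
  "closure (range (\<lambda>ps :: ('a :: chilbert_space \<times> 'b :: chilbert_space) list.
     \<Sum>(x, y)\<leftarrow>ps. x \<otimes> y)) = UNIV" (is "closure ?S = _")
proof -
  have "f \<in> closure ?S" for f :: "('a, 'b) htensor"
  proof (rule Lim_in_closed_set)
    show "(sum (\<lambda>e. e \<otimes> htensor_nth f e) \<longlongrightarrow> f) (finite_subsets_at_top onb)"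
      using htensor_has_sum[of f] by (simp add: has_sum_def)
    have "(\<Sum>e\<in>F. e \<otimes> htensor_nth f e) \<in> ?S" if "finite F" for F
    proof -
      obtain es where "set es = F" "distinct es"
        using finite_distinct_list[OF \<open>finite F\<close>] by blast
      then have "(\<Sum>e\<in>F. e \<otimes> htensor_nth f e) =
          (\<Sum>(x, y)\<leftarrow>map (\<lambda>e. (e, htensor_nth f e)) es. x \<otimes> y)"
        by (simp add: sum_list_distinct_conv_sum_set o_def)
      then show ?thesis
        by blast
    qed
    then show "\<forall>\<^sub>F F in finite_subsets_at_top onb. (\<Sum>e\<in>F. e \<otimes> htensor_nth f e) \<in> closure ?S"
      by (intro eventually_finite_subsets_at_top_weakI) (use closure_subset in blast)
  qed auto
  then show ?thesis
    by blast
qed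

section \<open>Bounded operators\<close>

text \<open>\<open>B(H)\<close> is the set of complex-linear elements of the library type of bounded real-linear
  maps, whose norm is the operator norm.\<close>

definition cbounded :: "('a :: chilbert_space \<Rightarrow>\<^sub>L 'b :: chilbert_space) set" where
  "cbounded = {T :: 'a \<Rightarrow>\<^sub>L 'b. \<forall>c x. T (c *\<^sub>C x) = c *\<^sub>C T x}"

definition adj_op :: "('a :: chilbert_space \<Rightarrow>\<^sub>L 'b :: chilbert_space) \<Rightarrow> 'b \<Rightarrow>\<^sub>L 'a" where
  "adj_op T = (THE R :: 'b \<Rightarrow>\<^sub>L 'a. \<forall>x y. cinner (R x) y = cinner x (T y))"

definition Re_op :: "('a :: chilbert_space \<Rightarrow>\<^sub>L 'a) \<Rightarrow> 'a \<Rightarrow>\<^sub>L 'a" where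
  "Re_op T = (1 / 2) *\<^sub>R (T + adj_op T)"

definition pos_op :: "('a :: chilbert_space \<Rightarrow>\<^sub>L 'a) \<Rightarrow> bool" where
  "pos_op T \<longleftrightarrow> (\<forall>x. cinner x (T x) \<in> \<real>\<^sub>\<ge>\<^sub>0)"

definition op_le :: "('a :: chilbert_space \<Rightarrow>\<^sub>L 'a) \<Rightarrow> ('a \<Rightarrow>\<^sub>L 'a) \<Rightarrow> bool" (infix "\<preceq>" 50) where
  "S \<preceq> T \<longleftrightarrow> pos_op (T - S)"

definition sqrt_op :: "('a :: chilbert_space \<Rightarrow>\<^sub>L 'a) \<Rightarrow> 'a \<Rightarrow>\<^sub>L 'a" where
  "sqrt_op T = (THE R. R \<in> cbounded \<and> pos_op R \<and> R o\<^sub>L R = T)"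

definition inv_op :: "('a :: chilbert_space \<Rightarrow>\<^sub>L 'a) \<Rightarrow> 'a \<Rightarrow>\<^sub>L 'a" where
  "inv_op T = (THE R. R o\<^sub>L T = id_blinfun \<and> T o\<^sub>L R = id_blinfun)"

definition tensor_op ::
    "('a :: chilbert_space \<Rightarrow>\<^sub>L 'c :: chilbert_space) \<Rightarrow> ('b :: chilbert_space \<Rightarrow>\<^sub>L 'd :: chilbert_space) \<Rightarrow>
      ('a, 'b) htensor \<Rightarrow>\<^sub>L ('c, 'd) htensor" (infixl "\<otimes>\<^sub>o" 70) where
  "T \<otimes>\<^sub>o A = (THE R :: ('a, 'b) htensor \<Rightarrow>\<^sub>L ('c, 'd) htensor. \<forall>x y. R (x \<otimes> y) = T x \<otimes> A y)"

text \<open>Orthogonal projection onto a closed subspace.\<close>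

definition proj :: "'a :: chilbert_space set \<Rightarrow> 'a \<Rightarrow>\<^sub>L 'a" where
  "proj M = (THE P :: 'a \<Rightarrow>\<^sub>L 'a. \<forall>x. P x \<in> M \<and> (\<forall>y\<in>M. cinner y (x - P x) = 0))"

text \<open>Norm of the row operator \<open>[R\<^sub>1, \<dots>, R\<^sub>n] : K\<^sup>n \<rightarrow> K\<close>; the library norm on \<open>'k ^ 'n\<close> is the
  Hilbert space norm of the direct sum.\<close>

definition row_norm :: "('n :: finite \<Rightarrow> 'k :: chilbert_space \<Rightarrow>\<^sub>L 'k) \<Rightarrow> real" where
  "row_norm R = onorm (\<lambda>v :: 'k ^ 'n. \<Sum>i\<in>UNIV. R i (v $ i))"

subsection \<open>Existence of the operators defined above\<close>

lemma cbounded_scaleC: "T \<in> cbounded \<Longrightarrow> T (c *\<^sub>C x) = c *\<^sub>C T x"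
  by (simp add: cbounded_def)

lemma has_sum_norm_sq_onb: "((\<lambda>b. (cmod (cinner b v))\<^sup>2) has_sum (norm v)\<^sup>2) onb"
proof -
  have "((\<lambda>b. Re (cinner v b * cinner b v)) has_sum Re (cinner v v)) onb"
    by (rule has_sum_bounded_linear[OF bounded_linear_Re parseval'])
  moreover have "Re (cinner v b * cinner b v) = (cmod (cinner b v))\<^sup>2" for b
  proof -
    have "cinner v b * cinner b v = complex_of_real ((cmod (cinner b v))\<^sup>2)"
      unfolding complex_norm_square by (subst cinner_commute[of v b]) (rule mult.commute)
    then show ?thesis
      by (simp only: Re_complex_of_real)
  qed
  ultimately show ?thesis
    by (simp only: cinner_self Re_complex_of_real)
qed

lemma has_sum_sum:
  fixes f :: "'i \<Rightarrow> 'j \<Rightarrow> 'v :: topological_comm_monoid_add"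
  assumes "finite F" "\<And>i. i \<in> F \<Longrightarrow> (f i has_sum s i) A"
  shows "((\<lambda>x. \<Sum>i\<in>F. f i x) has_sum (\<Sum>i\<in>F. s i)) A"
  using assms by (induction F rule: finite_induct) (auto intro: has_sum_add)

lemma tensor_op_finite_bound:
  assumes T: "T \<in> cbounded" and F: "finite F" "F \<subseteq> onb"
  shows "(norm (\<Sum>e\<in>F. T e \<otimes> v e))\<^sup>2 \<le> (norm T)\<^sup>2 * (\<Sum>e\<in>F. (norm (v e))\<^sup>2)"
proof (rule has_sum_mono)
  let ?w = "\<lambda>b. \<Sum>e\<in>F. cinner b (v e) *\<^sub>C e"
  show "((\<lambda>b. (norm T)\<^sup>2 * (\<Sum>e\<in>F. (cmod (cinner b (v e)))\<^sup>2)) has_sum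
      (norm T)\<^sup>2 * (\<Sum>e\<in>F. (norm (v e))\<^sup>2)) onb"
    by (intro has_sum_cmult_right has_sum_sum has_sum_norm_sq_onb F)
  have Tw: "blinfun_apply T (?w b) = (\<Sum>e\<in>F. cinner b (v e) *\<^sub>C T e)" for b
    by (simp add: blinfun.sum_right cbounded_scaleC[OF T])
  have "((\<lambda>b. \<Sum>e\<in>F. \<Sum>e'\<in>F. cinner (T e) (T e') * (cinner (v e) b * cinner b (v e'))) has_sum
      (\<Sum>e\<in>F. \<Sum>e'\<in>F. cinner (T e) (T e') * cinner (v e) (v e'))) onb"
    by (intro has_sum_sum F has_sum_cmult_right parseval')
  also have "(\<Sum>e\<in>F. \<Sum>e'\<in>F. cinner (T e) (T e') * cinner (v e) (v e')) =
      complex_of_real ((norm (\<Sum>e\<in>F. T e \<otimes> v e))\<^sup>2)"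
    unfolding cinner_self[symmetric] cinner_sum_left cinner_sum_right cinner_tensor
    by (rule sum.swap)
  also have "(\<lambda>b. \<Sum>e\<in>F. \<Sum>e'\<in>F. cinner (T e) (T e') * (cinner (v e) b * cinner b (v e'))) =
      (\<lambda>b. complex_of_real ((norm (T (?w b)))\<^sup>2))"
    unfolding cinner_self[symmetric] Tw cinner_sum_left cinner_sum_right cinner_scaleC_left
      cinner_scaleC_right
    by (subst sum.swap, intro ext sum.cong refl)
       (subst cinner_commute[of "v e" for e], simp only: mult_ac sum_distrib_left)
  finally have "((\<lambda>b. Re (complex_of_real ((norm (T (?w b)))\<^sup>2))) has_sum
      Re (complex_of_real ((norm (\<Sum>e\<in>F. T e \<otimes> v e))\<^sup>2))) onb"
    by (rule has_sum_bounded_linear[OF bounded_linear_Re])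
  then show "((\<lambda>b. (norm (T (?w b)))\<^sup>2) has_sum (norm (\<Sum>e\<in>F. T e \<otimes> v e))\<^sup>2) onb"
    by (simp only: Re_complex_of_real)
  fix b
  have "(norm (T (?w b)))\<^sup>2 \<le> (norm T * norm (?w b))\<^sup>2"
    by (intro power_mono norm_blinfun norm_ge_zero)
  also have "\<dots> = (norm T)\<^sup>2 * (\<Sum>e\<in>F. (cmod (cinner b (v e)))\<^sup>2)"
    by (simp only: power_mult_distrib norm_orthonormal_sum[OF orthonormal_onb F])
  finally show "(norm (T (?w b)))\<^sup>2 \<le> (norm T)\<^sup>2 * (\<Sum>e\<in>F. (cmod (cinner b (v e)))\<^sup>2)" .
qed

lemma blinfun_eq_tensorI:
  assumes "\<And>x y. blinfun_apply R (x \<otimes> y) = blinfun_apply R' (x \<otimes> y)"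
  shows "R = R'"
proof (rule blinfun_eqI)
  fix f
  have "((\<lambda>e. R (e \<otimes> htensor_nth f e)) has_sum R f) onb"
    and "((\<lambda>e. R' (e \<otimes> htensor_nth f e)) has_sum R' f) onb"
    by (rule has_sum_bounded_linear[OF blinfun.bounded_linear_right htensor_has_sum])+
  then show "R f = R' f"
    using assms has_sum_unique by fastforce
qed

lemma tensor_op_exists:
  fixes T :: "'a :: chilbert_space \<Rightarrow>\<^sub>L 'c :: chilbert_space"
    and A :: "'b :: chilbert_space \<Rightarrow>\<^sub>L 'd :: chilbert_space"
  assumes T: "T \<in> cbounded" and A: "A \<in> cbounded"
  shows "\<exists>R. \<forall>x y. blinfun_apply R (x \<otimes> y) = T x \<otimes> A y"
proof -
  let ?u = "\<lambda>f e. T e \<otimes> A (htensor_nth f e)"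
  have bd: "(norm (\<Sum>e\<in>F. ?u f e))\<^sup>2 \<le> (norm T * norm A)\<^sup>2 * (\<Sum>e\<in>F. (norm (htensor_nth f e))\<^sup>2)"
    if F: "finite F" "F \<subseteq> onb" for F f
  proof -
    have "(norm (\<Sum>e\<in>F. ?u f e))\<^sup>2 \<le> (norm T)\<^sup>2 * (\<Sum>e\<in>F. (norm (A (htensor_nth f e)))\<^sup>2)"
      by (rule tensor_op_finite_bound[OF T F])
    also have "\<dots> \<le> (norm T)\<^sup>2 * (\<Sum>e\<in>F. (norm A * norm (htensor_nth f e))\<^sup>2)"
      by (intro mult_left_mono sum_mono power_mono norm_blinfun) auto
    finally show ?thesis
      by (simp only: power_mult_distrib sum_distrib_left mult.assoc)
  qed
  define C where "C = norm T * norm A + 1"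
  have C: "C > 0"
    by (simp add: C_def add_nonneg_pos)
  have sm: "?u f summable_on onb" for f
  proof (rule summable_on_CauchyI)
    fix d :: real assume d: "d > 0"
    obtain F0 where F0: "finite F0" "F0 \<subseteq> onb" and F0': "\<And>F. finite F \<Longrightarrow> F \<subseteq> onb - F0 \<Longrightarrow>
        (\<Sum>e\<in>F. (norm (htensor_nth f e))\<^sup>2) < (d / C)\<^sup>2"
      using summable_on_tail[OF l2_summable[of "l2_of_htensor f" onb], of "(d / C)\<^sup>2"] C d by auto
    have "norm (sum (?u f) F) < d" if F: "finite F" "F \<subseteq> onb - F0" for F
    proof -
      have "(norm (sum (?u f) F))\<^sup>2 \<le> (norm T * norm A)\<^sup>2 * (\<Sum>e\<in>F. (norm (htensor_nth f e))\<^sup>2)"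
        using F by (intro bd) auto
      also have "\<dots> \<le> C\<^sup>2 * (\<Sum>e\<in>F. (norm (htensor_nth f e))\<^sup>2)"
        by (intro mult_right_mono power_mono sum_nonneg) (auto simp: C_def)
      also have "\<dots> < C\<^sup>2 * (d / C)\<^sup>2"
        using F0'[OF F] C by (intro mult_strict_left_mono) auto
      also have "\<dots> = d\<^sup>2"
        using C by (simp add: power_divide)
      finally show ?thesis
        using d by (simp add: power2_less_imp_less)
    qed
    with F0 show "\<exists>F0. finite F0 \<and> F0 \<subseteq> onb \<and>
        (\<forall>F. finite F \<and> F \<subseteq> onb - F0 \<longrightarrow> norm (sum (?u f) F) < d)"
      by blast
  qed
  define R where "R f = infsum (?u f) onb" for f
  have R: "(?u f has_sum R f) onb" for f
    unfolding R_def by (rule has_sum_infsum[OF sm])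
  have nR: "norm (R f) \<le> norm f * (norm T * norm A)" for f
  proof (rule tendsto_upperbound)
    show "((\<lambda>F. norm (sum (?u f) F)) \<longlongrightarrow> norm (R f)) (finite_subsets_at_top onb)"
      using R[of f] unfolding has_sum_def by (rule tendsto_norm)
    have "norm (sum (?u f) F) \<le> norm f * (norm T * norm A)" if F: "finite F" "F \<subseteq> onb" for F
    proof -
      have "(norm (sum (?u f) F))\<^sup>2 \<le> (norm T * norm A)\<^sup>2 * (\<Sum>e\<in>F. (norm (htensor_nth f e))\<^sup>2)"
        by (rule bd[OF F])
      also have "\<dots> \<le> (norm T * norm A)\<^sup>2 * (norm f)\<^sup>2"
        unfolding norm_htensor_sq
        by (intro mult_left_mono finite_sum_le_infsum l2_summable F) auto
      also have "\<dots> = (norm f * (norm T * norm A))\<^sup>2"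
        by (simp only: power_mult_distrib mult.commute)
      finally show ?thesis
        by (rule power2_le_imp_le) simp
    qed
    then show "\<forall>\<^sub>F F in finite_subsets_at_top onb. norm (sum (?u f) F) \<le> norm f * (norm T * norm A)"
      by (intro eventually_finite_subsets_at_top_weakI)
  qed simp
  have "bounded_linear R"
  proof (rule bounded_linear_intro[OF _ _ nR])
    fix f g and r :: real
    have "(?u (f + g) has_sum (R f + R g)) onb"
      using has_sum_add[OF R[of f] R[of g]]
      by (simp add: htensor_nth_simps blinfun.add_right tensor_add_right)
    then show "R (f + g) = R f + R g"
      by (rule has_sum_unique[OF R])
    have "(?u (r *\<^sub>R f) has_sum r *\<^sub>R R f) onb"
      using has_sum_bounded_linear[OF bounded_linear_scaleR_right R[of f], of r]
      by (simp add: htensor_nth_simps blinfun.scaleR_right)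
         (simp add: scaleR_scaleC tensor_scaleC_right)
    then show "R (r *\<^sub>R f) = r *\<^sub>R R f"
      by (rule has_sum_unique[OF R])
  qed
  moreover have "R (x \<otimes> y) = T x \<otimes> A y" for x y
  proof (rule has_sum_unique[OF R])
    have "((\<lambda>e. T (cinner e x *\<^sub>C e)) has_sum T x) onb"
      by (rule has_sum_bounded_linear[OF blinfun.bounded_linear_right onb_expansion'])
    then have "((\<lambda>e. T (cinner e x *\<^sub>C e) \<otimes> A y) has_sum T x \<otimes> A y) onb"
      by (rule has_sum_bounded_linear[OF bounded_linear_tensor_left])
    then show "(?u (x \<otimes> y) has_sum T x \<otimes> A y) onb"
      by (rule has_sum_cong[THEN iffD1, rotated])
         (simp add: htensor_nth_tensor cbounded_scaleC[OF T] cbounded_scaleC[OF A]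
            tensor_scaleC_left tensor_scaleC_right)
  qed
  ultimately show ?thesis
    by (intro exI[of _ "Blinfun R"]) (simp add: bounded_linear_Blinfun_apply)
qed

lemma tensor_op_apply:
  assumes "T \<in> cbounded" "A \<in> cbounded"
  shows "blinfun_apply (T \<otimes>\<^sub>o A) (x \<otimes> y) = T x \<otimes> A y"
proof -
  have "\<exists>!R. \<forall>x y. blinfun_apply R (x \<otimes> y) = T x \<otimes> A y"
    using tensor_op_exists[OF assms] by (auto intro: blinfun_eq_tensorI)
  from theI'[OF this] show ?thesis
    unfolding tensor_op_def by blast
qed

lemma adj_op_exists:
  fixes T :: "'a :: chilbert_space \<Rightarrow>\<^sub>L 'b :: chilbert_space"
  assumes T: "T \<in> cbounded"
  shows "\<exists>R. \<forall>x y. cinner (blinfun_apply R x) y = cinner x (T y)"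
proof -
  let ?u = "\<lambda>x e. cinner (T e) x *\<^sub>C e"
  have sm: "(\<lambda>e. (cmod (cinner (T e) x))\<^sup>2) summable_on onb" for x
  proof (rule nonneg_bounded_partial_sums_imp_summable_on[where C = "(norm T * norm x)\<^sup>2"])
    have "(\<Sum>e\<in>F. (cmod (cinner (T e) x))\<^sup>2) \<le> (norm T * norm x)\<^sup>2"
      if F: "finite F" "F \<subseteq> onb" for F
    proof -
      define v where "v = sum (?u x) F"
      have nv: "(norm v)\<^sup>2 = (\<Sum>e\<in>F. (cmod (cinner (T e) x))\<^sup>2)"
        unfolding v_def by (rule norm_orthonormal_sum[OF orthonormal_onb F])
      have "cinner (T v) x = complex_of_real (\<Sum>e\<in>F. (cmod (cinner (T e) x))\<^sup>2)"
        unfolding v_def blinfun.sum_right cbounded_scaleC[OF T] cinner_sum_left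
          cinner_scaleC_left of_real_sum complex_norm_square
        by (simp only: mult.commute)
      then have "(norm v)\<^sup>2 = cmod (cinner (T v) x)"
        unfolding nv[symmetric] by (simp only: norm_of_real abs_power2)
      also have "\<dots> \<le> norm (T v) * norm x"
        by (rule cmod_cinner_le)
      also have "\<dots> \<le> (norm T * norm v) * norm x"
        by (intro mult_right_mono norm_blinfun) auto
      finally have "norm v \<le> norm T * norm x"
        by (cases "v = 0") (auto simp: power2_eq_square mult_ac)
      then show ?thesis
        unfolding nv[symmetric] by (simp add: power_mono)
    qed
    then show "\<forall>\<^sub>F F in finite_subsets_at_top onb.
        (\<Sum>e\<in>F. (cmod (cinner (T e) x))\<^sup>2) \<le> (norm T * norm x)\<^sup>2"
      by (intro eventually_finite_subsets_at_top_weakI)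
  qed simp
  define R where "R x = infsum (?u x) onb" for x
  have R: "(?u x has_sum R x) onb" for x
    unfolding R_def by (intro has_sum_infsum orthonormal_summable orthonormal_onb sm)
  have adj: "cinner y (R x) = cinner (T y) x" for x y
  proof -
    have "((\<lambda>e. cinner y e * cinner e (R x)) has_sum cinner y (R x)) onb"
      by (rule parseval')
    then have "((\<lambda>e. cinner y e * cinner (T e) x) has_sum cinner y (R x)) onb"
      by (rule has_sum_cong[THEN iffD1, rotated])
         (simp add: cinner_orthonormal_has_sum[OF orthonormal_onb R])
    moreover have "((\<lambda>e. T (cinner e y *\<^sub>C e)) has_sum T y) onb"
      by (rule has_sum_bounded_linear[OF blinfun.bounded_linear_right onb_expansion'])
    then have "((\<lambda>e. cnj (cinner x (T (cinner e y *\<^sub>C e)))) has_sum cnj (cinner x (T y))) onb"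
      by (intro has_sum_bounded_linear[OF bounded_linear_cnj]
          has_sum_bounded_linear[OF bounded_linear_cinner_right])
    then have "((\<lambda>e. cinner y e * cinner (T e) x) has_sum cinner (T y) x) onb"
      by (simp only: cinner_commute[symmetric] cbounded_scaleC[OF T] cinner_scaleC_left)
    ultimately show ?thesis
      by (rule has_sum_unique)
  qed
  have "bounded_linear R"
  proof (rule bounded_linear_intro)
    fix x x' and r :: real
    have "cinner y (R (x + x') - (R x + R x')) = 0" for y
      by (simp add: cinner_diff_right cinner_add_right adj)
    then show "R (x + x') = R x + R x'"
      using cinner_eq_0_all[of "R (x + x') - (R x + R x')"] by simp
    have "cinner y (R (r *\<^sub>R x) - r *\<^sub>R R x) = 0" for y
      by (simp add: cinner_diff_right scaleR_scaleC cinner_scaleC_right adj)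
    then show "R (r *\<^sub>R x) = r *\<^sub>R R x"
      using cinner_eq_0_all[of "R (r *\<^sub>R x) - r *\<^sub>R R x"] by simp
    have "(norm (R x))\<^sup>2 = cmod (cinner (R x) (R x))"
      by (simp only: cinner_self norm_of_real abs_power2)
    also have "\<dots> \<le> norm (T (R x)) * norm x"
      unfolding adj by (rule cmod_cinner_le)
    also have "\<dots> \<le> (norm T * norm (R x)) * norm x"
      by (intro mult_right_mono norm_blinfun) auto
    finally show "norm (R x) \<le> norm x * norm T"
      by (cases "R x = 0") (auto simp: power2_eq_square mult_ac)
  qed
  moreover have "cinner (R x) y = cinner x (T y)" for x y
    using adj[of y x] by (metis cinner_commute)
  ultimately show ?thesis
    by (intro exI[of _ "Blinfun R"]) (simp add: bounded_linear_Blinfun_apply)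
qed

lemma adj_op_apply:
  assumes T: "T \<in> cbounded"
  shows "cinner (blinfun_apply (adj_op T) x) y = cinner x (T y)"
proof -
  have "\<exists>!R. \<forall>x y. cinner (blinfun_apply R x) y = cinner x (T y)"
  proof (rule ex_ex1I[OF adj_op_exists[OF T]])
    fix R R' :: "'b \<Rightarrow>\<^sub>L 'a"
    assume *: "\<forall>x y. cinner (R x) y = cinner x (T y)" "\<forall>x y. cinner (R' x) y = cinner x (T y)"
    have "R x - R' x = 0" for x
      using * cinner_self[of "R x - R' x"] by (simp add: cinner_diff_left)
    then show "R = R'"
      by (intro blinfun_eqI) simp
  qed
  from theI'[OF this] show ?thesis
    unfolding adj_op_def by blast
qed

lemma proj_apply:
  assumes M: "hilbert_subspace M"
  shows "blinfun_apply (proj M) x \<in> M" and "y \<in> M \<Longrightarrow> cinner y (x - proj M x) = 0"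
proof -
  obtain B where B: "is_onb M B"
    using onb_exists[OF M] by blast
  then have o: "orthonormal B" and BM: "B \<subseteq> M"
    by (auto simp: is_onb_def)
  let ?u = "\<lambda>x e. cinner e x *\<^sub>C e"
  define P where "P x = infsum (?u x) B" for x
  have P: "(?u x has_sum P x) B" for x
    unfolding P_def by (intro has_sum_infsum orthonormal_summable bessel_summable o)
  have PM: "P x \<in> M" for x
    by (rule hilbert_subspace_has_sum[OF M _ P])
       (use M BM in \<open>auto simp: hilbert_subspace_def\<close>)
  have PB: "cinner e (P x) = cinner e x" if "e \<in> B" for e x
    using cinner_orthonormal_has_sum[OF o P that] .
  have orth: "cinner y (x - P x) = 0" if "y \<in> M" for x y
  proof -
    have "((\<lambda>e. cinner (x - P x) (cinner e y *\<^sub>C e)) has_sum cinner (x - P x) y) B"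
      by (rule has_sum_bounded_linear[OF bounded_linear_cinner_right onb_expansion[OF M B that]])
    moreover have "cinner (x - P x) (cinner e y *\<^sub>C e) = 0" if "e \<in> B" for e
    proof -
      have "cinner e (x - P x) = 0"
        by (simp add: cinner_diff_right PB[OF that])
      then have "cinner (x - P x) e = 0"
        by (subst cinner_commute) simp
      then show ?thesis
        by (simp add: cinner_scaleC_right)
    qed
    ultimately have "cinner (x - P x) y = 0"
      by (metis (no_types, lifting) has_sum_0 has_sum_unique)
    then show ?thesis
      by (subst cinner_commute) simp
  qed
  have uniq: "p = q" if "p \<in> M" "q \<in> M"
    "\<forall>y\<in>M. cinner y (x - p) = 0" "\<forall>y\<in>M. cinner y (x - q) = 0" for p q x
  proof -
    have "p - q \<in> M"
      using M that unfolding hilbert_subspace_def by (metis add_uminus_conv_diff scaleC_minus_one)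
    then have "cinner (p - q) (x - q) - cinner (p - q) (x - p) = 0"
      using that by simp
    then have "cinner (p - q) (p - q) = 0"
      by (simp add: cinner_diff_right)
    then show ?thesis
      by (simp add: cinner_self)
  qed
  have "bounded_linear P"
  proof (rule bounded_linear_intro)
    fix x x' and r :: real
    have M': "x + y \<in> M" "c *\<^sub>C x \<in> M" if "x \<in> M" "y \<in> M" for x y c
      using M that by (auto simp: hilbert_subspace_def)
    show "P (x + x') = P x + P x'"
    proof (rule uniq[of _ _ "x + x'"])
      show "\<forall>y\<in>M. cinner y (x + x' - (P x + P x')) = 0"
        using orth by (simp add: add_diff_add cinner_add_right)
    qed (use PM M' orth in auto)
    show "P (r *\<^sub>R x) = r *\<^sub>R P x"
    proof (rule uniq[of _ _ "r *\<^sub>R x"])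
      show "\<forall>y\<in>M. cinner y (r *\<^sub>R x - r *\<^sub>R P x) = 0"
        unfolding scaleR_diff_right[symmetric] scaleR_scaleC[of r "x - P x"] cinner_scaleC_right
        using orth by simp
      show "r *\<^sub>R P x \<in> M"
        unfolding scaleR_scaleC using PM M' by blast
    qed (use PM M' orth in auto)
    have "cinner (P x) x = cinner (P x) (P x)"
      using orth[OF PM, of x x] by (simp add: cinner_diff_right)
    then have "(norm (P x))\<^sup>2 = cmod (cinner (P x) x)"
      by (simp only: cinner_self norm_of_real abs_power2)
    also have "\<dots> \<le> norm (P x) * norm x"
      by (rule cmod_cinner_le)
    finally show "norm (P x) \<le> norm x * 1"
      by (cases "P x = 0") (auto simp: power2_eq_square mult_ac)
  qed
  then have "\<exists>P. \<forall>x. blinfun_apply P x \<in> M \<and> (\<forall>y\<in>M. cinner y (x - P x) = 0)"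
    using PM orth by (intro exI[of _ "Blinfun P"]) (simp add: bounded_linear_Blinfun_apply)
  moreover have "Q = Q'"
    if "\<forall>x. blinfun_apply Q x \<in> M \<and> (\<forall>y\<in>M. cinner y (x - Q x) = 0)"
      "\<forall>x. blinfun_apply Q' x \<in> M \<and> (\<forall>y\<in>M. cinner y (x - Q' x) = 0)" for Q Q' :: "'a \<Rightarrow>\<^sub>L 'a"
    using that uniq by (intro blinfun_eqI) blast
  ultimately have "\<exists>!P. \<forall>x. blinfun_apply P x \<in> M \<and> (\<forall>y\<in>M. cinner y (x - P x) = 0)"
    by blast
  from theI'[OF this] show "blinfun_apply (proj M) x \<in> M"
    and "y \<in> M \<Longrightarrow> cinner y (x - proj M x) = 0"
    unfolding proj_def by blast+
qed

section \<open>Free holomorphic functions\<close>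

text \<open>Words over the alphabet \<open>'n\<close> form the free semigroup on \<open>n = CARD('n)\<close> generators; the empty
  word is its identity.

  A statement about an arbitrary Hilbert space \<open>X\<close> is stated for all closed subspaces \<open>M\<close> of
  \<open>'i ell2\<close>, where \<open>'i\<close> is an arbitrary infinite type; up to unitary equivalence, these are all the
  Hilbert spaces of dimension at most \<open>|'i|\<close>. An operator on \<open>M\<close> is represented by its extension
  by 0 on the orthogonal complement of \<open>M\<close>. In particular \<open>proj M\<close> represents the identity of \<open>M\<close>,
  and \<open>X \<otimes> A\<close> with \<open>X \<in> ops_on M\<close> represents an operator on \<open>M \<otimes> H\<close>. The extension preserves
  norms, sums, products, adjoints, and the order.\<close>

definition ops_on :: "'x :: chilbert_space set \<Rightarrow> ('x \<Rightarrow>\<^sub>L 'x) set" where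
  "ops_on M = {T :: 'x \<Rightarrow>\<^sub>L 'x. T \<in> cbounded \<and> (\<forall>x. T x \<in> M) \<and>
     (\<forall>x. (\<forall>y\<in>M. cinner y x = 0) \<longrightarrow> T x = 0)}"

definition row_ball :: "'x :: chilbert_space set \<Rightarrow> ('n :: finite \<Rightarrow> 'x \<Rightarrow>\<^sub>L 'x) set" where
  "row_ball M = {X. (\<forall>i. X i \<in> ops_on M) \<and> norm (\<Sum>i\<in>UNIV. X i o\<^sub>L adj_op (X i)) < 1}"

primrec word_op :: "('x :: real_normed_vector \<Rightarrow>\<^sub>L 'x) \<Rightarrow> ('n \<Rightarrow> 'x \<Rightarrow>\<^sub>L 'x) \<Rightarrow> 'n list \<Rightarrow> 'x \<Rightarrow>\<^sub>L 'x" where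
  "word_op E X [] = E"
| "word_op E X (i # \<alpha>) = X i o\<^sub>L word_op E X \<alpha>"

definition words :: "nat \<Rightarrow> 'n list set" where
  "words k = {\<alpha>. length \<alpha> = k}"

lemma finite_words: "finite (words k :: 'n :: finite list set)"
  unfolding words_def using finite_lists_length_eq[of "UNIV :: 'n set" k] by simp

definition homogeneous_part ::
    "'x :: chilbert_space set \<Rightarrow> ('n :: finite list \<Rightarrow> 'h :: chilbert_space \<Rightarrow>\<^sub>L 'h) \<Rightarrow>
      ('n \<Rightarrow> 'x \<Rightarrow>\<^sub>L 'x) \<Rightarrow> nat \<Rightarrow> ('x, 'h) htensor \<Rightarrow>\<^sub>L ('x, 'h) htensor" where
  "homogeneous_part M A X k = (\<Sum>\<alpha>\<in>words k. word_op (proj M) X \<alpha> \<otimes>\<^sub>o A \<alpha>)"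

definition free_eval ::
    "'x :: chilbert_space set \<Rightarrow> ('n :: finite list \<Rightarrow> 'h :: chilbert_space \<Rightarrow>\<^sub>L 'h) \<Rightarrow>
      ('n \<Rightarrow> 'x \<Rightarrow>\<^sub>L 'x) \<Rightarrow> ('x, 'h) htensor \<Rightarrow>\<^sub>L ('x, 'h) htensor" where
  "free_eval M A X = (\<Sum>k. homogeneous_part M A X k)"

definition free_holomorphic ::
    "'i :: infinite itself \<Rightarrow> ('n :: finite list \<Rightarrow> 'h :: chilbert_space \<Rightarrow>\<^sub>L 'h) \<Rightarrow> bool" where
  "free_holomorphic _ A \<longleftrightarrow> (\<forall>(M :: 'i ell2 set) X. hilbert_subspace M \<longrightarrow> X \<in> row_ball M \<longrightarrow>
     summable (homogeneous_part M A X))"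

text \<open>The full Fock space: the basis vector of \<open>'n list ell2\<close> at the word \<open>g\<^sub>i\<^sub>1 \<dots> g\<^sub>i\<^sub>k\<close> is
  \<open>e\<^sub>i\<^sub>1 \<otimes> \<dots> \<otimes> e\<^sub>i\<^sub>k\<close>, and the words of length \<open>k\<close> span the \<open>k\<close>-th tensor power.\<close>

type_synonym 'n fock = "'n list ell2"

lift_definition creation_fun :: "'n \<Rightarrow> 'n fock \<Rightarrow> 'n fock" is
  "\<lambda>i f \<alpha>. case \<alpha> of [] \<Rightarrow> 0 | j # \<beta> \<Rightarrow> if j = i then f \<beta> else 0"
proof -
  fix i :: 'n and f :: "'n list \<Rightarrow> complex"
  assume "(\<lambda>\<alpha>. (norm (f \<alpha>))\<^sup>2) summable_on UNIV"
  then have "(\<lambda>\<alpha>. (norm (f (tl \<alpha>)))\<^sup>2) summable_on range ((#) i)"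
    by (subst summable_on_reindex) (auto simp: o_def)
  then show "(\<lambda>\<alpha>. (norm (case \<alpha> of [] \<Rightarrow> 0 | j # \<beta> \<Rightarrow> if j = i then f \<beta> else 0))\<^sup>2) summable_on UNIV"
    by (rule summable_on_cong_neutral[THEN iffD1, rotated -1]) (auto split: list.splits)
qed

lemma norm_creation_fun: "norm (creation_fun i \<phi>) = norm \<phi>"
proof -
  have "(\<Sum>\<^sub>\<infinity>\<alpha>. (norm (l2_nth (creation_fun i \<phi>) \<alpha>))\<^sup>2) =
      (\<Sum>\<^sub>\<infinity>\<alpha>\<in>range ((#) i). (norm (l2_nth \<phi> (tl \<alpha>)))\<^sup>2)"
    by (rule infsum_cong_neutral) (auto simp: creation_fun.rep_eq split: list.splits)
  also have "\<dots> = (\<Sum>\<^sub>\<infinity>\<alpha>. (norm (l2_nth \<phi> \<alpha>))\<^sup>2)"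
    by (subst infsum_reindex) (auto simp: o_def)
  finally show ?thesis
    by (simp add: norm_l2_def)
qed

lift_definition creation :: "'n \<Rightarrow> 'n fock \<Rightarrow>\<^sub>L 'n fock" is creation_fun
proof (rule bounded_linear_intro[where K = 1])
  fix i :: 'n and f g :: "'n fock" and r :: real
  show "creation_fun i (f + g) = creation_fun i f + creation_fun i g"
    by transfer (auto split: list.splits)
  show "creation_fun i (r *\<^sub>R f) = r *\<^sub>R creation_fun i f"
    by transfer (auto split: list.splits)
  show "norm (creation_fun i f) \<le> norm f * 1"
    by (simp add: norm_creation_fun)
qed

text \<open>The homogeneous parts of \<open>F(S\<^sub>1 \<otimes> Y\<^sub>1, \<dots>, S\<^sub>n \<otimes> Y\<^sub>n)\<close>.\<close>

definition fock_part ::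
    "('n :: finite list \<Rightarrow> 'h :: chilbert_space \<Rightarrow>\<^sub>L 'h) \<Rightarrow> ('n \<Rightarrow> 'k :: chilbert_space \<Rightarrow>\<^sub>L 'k) \<Rightarrow> nat \<Rightarrow>
      (('n fock, 'k) htensor, 'h) htensor \<Rightarrow>\<^sub>L (('n fock, 'k) htensor, 'h) htensor" where
  "fock_part A Y k =
     (\<Sum>\<alpha>\<in>words k. word_op id_blinfun creation \<alpha> \<otimes>\<^sub>o word_op id_blinfun Y \<alpha> \<otimes>\<^sub>o A \<alpha>)"

definition gram :: "('n :: finite list \<Rightarrow> 'h :: chilbert_space \<Rightarrow>\<^sub>L 'h) \<Rightarrow> nat \<Rightarrow> 'h \<Rightarrow>\<^sub>L 'h" where
  "gram A k = (\<Sum>\<alpha>\<in>words k. adj_op (A \<alpha>) o\<^sub>L A \<alpha>)"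

end

theory Submission
  imports Defs
begin

text \<open>Evaluating \<open>F\<close> at \<open>(r S\<^sub>1, \<dots>, r S\<^sub>n)\<close>, transported into the given Hilbert space, testing
  \<open>Re F \<le> I\<close> on \<open>1 \<otimes> x + \<Sum>\<^bsub>|\<alpha>|=k\<^esub> e\<^sub>\<alpha> \<otimes> h\<^sub>\<alpha>\<close> and letting \<open>r \<rightarrow> 1\<close> gives, for
  \<open>D = I - A\<^sub>0\<close> and \<open>k \<ge> 1\<close>,
  \<open>Re \<Sum>\<^bsub>|\<alpha>|=k\<^esub> \<langle>h\<^sub>\<alpha>, A\<^sub>\<alpha> x\<rangle> \<le> \<langle>x, D x\<rangle> + \<Sum>\<^bsub>|\<alpha>|=k\<^esub> \<langle>h\<^sub>\<alpha>, D h\<^sub>\<alpha>\<rangle>\<close>.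
  Everything else follows from this inequality: (ii), (iii) and (v) by taking for \<open>h\<^sub>\<alpha>\<close> a multiple of
  \<open>A\<^sub>\<alpha> x\<close> or of \<open>D\<^sup>-\<^sup>1 A\<^sub>\<alpha> x\<close>; (iv) from (ii) and \<open>2 s G\<^sup>1\<^sup>/\<^sup>2 \<le> G + s\<^sup>2 I\<close> with a suitable scalar
  \<open>s\<close>; (vi) from (iii). For (i) the inequality is tensored with the identity and applied to
  \<open>h\<^sub>\<alpha> = 3\<^sup>k (S\<^sub>\<alpha> \<otimes> Y\<^sub>\<alpha> \<otimes> I)\<^sup>* g\<close>; as the \<open>S\<^sub>\<alpha>\<close> are isometries with orthogonal ranges and
  \<open>\<parallel>Y\<^sub>\<alpha>\<parallel> \<le> 3\<^sup>-\<^sup>k\<close>, it bounds the \<open>k\<close>-th sesquilinear form by \<open>3\<^sup>-\<^sup>k\<close> times the sum of the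
  quadratic forms of \<open>I \<otimes> D\<close> at both arguments, and \<open>\<Sum>\<^bsub>k\<ge>1\<^esub> 3\<^sup>-\<^sup>k = 1/2\<close> is what is needed to
  complement the contribution of \<open>A\<^sub>0\<close> to the identity.\<close>

section \<open>Adjoints and self-adjoint operators\<close>

lemma blinfun_eq_cinnerI:
  assumes "\<And>x y. cinner x (blinfun_apply S y) = cinner x (blinfun_apply T y)"
  shows "S = T"
proof (rule blinfun_eqI)
  fix y
  have "cinner x (S y - T y) = 0" for x
    using assms by (simp add: cinner_diff_right)
  then show "S y = T y"
    using cinner_eq_0_all[of "S y - T y"] by simp
qed

lemma cinner_adj_op: "T \<in> cbounded \<Longrightarrow> cinner x (blinfun_apply (adj_op T) y) = cinner (T x) y"
  using adj_op_apply[of T y x] by (metis cinner_commute)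

lemma adj_op_eqI:
  assumes "T \<in> cbounded" "\<And>x y. cinner (blinfun_apply R x) y = cinner x (T y)"
  shows "adj_op T = R"
  by (rule blinfun_eq_cinnerI) (metis assms cinner_adj_op cinner_commute)

lemma inner_adj_op: "T \<in> cbounded \<Longrightarrow> inner x (blinfun_apply (adj_op T) y) = inner (T x) y"
  by (simp add: inner_eq_Re_cinner cinner_adj_op)

lemma cbounded_adj_op: "T \<in> cbounded \<Longrightarrow> adj_op T \<in> cbounded"
proof -
  assume T: "T \<in> cbounded"
  have "adj_op T (c *\<^sub>C x) - c *\<^sub>C adj_op T x = 0" for c x
    by (rule cinner_eq_0_all) (simp add: cinner_diff_right cinner_adj_op[OF T] cinner_scaleC_right)
  then show ?thesis
    by (simp add: cbounded_def)
qed

lemma adj_adj_op: "T \<in> cbounded \<Longrightarrow> adj_op (adj_op T) = T"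
  by (rule adj_op_eqI) (simp_all add: cbounded_adj_op cinner_adj_op)

lemma norm_adj_op_le: "T \<in> cbounded \<Longrightarrow> norm (adj_op T) \<le> norm T"
proof (rule norm_blinfun_bound)
  fix x assume T: "T \<in> cbounded"
  have "(norm (adj_op T x))\<^sup>2 = inner (T (adj_op T x)) x"
    unfolding power2_norm_eq_inner by (rule inner_adj_op[OF T])
  also have "\<dots> \<le> norm (T (adj_op T x)) * norm x"
    by (rule norm_cauchy_schwarz)
  also have "\<dots> \<le> (norm T * norm (adj_op T x)) * norm x"
    by (intro mult_right_mono norm_blinfun) auto
  finally show "norm (adj_op T x) \<le> norm T * norm x"
    by (cases "adj_op T x = 0") (auto simp: power2_eq_square mult_ac)
qed simp

lemma cbounded_id: "id_blinfun \<in> cbounded"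
  by (simp add: cbounded_def)

lemma cbounded_zero: "0 \<in> cbounded"
  by (simp add: cbounded_def)

lemma cbounded_add: "S \<in> cbounded \<Longrightarrow> T \<in> cbounded \<Longrightarrow> S + T \<in> cbounded"
  by (simp add: cbounded_def blinfun.add_left scaleC_add_right)

lemma cbounded_scaleR: "T \<in> cbounded \<Longrightarrow> r *\<^sub>R T \<in> cbounded"
  by (simp add: cbounded_def blinfun.scaleR_left scaleR_scaleC scaleC_scaleC mult.commute)

lemma cbounded_compose: "S \<in> cbounded \<Longrightarrow> T \<in> cbounded \<Longrightarrow> S o\<^sub>L T \<in> cbounded"
  by (simp add: cbounded_def)

lemma cbounded_sum: "(\<And>i. i \<in> I \<Longrightarrow> T i \<in> cbounded) \<Longrightarrow> sum T I \<in> cbounded"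
  by (induction I rule: infinite_finite_induct) (auto simp: cbounded_zero cbounded_add)

text \<open>Operators are typed as real-linear maps, so complex-linearity of a norm limit has to be
  carried over. It is a family of closed conditions, one for each scalar and vector.\<close>

lemma closed_cbounded: "closed (cbounded :: ('a :: chilbert_space \<Rightarrow>\<^sub>L 'b :: chilbert_space) set)"
proof -
  have eq: "cbounded = (\<Inter>c. \<Inter>x. {T :: 'a \<Rightarrow>\<^sub>L 'b. T (c *\<^sub>C x) = c *\<^sub>C T x})"
    by (auto simp: cbounded_def)
  have "continuous_on UNIV (\<lambda>T :: 'a \<Rightarrow>\<^sub>L 'b. c *\<^sub>C T x)" for c x
    by (intro continuous_on_compose2[OF linear_continuous_on[OF bounded_linear_scaleC_right]]
        continuous_intros) auto
  then show ?thesis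
    unfolding eq by (intro closed_INT ballI closed_Collect_eq continuous_intros)
qed

lemma cbounded_suminf: "summable T \<Longrightarrow> (\<And>k. T k \<in> cbounded) \<Longrightarrow> suminf T \<in> cbounded"
  by (rule closed_sequentially[OF closed_cbounded _ summable_LIMSEQ]) (simp_all add: cbounded_sum)

lemma adj_op_compose:
  "S \<in> cbounded \<Longrightarrow> T \<in> cbounded \<Longrightarrow> adj_op (S o\<^sub>L T) = adj_op T o\<^sub>L adj_op S"
  by (rule adj_op_eqI) (simp_all add: cbounded_compose adj_op_apply)

lemma adj_op_scaleR: "T \<in> cbounded \<Longrightarrow> adj_op (r *\<^sub>R T) = r *\<^sub>R adj_op T"
  by (rule adj_op_eqI)
     (simp_all add: cbounded_scaleR blinfun.scaleR_left scaleR_scaleC cinner_scaleC_left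
       cinner_scaleC_right adj_op_apply)

lemma id_blinfun_compose: "id_blinfun o\<^sub>L T = T" "T o\<^sub>L id_blinfun = T"
  by (rule blinfun_eqI, simp)+

text \<open>Restricting the row to vectors supported in coordinate j recovers its j-th entry. This
  turns the row condition of (i) into a bound on each single operator.\<close>

lemma norm_le_row_norm:
  fixes R :: "'n :: finite \<Rightarrow> 'k :: chilbert_space \<Rightarrow>\<^sub>L 'k"
  shows "norm (R j) \<le> row_norm R"
proof (rule norm_blinfun_bound)
  let ?f = "\<lambda>v :: 'k ^ 'n. \<Sum>i\<in>UNIV. R i (v $ i)"
  have f: "bounded_linear ?f"
    by (intro bounded_linear_sum bounded_linear_compose[OF blinfun.bounded_linear_right]
        bounded_linear_vec_nth)
  then show "0 \<le> row_norm R"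
    unfolding row_norm_def by (rule onorm_pos_le)
  fix x
  have "norm (?f (axis j x)) \<le> row_norm R * norm (axis j x :: 'k ^ 'n)"
    unfolding row_norm_def by (rule onorm[OF f])
  moreover have "?f (axis j x) = (\<Sum>i\<in>UNIV. if i = j then R i x else 0)"
    by (intro sum.cong refl) (auto simp: axis_def)
  moreover have "norm (axis j x :: 'k ^ 'n) = norm x"
  proof -
    have "(norm ((axis j x :: 'k ^ 'n) $ i))\<^sup>2 = (if i = j then (norm x)\<^sup>2 else 0)" for i
      by (simp add: axis_def)
    then show ?thesis
      by (simp add: norm_vec_def L2_set_def)
  qed
  ultimately show "norm (R j x) \<le> row_norm R * norm x"
    by simp
qed

section \<open>Self-adjoint and positive operators\<close>

definition selfadjoint :: "('a :: chilbert_space \<Rightarrow>\<^sub>L 'a) \<Rightarrow> bool" where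
  "selfadjoint T \<longleftrightarrow> (\<forall>x y. cinner x (T y) = cinner (T x) y)"

text \<open>Moving T to the first argument and back lets the scalar leave the second one, so
  complex-linearity comes from the symmetry of the form.\<close>

lemma selfadjoint_cbounded: "selfadjoint T \<Longrightarrow> T \<in> cbounded"
proof -
  assume T: "selfadjoint T"
  have "T (c *\<^sub>C x) - c *\<^sub>C T x = 0" for c x
    by (rule cinner_eq_0_all)
       (use T in \<open>simp add: cinner_diff_right cinner_scaleC_right selfadjoint_def\<close>)
  then show ?thesis
    by (simp add: cbounded_def)
qed

lemma adj_op_selfadjoint: "selfadjoint T \<Longrightarrow> adj_op T = T"
  by (rule adj_op_eqI[OF selfadjoint_cbounded]) (simp_all add: selfadjoint_def)

lemma selfadjoint_inner: "selfadjoint T \<Longrightarrow> inner x (T y) = inner (T x) y"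
  by (simp add: inner_eq_Re_cinner selfadjoint_def)

lemma selfadjoint_id: "selfadjoint id_blinfun"
  by (simp add: selfadjoint_def)

lemma selfadjoint_zero: "selfadjoint 0"
  by (simp add: selfadjoint_def)

lemma selfadjoint_add: "selfadjoint S \<Longrightarrow> selfadjoint T \<Longrightarrow> selfadjoint (S + T)"
  by (simp add: selfadjoint_def blinfun.add_left cinner_add_left cinner_add_right)

lemma selfadjoint_diff: "selfadjoint S \<Longrightarrow> selfadjoint T \<Longrightarrow> selfadjoint (S - T)"
  by (simp add: selfadjoint_def blinfun.diff_left cinner_diff_left cinner_diff_right)

lemma selfadjoint_scaleR: "selfadjoint T \<Longrightarrow> selfadjoint (r *\<^sub>R T)"
  by (simp add: selfadjoint_def blinfun.scaleR_left scaleR_scaleC cinner_scaleC_left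
      cinner_scaleC_right)

lemma selfadjoint_sum: "(\<And>i. i \<in> I \<Longrightarrow> selfadjoint (T i)) \<Longrightarrow> selfadjoint (sum T I)"
  by (induction I rule: infinite_finite_induct) (auto simp: selfadjoint_zero selfadjoint_add)

lemma selfadjoint_square: "selfadjoint T \<Longrightarrow> selfadjoint (T o\<^sub>L T)"
  by (simp add: selfadjoint_def)

lemma selfadjoint_conjugate:
  "A \<in> cbounded \<Longrightarrow> selfadjoint R \<Longrightarrow> selfadjoint (adj_op A o\<^sub>L R o\<^sub>L A)"
  by (simp add: selfadjoint_def cinner_adj_op adj_op_apply)

lemma selfadjoint_adj_compose: "A \<in> cbounded \<Longrightarrow> selfadjoint (adj_op A o\<^sub>L A)"
  by (simp add: selfadjoint_def cinner_adj_op adj_op_apply)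

lemma closed_selfadjoint: "closed (Collect (selfadjoint :: ('a :: chilbert_space \<Rightarrow>\<^sub>L 'a) \<Rightarrow> bool))"
proof -
  \<comment> \<open>Conjugation puts T into the second argument on both sides, where
    \<open>bounded_linear_cinner_right\<close> gives continuity.\<close>
  have "Collect selfadjoint =
      (\<Inter>x. \<Inter>y. {T :: 'a \<Rightarrow>\<^sub>L 'a. cinner x (T y) = cnj (cinner y (T x))})"
    by (auto simp: selfadjoint_def cinner_commute[symmetric])
  moreover have "continuous_on UNIV (\<lambda>T :: 'a \<Rightarrow>\<^sub>L 'a. cinner x (T y))" for x y
    by (intro continuous_on_compose2[OF linear_continuous_on[OF bounded_linear_cinner_right]]
        continuous_intros) auto
  ultimately show ?thesis
    by (auto intro!: closed_INT closed_Collect_eq continuous_intros)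
qed

lemma selfadjoint_suminf: "summable T \<Longrightarrow> (\<And>k. selfadjoint (T k)) \<Longrightarrow> selfadjoint (suminf T)"
  using closed_sequentially[OF closed_selfadjoint _ summable_LIMSEQ, of T]
  by (simp add: selfadjoint_sum)

text \<open>Polarization: a form that is real on the diagonal is Hermitian over the complex scalars.
  From here on positivity is tested with the real \<open>inner\<close>.\<close>

lemma pos_op_iff:
  assumes "T \<in> cbounded"
  shows "pos_op T \<longleftrightarrow> selfadjoint T \<and> (\<forall>x. 0 \<le> inner x (T x))"
proof
  assume T: "pos_op T"
  have real: "Im (cinner x (T x)) = 0" and nn: "0 \<le> inner x (T x)" for x
    using T by (auto simp: pos_op_def complex_nonneg_Reals_iff inner_eq_Re_cinner)
  have "cinner x (T y) = cinner (T x) y" for x y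
  proof -
    \<comment> \<open>Reality at x + y gives the imaginary part of the Hermitian symmetry, reality
      at x + \<i> y the real part.\<close>
    have 1: "Im (cinner x (T y)) + Im (cinner y (T x)) = 0"
      using real[of "x + y"] real[of x] real[of y]
      by (simp add: blinfun.add_right cinner_add_left cinner_add_right)
    have 2: "Re (cinner x (T y)) - Re (cinner y (T x)) = 0"
      using real[of "x + \<i> *\<^sub>C y"] real[of x] real[of y]
      by (simp add: blinfun.add_right cinner_add_left cinner_add_right cinner_scaleC_left
          cinner_scaleC_right cbounded_scaleC[OF assms])
    have "cinner x (T y) = cnj (cinner y (T x))"
      using 1 2 by (simp add: complex_eq_iff)
    then show ?thesis
      by (metis cinner_commute)
  qed
  then show "selfadjoint T \<and> (\<forall>x. 0 \<le> inner x (T x))"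
    using nn by (simp add: selfadjoint_def)
next
  assume T: "selfadjoint T \<and> (\<forall>x. 0 \<le> inner x (T x))"
  then have "cinner x (T x) = cnj (cinner x (T x))" for x
    by (metis cinner_commute selfadjoint_def)
  then have "Im (cinner x (T x)) = 0" for x
    by (metis Reals_cnj_iff complex_is_Real_iff)
  then show "pos_op T"
    using T by (simp add: pos_op_def complex_nonneg_Reals_iff inner_eq_Re_cinner)
qed

lemma op_leI:
  assumes "selfadjoint S" "selfadjoint T" "\<And>x. inner x (S x) \<le> inner x (T x)"
  shows "S \<preceq> T"
  unfolding op_le_def using assms
  by (simp add: pos_op_iff selfadjoint_diff selfadjoint_cbounded blinfun.diff_left inner_diff_right)

text \<open>Positivity at x - y, expanded. In this additive form the inequality combines with bounds
  on the two quadratic forms.\<close>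

lemma inner_le_half_sum:
  assumes T: "selfadjoint T" and nn: "\<And>x. 0 \<le> inner x (T x)"
  shows "2 * inner x (T y) \<le> inner x (T x) + inner y (T y)"
proof -
  have "0 \<le> inner (x - y) (T (x - y))"
    by (rule nn)
  also have "\<dots> = inner x (T x) + inner y (T y) - inner x (T y) - inner y (T x)"
    by (simp add: blinfun.diff_right inner_diff_left inner_diff_right)
  also have "inner y (T x) = inner x (T y)"
    using selfadjoint_inner[OF T, of x y] by (simp add: inner_commute)
  finally show ?thesis
    by simp
qed

text \<open>Turns an additive bound on a real bilinear form into an operator norm bound, by testing
  with a vector in the direction of T y.\<close>

lemma norm_le_of_form_bound:
  fixes T :: "'a :: real_inner \<Rightarrow>\<^sub>L 'b :: real_inner"
  assumes bound: "\<And>x y. 2 * inner x (T y) \<le> c * ((norm x)\<^sup>2 + (norm y)\<^sup>2)" and c: "0 \<le> c"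
  shows "norm T \<le> c"
proof (rule norm_blinfun_bound[OF c])
  fix y
  show "norm (T y) \<le> c * norm y"
  proof (cases "T y = 0")
    case False
    then have y: "norm y > 0"
      by (cases "y = 0") auto
    \<comment> \<open>This scaling gives the test vector the same norm as y, which makes the
      additive bound as strong as a product bound.\<close>
    define s where "s = norm y / norm (T y)"
    have "2 * inner (s *\<^sub>R T y) (T y) \<le> c * ((norm (s *\<^sub>R T y))\<^sup>2 + (norm y)\<^sup>2)"
      by (rule bound)
    moreover have "norm (s *\<^sub>R T y) = norm y"
      using False by (simp add: s_def)
    moreover have "inner (s *\<^sub>R T y) (T y) = norm y * norm (T y)"
      using False by (simp add: s_def power2_eq_square flip: power2_norm_eq_inner)
    ultimately have "2 * (norm y * norm (T y)) \<le> c * ((norm y)\<^sup>2 + (norm y)\<^sup>2)"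
      by metis
    then have "norm y * norm (T y) \<le> norm y * (c * norm y)"
      by (simp add: power2_eq_square algebra_simps)
    then show ?thesis
      using y by simp
  qed (use c in simp)
qed

lemma norm_positive_le:
  assumes T: "selfadjoint T" and nn: "\<And>x. 0 \<le> inner x (T x)"
    and le: "\<And>x. inner x (T x) \<le> c * (norm x)\<^sup>2" and c: "0 \<le> c"
  shows "norm T \<le> c"
proof (rule norm_le_of_form_bound[OF _ c])
  fix x y
  show "2 * inner x (T y) \<le> c * ((norm x)\<^sup>2 + (norm y)\<^sup>2)"
    using inner_le_half_sum[OF T nn, of x y] le[of x] le[of y] by (simp add: algebra_simps)
qed

lemma inner_blinfun_le: "inner x (blinfun_apply T x) \<le> norm T * (norm x)\<^sup>2"
proof -
  have "inner x (T x) \<le> norm x * norm (T x)"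
    by (rule norm_cauchy_schwarz)
  also have "\<dots> \<le> norm x * (norm T * norm x)"
    by (intro mult_left_mono norm_blinfun) auto
  finally show ?thesis
    by (simp add: power2_eq_square mult_ac)
qed

section \<open>Square roots of positive operators\<close>

text \<open>If \<open>\<parallel>X\<parallel> \<le> 1\<close>, then the iteration \<open>Y \<mapsto> (X + Y\<^sup>2) / 2\<close> converges in norm to a solution of
  \<open>(I - Y)\<^sup>2 = I - X\<close>, because its increments are dominated by those of the scalar iteration
  \<open>y \<mapsto> (1 + y\<^sup>2) / 2\<close>.\<close>

primrec sqrt_iter :: "('a :: real_normed_vector \<Rightarrow>\<^sub>L 'a) \<Rightarrow> nat \<Rightarrow> 'a \<Rightarrow>\<^sub>L 'a" where
  "sqrt_iter X 0 = 0"
| "sqrt_iter X (Suc n) = (1 / 2) *\<^sub>R (X + (sqrt_iter X n o\<^sub>L sqrt_iter X n))"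

primrec sqrt_majorant :: "nat \<Rightarrow> real" where
  "sqrt_majorant 0 = 0"
| "sqrt_majorant (Suc n) = (1 + (sqrt_majorant n)\<^sup>2) / 2"

lemma sqrt_majorant_bounds: "0 \<le> sqrt_majorant n \<and> sqrt_majorant n \<le> 1"
proof (induction n)
  case (Suc n)
  then have "(sqrt_majorant n)\<^sup>2 \<le> 1"
    by (simp add: power_le_one)
  then show ?case
    by simp
qed simp

lemma incseq_sqrt_majorant: "incseq sqrt_majorant"
proof (rule incseq_SucI)
  fix n
  have "0 \<le> (1 - sqrt_majorant n)\<^sup>2"
    by simp
  then show "sqrt_majorant n \<le> sqrt_majorant (Suc n)"
    by (simp add: power2_eq_square algebra_simps)
qed

lemma norm_sqrt_iter:
  assumes X: "norm X \<le> 1"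
  shows "norm (sqrt_iter X n) \<le> sqrt_majorant n"
proof (induction n)
  case (Suc n)
  have "norm (sqrt_iter X n o\<^sub>L sqrt_iter X n) \<le> norm (sqrt_iter X n) * norm (sqrt_iter X n)"
    by (rule norm_blinfun_compose)
  also have "\<dots> \<le> (sqrt_majorant n)\<^sup>2"
    using Suc by (simp add: power2_eq_square mult_mono sqrt_majorant_bounds)
  finally have "norm (X + (sqrt_iter X n o\<^sub>L sqrt_iter X n)) \<le> 1 + (sqrt_majorant n)\<^sup>2"
    using X by (intro order_trans[OF norm_triangle_ineq] add_mono)
  then show ?case
    by simp
qed simp

lemma norm_sqrt_iter_diff:
  assumes X: "norm X \<le> 1"
  shows "norm (sqrt_iter X (n + m) - sqrt_iter X n) \<le> sqrt_majorant (n + m) - sqrt_majorant n"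
proof (induction n)
  case 0
  then show ?case
    using norm_sqrt_iter[OF X, of m] by simp
next
  case (Suc n)
  let ?Y = "sqrt_iter X" and ?y = sqrt_majorant
  \<comment> \<open>Difference of two squares, written so that nothing has to commute.\<close>
  have "(?Y (n + m) o\<^sub>L ?Y (n + m)) - (?Y n o\<^sub>L ?Y n) =
      (?Y (n + m) o\<^sub>L (?Y (n + m) - ?Y n)) + ((?Y (n + m) - ?Y n) o\<^sub>L ?Y n)"
    by (intro blinfun_eqI) (simp add: blinfun.diff_left blinfun.diff_right blinfun.add_left)
  also have "norm \<dots> \<le> norm (?Y (n + m)) * norm (?Y (n + m) - ?Y n) +
      norm (?Y (n + m) - ?Y n) * norm (?Y n)"
    by (intro order_trans[OF norm_triangle_ineq] add_mono norm_blinfun_compose)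
  also have "\<dots> \<le> ?y (n + m) * (?y (n + m) - ?y n) + (?y (n + m) - ?y n) * ?y n"
    using Suc norm_sqrt_iter[OF X] sqrt_majorant_bounds
      incseqD[OF incseq_sqrt_majorant, of n "n + m"]
    by (intro add_mono mult_mono) auto
  also have "\<dots> = (?y (n + m))\<^sup>2 - (?y n)\<^sup>2"
    by (simp add: power2_eq_square algebra_simps)
  finally have *: "norm ((?Y (n + m) o\<^sub>L ?Y (n + m)) - (?Y n o\<^sub>L ?Y n)) \<le> (?y (n + m))\<^sup>2 - (?y n)\<^sup>2" .
  have "?Y (Suc n + m) - ?Y (Suc n) =
      (1 / 2) *\<^sub>R ((?Y (n + m) o\<^sub>L ?Y (n + m)) - (?Y n o\<^sub>L ?Y n))"
    by (simp add: scaleR_diff_right scaleR_add_right)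
  then have "norm (?Y (Suc n + m) - ?Y (Suc n)) =
      norm ((?Y (n + m) o\<^sub>L ?Y (n + m)) - (?Y n o\<^sub>L ?Y n)) / 2"
    by simp
  then show ?case
    using * by (simp del: sqrt_iter.simps add: diff_divide_distrib[symmetric])
qed

lemma convergent_sqrt_iter:
  fixes X :: "'a :: banach \<Rightarrow>\<^sub>L 'a"
  assumes X: "norm X \<le> 1"
  shows "convergent (sqrt_iter X)"
proof -
  have "convergent sqrt_majorant"
    by (rule Bseq_mono_convergent[OF BseqI'[where K = 1]])
       (use sqrt_majorant_bounds incseqD[OF incseq_sqrt_majorant] in auto)
  then have "Cauchy sqrt_majorant"
    by (rule convergent_Cauchy)
  have le: "dist (sqrt_iter X m) (sqrt_iter X n) \<le> dist (sqrt_majorant m) (sqrt_majorant n)"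
    if "n \<le> m" for m n
    using norm_sqrt_iter_diff[OF X, of n "m - n"] that incseqD[OF incseq_sqrt_majorant that]
    by (simp add: dist_norm)
  then have le: "dist (sqrt_iter X m) (sqrt_iter X n) \<le> dist (sqrt_majorant m) (sqrt_majorant n)"
    for m n
    by (metis dist_commute nle_le)
  have "Cauchy (sqrt_iter X)"
    using \<open>Cauchy sqrt_majorant\<close> unfolding Cauchy_def by (meson le le_less_trans)
  then show ?thesis
    by (rule Cauchy_convergent)
qed

lemma selfadjoint_sqrt_iter: "selfadjoint X \<Longrightarrow> selfadjoint (sqrt_iter X n)"
  by (induction n)
     (simp_all add: selfadjoint_zero selfadjoint_add selfadjoint_scaleR selfadjoint_square)

lemma commute_sqrt_iter: "S o\<^sub>L X = X o\<^sub>L S \<Longrightarrow> S o\<^sub>L sqrt_iter X n = sqrt_iter X n o\<^sub>L S"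
proof (induction n)
  case (Suc n)
  then have "S (X x) = X (S x)" "S (sqrt_iter X n x) = sqrt_iter X n (S x)" for x
    by (metis blinfun_apply_blinfun_compose)+
  then show ?case
    by (intro blinfun_eqI) (simp add: blinfun.scaleR_left blinfun.scaleR_right blinfun.add_left
        blinfun.add_right)
qed (auto intro!: blinfun_eqI)

text \<open>The root is I - Y, where Y is the limit of the iteration for X = I - T and 2 Y = X +
  Y^2. Every iterate commutes with whatever commutes with T, hence so does the root; its uniqueness
  rests on this.\<close>

lemma contraction_sqrt_exists:
  assumes T: "selfadjoint T" and le: "norm (id_blinfun - T) \<le> 1"
  shows "\<exists>R. selfadjoint R \<and> (\<forall>x. 0 \<le> inner x (R x)) \<and> R o\<^sub>L R = T \<and>
    (\<forall>S. S o\<^sub>L T = T o\<^sub>L S \<longrightarrow> S o\<^sub>L R = R o\<^sub>L S)"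
proof -
  define X where "X = id_blinfun - T"
  have X: "norm X \<le> 1" "selfadjoint X"
    using le T by (simp_all add: X_def selfadjoint_diff selfadjoint_id)
  obtain Y where Y: "sqrt_iter X \<longlonglongrightarrow> Y"
    using convergent_sqrt_iter[OF X(1)] by (auto simp: convergent_def)
  have "(\<lambda>n. (1 / 2) *\<^sub>R (X + (sqrt_iter X n o\<^sub>L sqrt_iter X n))) \<longlonglongrightarrow> (1 / 2) *\<^sub>R (X + (Y o\<^sub>L Y))"
    by (intro tendsto_intros bounded_bilinear.tendsto[OF bounded_bilinear_blinfun_compose] Y)
  then have "(\<lambda>n. sqrt_iter X (Suc n)) \<longlonglongrightarrow> (1 / 2) *\<^sub>R (X + (Y o\<^sub>L Y))"
    by (simp only: sqrt_iter.simps)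
  then have fixpoint: "Y = (1 / 2) *\<^sub>R (X + (Y o\<^sub>L Y))"
    by (rule LIMSEQ_unique[OF LIMSEQ_Suc[OF Y]])
  have fixpoint': "2 *\<^sub>R Y x = X x + Y (Y x)" for x
  proof -
    have "2 *\<^sub>R Y x = 2 *\<^sub>R ((1 / 2) *\<^sub>R (X + (Y o\<^sub>L Y))) x"
      by (rule arg_cong[OF fixpoint, of "\<lambda>Z. 2 *\<^sub>R blinfun_apply Z x"])
    then show ?thesis
      by (simp add: blinfun.scaleR_left blinfun.add_left)
  qed
  have selfY: "selfadjoint Y"
    using closed_sequentially[OF closed_selfadjoint _ Y] X selfadjoint_sqrt_iter by blast
  have "norm Y \<le> 1"
  proof (rule LIMSEQ_le_const2[OF tendsto_norm[OF Y]])
    show "\<exists>N. \<forall>n\<ge>N. norm (sqrt_iter X n) \<le> 1"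
      using norm_sqrt_iter[OF X(1)] sqrt_majorant_bounds order_trans by blast
  qed
  let ?R = "id_blinfun - Y"
  show ?thesis
  proof (intro exI[of _ ?R] conjI allI impI)
    show "selfadjoint ?R"
      by (intro selfadjoint_diff selfadjoint_id selfY)
    fix x
    have "inner x (Y x) \<le> norm Y * (norm x)\<^sup>2"
      by (rule inner_blinfun_le)
    also have "\<dots> \<le> 1 * (norm x)\<^sup>2"
      by (intro mult_right_mono \<open>norm Y \<le> 1\<close>) simp
    finally show "0 \<le> inner x (?R x)"
      by (simp add: blinfun.diff_left inner_diff_right power2_norm_eq_inner)
  next
    show "?R o\<^sub>L ?R = T"
    proof (rule blinfun_eqI)
      fix x
      have "(?R o\<^sub>L ?R) x = x - 2 *\<^sub>R Y x + Y (Y x)"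
        by (simp add: blinfun.diff_left blinfun.diff_right scaleR_2 algebra_simps)
      also have "\<dots> = T x"
        unfolding fixpoint' by (simp add: X_def blinfun.diff_left)
      finally show "(?R o\<^sub>L ?R) x = T x" .
    qed
  next
    fix S assume "S o\<^sub>L T = T o\<^sub>L S"
    then have "S (T x) = T (S x)" for x
      by (metis blinfun_apply_blinfun_compose)
    then have "S o\<^sub>L X = X o\<^sub>L S"
      by (intro blinfun_eqI) (simp add: X_def blinfun.diff_left blinfun.diff_right)
    then have "(\<lambda>n. S o\<^sub>L sqrt_iter X n) = (\<lambda>n. sqrt_iter X n o\<^sub>L S)"
      by (intro ext commute_sqrt_iter)
    moreover have "(\<lambda>n. S o\<^sub>L sqrt_iter X n) \<longlonglongrightarrow> (S o\<^sub>L Y)"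
      by (intro bounded_bilinear.tendsto[OF bounded_bilinear_blinfun_compose] Y tendsto_const)
    moreover have "(\<lambda>n. sqrt_iter X n o\<^sub>L S) \<longlonglongrightarrow> (Y o\<^sub>L S)"
      by (intro bounded_bilinear.tendsto[OF bounded_bilinear_blinfun_compose] Y tendsto_const)
    ultimately have *: "S o\<^sub>L Y = Y o\<^sub>L S"
      by (simp only: LIMSEQ_unique)
    have "S (Y x) = Y (S x)" for x
      using arg_cong[OF *, of "\<lambda>Z. blinfun_apply Z x"] by simp
    then show "S o\<^sub>L ?R = ?R o\<^sub>L S"
      by (intro blinfun_eqI) (simp add: blinfun.diff_left blinfun.diff_right)
  qed
qed

text \<open>Dividing T by a bound c of its norm gives 0 \<le> T / c \<le> I, so I - T / c has norm
  at most 1. The root is scaled back by the square root of c.\<close>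

lemma sqrt_exists:
  fixes T :: "'a :: chilbert_space \<Rightarrow>\<^sub>L 'a"
  assumes T: "selfadjoint T" and nn: "\<And>x. 0 \<le> inner x (T x)"
  shows "\<exists>R. selfadjoint R \<and> (\<forall>x. 0 \<le> inner x (R x)) \<and> R o\<^sub>L R = T \<and>
    (\<forall>S. S o\<^sub>L T = T o\<^sub>L S \<longrightarrow> S o\<^sub>L R = R o\<^sub>L S)"
proof -
  \<comment> \<open>Adding 1 keeps c positive also when T = 0.\<close>
  define c where "c = norm T + 1"
  have c: "c > 0" "norm T \<le> c"
    by (simp_all add: c_def add_nonneg_pos)
  define T' where "T' = (1 / c) *\<^sub>R T"
  have T': "selfadjoint T'"
    unfolding T'_def by (rule selfadjoint_scaleR[OF T])
  have "norm (id_blinfun - T') \<le> 1"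
  proof (rule norm_positive_le)
    show "selfadjoint (id_blinfun - T')"
      by (intro selfadjoint_diff selfadjoint_id T')
    fix x
    have eq: "inner x ((id_blinfun - T') x) = (norm x)\<^sup>2 - inner x (T x) / c"
      by (simp add: T'_def blinfun.diff_left blinfun.scaleR_left inner_diff_right
          power2_norm_eq_inner)
    have "inner x (T x) \<le> norm T * (norm x)\<^sup>2"
      by (rule inner_blinfun_le)
    also have "\<dots> \<le> c * (norm x)\<^sup>2"
      by (intro mult_right_mono c) simp
    finally show "0 \<le> inner x ((id_blinfun - T') x)"
      unfolding eq using c by (simp add: divide_le_eq mult.commute)
    show "inner x ((id_blinfun - T') x) \<le> 1 * (norm x)\<^sup>2"
      unfolding eq using nn[of x] c by simp
  qed simp
  then obtain R where R: "selfadjoint R" "\<And>x. 0 \<le> inner x (R x)" "R o\<^sub>L R = T'"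
      and comm: "\<And>S. S o\<^sub>L T' = T' o\<^sub>L S \<Longrightarrow> S o\<^sub>L R = R o\<^sub>L S"
    using contraction_sqrt_exists[OF T'] by blast
  let ?R = "sqrt c *\<^sub>R R"
  have RR: "R (R x) = (1 / c) *\<^sub>R T x" for x
    using arg_cong[OF R(3), of "\<lambda>T. blinfun_apply T x"] by (simp add: T'_def blinfun.scaleR_left)
  show ?thesis
  proof (intro exI[of _ ?R] conjI allI impI)
    show "selfadjoint ?R"
      by (rule selfadjoint_scaleR[OF R(1)])
    show "0 \<le> inner x (?R x)" for x
      using R(2)[of x] c by (simp add: blinfun.scaleR_left)
    show "?R o\<^sub>L ?R = T"
      by (rule blinfun_eqI) (use c in \<open>simp add: blinfun.scaleR_left blinfun.scaleR_right RR\<close>)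
    fix S assume "S o\<^sub>L T = T o\<^sub>L S"
    then have "S (T x) = T (S x)" for x
      by (metis blinfun_apply_blinfun_compose)
    then have "S o\<^sub>L T' = T' o\<^sub>L S"
      by (intro blinfun_eqI) (simp add: T'_def blinfun.scaleR_left blinfun.scaleR_right)
    then have "S (R x) = R (S x)" for x
      by (metis comm blinfun_apply_blinfun_compose)
    then show "S o\<^sub>L ?R = ?R o\<^sub>L S"
      by (intro blinfun_eqI) (simp add: blinfun.scaleR_left blinfun.scaleR_right)
  qed
qed

text \<open>With a self-adjoint root R, the vanishing form is the squared norm of R x, and T x = R
  (R x).\<close>

lemma positive_form_eq_0:
  fixes T :: "'a :: chilbert_space \<Rightarrow>\<^sub>L 'a"
  assumes T: "selfadjoint T" and nn: "\<And>x. 0 \<le> inner x (T x)" and x: "inner x (T x) = 0"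
  shows "T x = 0"
proof -
  obtain R where R: "selfadjoint R" "R o\<^sub>L R = T"
    using sqrt_exists[OF T nn] by blast
  have T_eq: "T x = R (R x)"
    by (simp add: R(2)[symmetric])
  then have "(norm (R x))\<^sup>2 = 0"
    using x by (simp add: power2_norm_eq_inner selfadjoint_inner[OF R(1)])
  then show ?thesis
    by (simp add: T_eq)
qed

text \<open>For y = R x - R' x, commutation gives R y + R' y = 0. Two nonnegative forms with sum 0
  both vanish at y, hence R y = R' y = 0, and y is orthogonal to itself.\<close>

lemma sqrt_unique:
  assumes R: "selfadjoint R" "\<And>x. 0 \<le> inner x (R x)"
    and R': "selfadjoint R'" "\<And>x. 0 \<le> inner x (R' x)"
    and eq: "R o\<^sub>L R = R' o\<^sub>L R'" and comm: "R' o\<^sub>L R = R o\<^sub>L R'"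
  shows "R = R'"
proof (rule blinfun_eqI)
  fix x
  define y where "y = R x - R' x"
  have eq': "R (R x) = R' (R' x)"
    by (metis eq blinfun_apply_blinfun_compose)
  have comm': "R' (R x) = R (R' x)"
    by (metis comm blinfun_apply_blinfun_compose)
  have sum: "R y + R' y = 0"
    by (simp add: y_def blinfun.diff_right eq' comm')
  then have "inner y (R y) + inner y (R' y) = 0"
    by (metis inner_add_right inner_zero_right)
  then have "inner y (R y) = 0" "inner y (R' y) = 0"
    using R(2)[of y] R'(2)[of y] by linarith+
  then have "R y = 0" "R' y = 0"
    using positive_form_eq_0 R R' by blast+
  moreover have "(norm y)\<^sup>2 = inner x (R y) - inner x (R' y)"
    unfolding power2_norm_eq_inner selfadjoint_inner[OF R(1)] selfadjoint_inner[OF R'(1)]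
    by (simp add: y_def inner_diff_left)
  ultimately show "R x = R' x"
    by (simp add: y_def)
qed

text \<open>The description in \<open>sqrt_op\<close> ranges over all positive roots Q, whereas
  \<open>sqrt_unique\<close> compares commuting ones. The root R0 from \<open>sqrt_exists\<close>
  serves as reference: Q commutes with T = Q^2, hence with R0.\<close>

lemma sqrt_op_eqI:
  assumes R: "selfadjoint R" "\<And>x. 0 \<le> inner x (R x)" "R o\<^sub>L R = T"
  shows "sqrt_op T = R"
proof -
  have T: "selfadjoint T" "\<And>x. 0 \<le> inner x (T x)"
    using selfadjoint_inner[OF R(1), of x "R x" for x] R(1)
    unfolding R(3)[symmetric] by (simp_all add: selfadjoint_square)
  then obtain R0 where R0: "selfadjoint R0" "\<And>x. 0 \<le> inner x (R0 x)" "R0 o\<^sub>L R0 = T"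
      and comm: "\<And>S. S o\<^sub>L T = T o\<^sub>L S \<Longrightarrow> S o\<^sub>L R0 = R0 o\<^sub>L S"
    using sqrt_exists[OF T] by blast
  have *: "Q = R0" if Q: "Q \<in> cbounded" "pos_op Q" "Q o\<^sub>L Q = T" for Q
  proof -
    have "Q o\<^sub>L T = T o\<^sub>L Q"
      unfolding Q(3)[symmetric] by (intro blinfun_eqI) simp
    then have "Q o\<^sub>L R0 = R0 o\<^sub>L Q"
      by (rule comm)
    moreover have "selfadjoint Q" "\<And>x. 0 \<le> inner x (Q x)"
      using Q pos_op_iff by blast+
    moreover have "R0 o\<^sub>L R0 = Q o\<^sub>L Q"
      by (simp only: R0 Q)
    ultimately show ?thesis
      using sqrt_unique[OF R0(1,2)] by blast
  qed
  have "R \<in> cbounded" "pos_op R"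
    using R selfadjoint_cbounded pos_op_iff by blast+
  moreover have "Q = R" if "Q \<in> cbounded \<and> pos_op Q \<and> Q o\<^sub>L Q = T" for Q
    using that *[of Q] *[OF calculation R(3)] by simp
  ultimately show ?thesis
    unfolding sqrt_op_def using R(3) by (intro the_equality conjI)
qed

lemma
  assumes T: "selfadjoint T" "\<And>x. 0 \<le> inner x (T x)"
  shows selfadjoint_sqrt_op: "selfadjoint (sqrt_op T)"
    and sqrt_op_square: "sqrt_op T (sqrt_op T x) = T x"
proof -
  obtain R where "selfadjoint R" "\<And>x. 0 \<le> inner x (R x)" "R o\<^sub>L R = T"
    using sqrt_exists[OF T] by blast
  moreover from this have "sqrt_op T = R"
    by (rule sqrt_op_eqI)
  ultimately show "selfadjoint (sqrt_op T)" "sqrt_op T (sqrt_op T x) = T x"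
    by auto
qed

lemma norm_sqrt_op_le:
  assumes T: "selfadjoint T" "\<And>x. 0 \<le> inner x (T x)"
  shows "norm (sqrt_op T) \<le> sqrt (norm T)"
proof (rule norm_blinfun_bound)
  fix x
  have "(norm (sqrt_op T x))\<^sup>2 = inner x (T x)"
    using selfadjoint_inner[OF selfadjoint_sqrt_op[OF T], of x "sqrt_op T x"]
    by (simp add: sqrt_op_square[OF T] power2_norm_eq_inner)
  also have "\<dots> \<le> norm T * (norm x)\<^sup>2"
    by (rule inner_blinfun_le)
  also have "\<dots> = (sqrt (norm T) * norm x)\<^sup>2"
    by (simp add: power_mult_distrib)
  finally show "norm (sqrt_op T x) \<le> sqrt (norm T) * norm x"
    by (rule power2_le_imp_le) simp
qed simp

text \<open>Expansion of the squared norm of \<open>sqrt_op T x - s *\<^sub>R x\<close>. The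
  parameter s is free and is chosen according to r in (iv).\<close>

lemma sqrt_op_form_le:
  assumes T: "selfadjoint T" "\<And>x. 0 \<le> inner x (T x)" and s: "0 < s"
  shows "inner x (sqrt_op T x) \<le> (inner x (T x) / s + s * (norm x)\<^sup>2) / 2"
proof -
  let ?y = "sqrt_op T x"
  have y: "inner ?y ?y = inner x (T x)"
    using selfadjoint_inner[OF selfadjoint_sqrt_op[OF T], of x ?y] by (simp add: sqrt_op_square[OF T])
  have "0 \<le> inner (?y - s *\<^sub>R x) (?y - s *\<^sub>R x)"
    by simp
  also have "\<dots> = inner x (T x) - 2 * s * inner x ?y + s\<^sup>2 * (norm x)\<^sup>2"
    unfolding power2_norm_eq_inner y[symmetric]
    by (simp add: inner_diff_left inner_diff_right inner_commute power2_eq_square algebra_simps)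
  finally have "2 * s * inner x ?y \<le> inner x (T x) + s\<^sup>2 * (norm x)\<^sup>2"
    by simp
  then show ?thesis
    using s by (simp add: field_simps power2_eq_square)
qed

section \<open>Tensor products of operators\<close>

text \<open>The coordinate expansion of u is a convergent sum of elementary tensors, so
  real-linearity and continuity suffice. The general codomain covers functionals and coordinate
  maps.\<close>

lemma bounded_linear_eq_tensorI:
  fixes f g :: "('a :: chilbert_space, 'b :: chilbert_space) htensor \<Rightarrow> 'c :: real_normed_vector"
  assumes "bounded_linear f" "bounded_linear g" "\<And>x y. f (x \<otimes> y) = g (x \<otimes> y)"
  shows "f u = g u"
proof -
  have "((\<lambda>e. f (e \<otimes> htensor_nth u e)) has_sum f u) onb"
    and "((\<lambda>e. g (e \<otimes> htensor_nth u e)) has_sum g u) onb"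
    by (rule has_sum_bounded_linear[OF _ htensor_has_sum], rule assms)+
  then show ?thesis
    using assms(3) has_sum_unique by fastforce
qed

lemma bounded_linear_htensor_nth: "bounded_linear (\<lambda>u. htensor_nth u e)"
  by (rule bounded_linear_intro[where K = 1])
     (simp_all add: htensor_nth_simps norm_htensor.rep_eq norm_l2_nth_le)

lemma tensor_scaleR_left: "(r *\<^sub>R x) \<otimes> y = r *\<^sub>R (x \<otimes> y)"
  by (simp add: scaleR_scaleC tensor_scaleC_left)

lemma tensor_zero_left: "0 \<otimes> y = 0"
  using tensor_scaleC_left[of 0 0 y] by simp

lemma cbounded_tensor_op:
  assumes T: "T \<in> cbounded" and A: "A \<in> cbounded"
  shows "T \<otimes>\<^sub>o A \<in> cbounded"
proof -
  have "(T \<otimes>\<^sub>o A) (c *\<^sub>C u) = c *\<^sub>C (T \<otimes>\<^sub>o A) u" for c u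
  proof (rule bounded_linear_eq_tensorI[of "\<lambda>u. (T \<otimes>\<^sub>o A) (c *\<^sub>C u)"])
    show "bounded_linear (\<lambda>u. (T \<otimes>\<^sub>o A) (c *\<^sub>C u))"
      by (rule bounded_linear_compose[OF blinfun.bounded_linear_right bounded_linear_scaleC_right])
    show "bounded_linear (\<lambda>u. c *\<^sub>C (T \<otimes>\<^sub>o A) u)"
      by (rule bounded_linear_compose[OF bounded_linear_scaleC_right blinfun.bounded_linear_right])
  qed (simp add: tensor_op_apply[OF assms] cbounded_scaleC[OF T]
      flip: tensor_scaleC_left)
  then show ?thesis
    by (simp add: cbounded_def)
qed

lemma tensor_op_compose:
  assumes "T \<in> cbounded" "A \<in> cbounded" "T' \<in> cbounded" "A' \<in> cbounded"
  shows "(T \<otimes>\<^sub>o A) o\<^sub>L (T' \<otimes>\<^sub>o A') = (T o\<^sub>L T') \<otimes>\<^sub>o (A o\<^sub>L A')"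
  by (rule blinfun_eq_tensorI) (simp add: assms tensor_op_apply cbounded_compose)

lemma tensor_op_id: "id_blinfun \<otimes>\<^sub>o id_blinfun = id_blinfun"
  by (rule blinfun_eq_tensorI) (simp add: tensor_op_apply cbounded_id)

lemma tensor_op_add_right:
  assumes "T \<in> cbounded" "A \<in> cbounded" "A' \<in> cbounded"
  shows "T \<otimes>\<^sub>o (A + A') = (T \<otimes>\<^sub>o A) + (T \<otimes>\<^sub>o A')"
  by (rule blinfun_eq_tensorI)
     (simp add: assms tensor_op_apply cbounded_add blinfun.add_left tensor_add_right)

lemma adj_tensor_op:
  assumes T: "T \<in> cbounded" and A: "A \<in> cbounded"
  shows "adj_op (T \<otimes>\<^sub>o A) = adj_op T \<otimes>\<^sub>o adj_op A"
proof (rule blinfun_eq_tensorI)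
  fix x y
  have "cinner (adj_op (T \<otimes>\<^sub>o A) (x \<otimes> y)) u = cinner ((adj_op T \<otimes>\<^sub>o adj_op A) (x \<otimes> y)) u" for u
  proof (rule bounded_linear_eq_tensorI)
    fix x' y'
    show "cinner (adj_op (T \<otimes>\<^sub>o A) (x \<otimes> y)) (x' \<otimes> y') =
        cinner ((adj_op T \<otimes>\<^sub>o adj_op A) (x \<otimes> y)) (x' \<otimes> y')"
      by (simp add: adj_op_apply cbounded_tensor_op tensor_op_apply cinner_tensor assms
          cbounded_adj_op)
  qed (rule bounded_linear_cinner_right)+
  then have *: "cinner u (adj_op (T \<otimes>\<^sub>o A) (x \<otimes> y)) = cinner u ((adj_op T \<otimes>\<^sub>o adj_op A) (x \<otimes> y))"
    for u
    by (metis cinner_commute)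
  have "adj_op (T \<otimes>\<^sub>o A) (x \<otimes> y) - (adj_op T \<otimes>\<^sub>o adj_op A) (x \<otimes> y) = 0"
    by (rule cinner_eq_0_all) (simp only: cinner_diff_right * diff_self)
  then show "adj_op (T \<otimes>\<^sub>o A) (x \<otimes> y) = (adj_op T \<otimes>\<^sub>o adj_op A) (x \<otimes> y)"
    by simp
qed

lemma selfadjoint_tensor_op:
  assumes "selfadjoint T" "selfadjoint A"
  shows "selfadjoint (T \<otimes>\<^sub>o A)"
proof -
  have "adj_op (T \<otimes>\<^sub>o A) = T \<otimes>\<^sub>o A"
    using assms by (simp add: adj_tensor_op selfadjoint_cbounded adj_op_selfadjoint)
  moreover have "T \<otimes>\<^sub>o A \<in> cbounded"
    using assms by (intro cbounded_tensor_op selfadjoint_cbounded)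
  ultimately show ?thesis
    unfolding selfadjoint_def by (metis cinner_adj_op)
qed

lemma norm_tensor_op_le:
  assumes T: "T \<in> cbounded" and A: "A \<in> cbounded"
  shows "norm (T \<otimes>\<^sub>o A) \<le> norm T * norm A"
proof (rule norm_blinfun_bound)
  fix u
  let ?s = "\<lambda>F. \<Sum>e\<in>F. T e \<otimes> A (htensor_nth u e)"
  show "norm ((T \<otimes>\<^sub>o A) u) \<le> norm T * norm A * norm u"
  proof (rule tendsto_upperbound)
    have "((\<lambda>e. (T \<otimes>\<^sub>o A) (e \<otimes> htensor_nth u e)) has_sum (T \<otimes>\<^sub>o A) u) onb"
      by (rule has_sum_bounded_linear[OF blinfun.bounded_linear_right htensor_has_sum])
    then show "((\<lambda>F. norm (?s F)) \<longlongrightarrow> norm ((T \<otimes>\<^sub>o A) u)) (finite_subsets_at_top onb)"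
      by (intro tendsto_norm) (simp add: has_sum_def tensor_op_apply[OF assms])
    have "norm (?s F) \<le> norm T * norm A * norm u" if F: "finite F" "F \<subseteq> onb" for F
    proof (rule power2_le_imp_le)
      have "(norm (?s F))\<^sup>2 \<le> (norm T)\<^sup>2 * (\<Sum>e\<in>F. (norm (A (htensor_nth u e)))\<^sup>2)"
        by (rule tensor_op_finite_bound[OF T F])
      also have "\<dots> \<le> (norm T)\<^sup>2 * (\<Sum>e\<in>F. (norm A * norm (htensor_nth u e))\<^sup>2)"
        by (intro mult_left_mono sum_mono power_mono norm_blinfun) auto
      also have "\<dots> = (norm T * norm A)\<^sup>2 * (\<Sum>e\<in>F. (norm (htensor_nth u e))\<^sup>2)"
        by (simp only: power_mult_distrib sum_distrib_left mult.assoc)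
      also have "\<dots> \<le> (norm T * norm A)\<^sup>2 * (norm u)\<^sup>2"
        unfolding norm_htensor_sq
        by (intro mult_left_mono finite_sum_le_infsum l2_summable F) auto
      finally show "(norm (?s F))\<^sup>2 \<le> (norm T * norm A * norm u)\<^sup>2"
        by (simp only: power_mult_distrib)
    qed simp
    then show "\<forall>\<^sub>F F in finite_subsets_at_top onb. norm (?s F) \<le> norm T * norm A * norm u"
      by (intro eventually_finite_subsets_at_top_weakI)
  qed simp
qed simp

text \<open>In the coordinate model I \<otimes> A acts on every coordinate by A. This reduces
  inequalities between forms of such operators to inequalities on the second factor.\<close>

lemma htensor_nth_tensor_op_id:
  assumes "A \<in> cbounded"
  shows "htensor_nth ((id_blinfun \<otimes>\<^sub>o A) u) e = A (htensor_nth u e)"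
proof (rule bounded_linear_eq_tensorI[of "\<lambda>u. htensor_nth ((id_blinfun \<otimes>\<^sub>o A) u) e"])
  show "bounded_linear (\<lambda>u. htensor_nth ((id_blinfun \<otimes>\<^sub>o A) u) e)"
    by (rule bounded_linear_compose[OF bounded_linear_htensor_nth blinfun.bounded_linear_right])
  show "bounded_linear (\<lambda>u. A (htensor_nth u e))"
    by (rule bounded_linear_compose[OF blinfun.bounded_linear_right bounded_linear_htensor_nth])
qed (simp add: tensor_op_apply cbounded_id assms htensor_nth_tensor cbounded_scaleC)

lemma has_sum_inner_htensor:
  "((\<lambda>e. inner (htensor_nth u e) (htensor_nth v e)) has_sum inner u v) UNIV"
  using has_sum_bounded_linear[OF bounded_linear_Re has_sum_infsum[OF summable_cinner],
      of "l2_of_htensor u" "l2_of_htensor v"]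
  by (simp add: inner_htensor.rep_eq inner_l2_def inner_eq_Re_cinner[symmetric])

lemma tensor_op_id_form_nonneg:
  assumes "T \<in> cbounded" "\<And>x. 0 \<le> inner x (T x)"
  shows "0 \<le> inner f ((id_blinfun \<otimes>\<^sub>o T) f)"
  by (rule has_sum_nonneg[OF has_sum_inner_htensor])
     (simp add: htensor_nth_tensor_op_id assms)

text \<open>The assumed bound holds for all vectors x and h, so it can be applied to the coordinates
  at each e and then summed over e.\<close>

lemma form_bound_amplification:
  fixes A :: "'w \<Rightarrow> 'h :: chilbert_space \<Rightarrow>\<^sub>L 'h"
    and f :: "('l :: chilbert_space, 'h) htensor"
  assumes W: "finite W" and cb: "D \<in> cbounded" "\<And>\<alpha>. \<alpha> \<in> W \<Longrightarrow> A \<alpha> \<in> cbounded"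
    and bound: "\<And>x h. (\<Sum>\<alpha>\<in>W. inner (h \<alpha>) (A \<alpha> x)) \<le>
      inner x (D x) + (\<Sum>\<alpha>\<in>W. inner (h \<alpha>) (D (h \<alpha>)))"
  shows "(\<Sum>\<alpha>\<in>W. inner (g \<alpha>) ((id_blinfun \<otimes>\<^sub>o A \<alpha>) f)) \<le>
    inner f ((id_blinfun \<otimes>\<^sub>o D) f) + (\<Sum>\<alpha>\<in>W. inner (g \<alpha>) ((id_blinfun \<otimes>\<^sub>o D) (g \<alpha>)))"
proof (rule has_sum_mono)
  show "((\<lambda>e. \<Sum>\<alpha>\<in>W. inner (htensor_nth (g \<alpha>) e) (htensor_nth ((id_blinfun \<otimes>\<^sub>o A \<alpha>) f) e))
      has_sum (\<Sum>\<alpha>\<in>W. inner (g \<alpha>) ((id_blinfun \<otimes>\<^sub>o A \<alpha>) f))) UNIV"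
    by (intro has_sum_sum W has_sum_inner_htensor)
  show "((\<lambda>e. inner (htensor_nth f e) (htensor_nth ((id_blinfun \<otimes>\<^sub>o D) f) e) +
      (\<Sum>\<alpha>\<in>W. inner (htensor_nth (g \<alpha>) e) (htensor_nth ((id_blinfun \<otimes>\<^sub>o D) (g \<alpha>)) e)))
      has_sum (inner f ((id_blinfun \<otimes>\<^sub>o D) f) +
        (\<Sum>\<alpha>\<in>W. inner (g \<alpha>) ((id_blinfun \<otimes>\<^sub>o D) (g \<alpha>))))) UNIV"
    by (intro has_sum_add has_sum_sum W has_sum_inner_htensor)
  fix e
  show "(\<Sum>\<alpha>\<in>W. inner (htensor_nth (g \<alpha>) e) (htensor_nth ((id_blinfun \<otimes>\<^sub>o A \<alpha>) f) e)) \<le>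
      inner (htensor_nth f e) (htensor_nth ((id_blinfun \<otimes>\<^sub>o D) f) e) +
      (\<Sum>\<alpha>\<in>W. inner (htensor_nth (g \<alpha>) e) (htensor_nth ((id_blinfun \<otimes>\<^sub>o D) (g \<alpha>)) e))"
    using bound[of "\<lambda>\<alpha>. htensor_nth (g \<alpha>) e" "htensor_nth f e"]
    by (simp add: htensor_nth_tensor_op_id cb)
qed

section \<open>Isometries with orthogonal ranges\<close>

definition orthogonal_isometries ::
    "'w set \<Rightarrow> ('w \<Rightarrow> 'a :: chilbert_space \<Rightarrow>\<^sub>L 'b :: chilbert_space) \<Rightarrow> bool" where
  "orthogonal_isometries W V \<longleftrightarrow> (\<forall>\<alpha>\<in>W. V \<alpha> \<in> cbounded) \<and>
     (\<forall>\<alpha>\<in>W. \<forall>\<beta>\<in>W. \<forall>x y. cinner (V \<alpha> x) (V \<beta> y) = (if \<alpha> = \<beta> then cinner x y else 0))"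

text \<open>Bessel's inequality, with p the projection of u onto the sum of the ranges: <p, u> = <p,
  p>, and the squared norm of u - p is nonnegative.\<close>

lemma orthogonal_isometries_bessel:
  assumes W: "finite W" and V: "orthogonal_isometries W V"
  shows "(\<Sum>\<alpha>\<in>W. (norm (adj_op (V \<alpha>) u))\<^sup>2) \<le> (norm u)\<^sup>2"
proof -
  let ?a = "\<lambda>\<alpha>. adj_op (V \<alpha>) u"
  define p where "p = (\<Sum>\<alpha>\<in>W. V \<alpha> (?a \<alpha>))"
  have cb: "V \<alpha> \<in> cbounded" if "\<alpha> \<in> W" for \<alpha>
    using V that by (simp add: orthogonal_isometries_def)
  have orth: "inner (V \<alpha> x) (V \<beta> y) = (if \<alpha> = \<beta> then inner x y else 0)"
    if "\<alpha> \<in> W" "\<beta> \<in> W" for \<alpha> \<beta> x y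
    using V that by (simp add: orthogonal_isometries_def inner_eq_Re_cinner)
  have "inner p u = (\<Sum>\<alpha>\<in>W. (norm (?a \<alpha>))\<^sup>2)"
    unfolding p_def inner_sum_left
    by (intro sum.cong refl) (simp add: power2_norm_eq_inner inner_adj_op cb)
  moreover have "inner p p = (\<Sum>\<alpha>\<in>W. \<Sum>\<beta>\<in>W. if \<alpha> = \<beta> then inner (?a \<alpha>) (?a \<beta>) else 0)"
    unfolding p_def inner_sum_left inner_sum_right
    by (intro sum.cong refl) (simp add: orth inner_commute)
  then have "inner p p = (\<Sum>\<alpha>\<in>W. (norm (?a \<alpha>))\<^sup>2)"
    using W by (simp add: power2_norm_eq_inner)
  moreover have "0 \<le> inner (u - p) (u - p)"
    by simp
  ultimately show ?thesis
    by (simp add: inner_diff_left inner_diff_right inner_commute power2_norm_eq_inner)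
qed

lemma orthogonal_isometries_tensor_id:
  fixes V :: "'w \<Rightarrow> 'a :: chilbert_space \<Rightarrow>\<^sub>L 'b :: chilbert_space"
  assumes V: "orthogonal_isometries W V"
  shows "orthogonal_isometries W
    (\<lambda>\<alpha>. V \<alpha> \<otimes>\<^sub>o (id_blinfun :: 'c :: chilbert_space \<Rightarrow>\<^sub>L 'c))"
proof -
  let ?I = "id_blinfun :: 'c \<Rightarrow>\<^sub>L 'c"
  have cb: "V \<alpha> \<in> cbounded" if "\<alpha> \<in> W" for \<alpha>
    using V that by (simp add: orthogonal_isometries_def)
  have "cinner ((V \<alpha> \<otimes>\<^sub>o ?I) x) ((V \<beta> \<otimes>\<^sub>o ?I) y) = (if \<alpha> = \<beta> then cinner x y else 0)"
    if W: "\<alpha> \<in> W" "\<beta> \<in> W" for \<alpha> \<beta> x y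
  proof -
    \<comment> \<open>Orthogonality of the ranges is recast as an operator identity for adjoints,
      which can be checked on elementary tensors.\<close>
    have *: "adj_op (V \<alpha>) (V \<beta> z) = (if \<alpha> = \<beta> then z else 0)" for z
    proof -
      have "adj_op (V \<alpha>) (V \<beta> z) - (if \<alpha> = \<beta> then z else 0) = 0"
        by (rule cinner_eq_0_all)
           (use V W in \<open>auto simp: cinner_diff_right cinner_adj_op cb orthogonal_isometries_def\<close>)
      then show ?thesis
        by simp
    qed
    have "adj_op (V \<alpha> \<otimes>\<^sub>o ?I) o\<^sub>L (V \<beta> \<otimes>\<^sub>o ?I) = (if \<alpha> = \<beta> then id_blinfun else 0)"
      by (rule blinfun_eq_tensorI)
         (simp add: adj_tensor_op cb W cbounded_id tensor_op_apply cbounded_adj_op *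
           adj_op_selfadjoint selfadjoint_id tensor_zero_left)
    then have "adj_op (V \<alpha> \<otimes>\<^sub>o ?I) ((V \<beta> \<otimes>\<^sub>o ?I) y) = (if \<alpha> = \<beta> then y else 0)"
      by (metis blinfun_apply_blinfun_compose blinfun_apply_id_blinfun id_apply zero_blinfun.rep_eq)
    then show ?thesis
      using cinner_adj_op[of "V \<alpha> \<otimes>\<^sub>o ?I" x] adj_op_apply[of "adj_op (V \<alpha> \<otimes>\<^sub>o ?I)"]
      by (metis W(1) cb cbounded_id cbounded_tensor_op cinner_adj_op cinner_zero_right)
  qed
  then show ?thesis
    by (simp add: orthogonal_isometries_def cb cbounded_tensor_op cbounded_id)
qed

section \<open>Creation operators\<close>

lemma creation_cbounded: "creation i \<in> cbounded"
proof -
  have "creation_fun i (c *\<^sub>C f) = c *\<^sub>C creation_fun i f" for c and f :: "'a fock"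
    by transfer (auto split: list.splits)
  then show ?thesis
    by (simp add: cbounded_def creation.rep_eq)
qed

lemma cinner_creation:
  "cinner (creation i f) (creation j g) = (if i = j then cinner f g else 0)"
proof (cases "i = j")
  case True
  have "(\<Sum>\<^sub>\<infinity>\<alpha>. cinner (l2_nth (creation_fun i f) \<alpha>) (l2_nth (creation_fun i g) \<alpha>)) =
      (\<Sum>\<^sub>\<infinity>\<alpha>\<in>range ((#) i). cinner (l2_nth f (tl \<alpha>)) (l2_nth g (tl \<alpha>)))"
    by (rule infsum_cong_neutral) (auto simp: creation_fun.rep_eq split: list.splits)
  also have "\<dots> = (\<Sum>\<^sub>\<infinity>\<alpha>. cinner (l2_nth f \<alpha>) (l2_nth g \<alpha>))"
    by (subst infsum_reindex) (auto simp: o_def)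
  finally show ?thesis
    using True by (simp add: creation.rep_eq cinner_l2_def)
next
  case False
  then have "cinner (l2_nth (creation_fun i f) \<alpha>) (l2_nth (creation_fun j g) \<alpha>) = 0" for \<alpha>
    by (auto simp: creation_fun.rep_eq split: list.splits)
  then show ?thesis
    using False by (simp add: creation.rep_eq cinner_l2_def)
qed

abbreviation fock_word :: "'n list \<Rightarrow> 'n fock \<Rightarrow>\<^sub>L 'n fock" where
  "fock_word \<equiv> word_op id_blinfun creation"

lemma word_op_cbounded:
  "E \<in> cbounded \<Longrightarrow> (\<And>i. X i \<in> cbounded) \<Longrightarrow> word_op E X \<alpha> \<in> cbounded"
  by (induction \<alpha>) (simp_all add: cbounded_compose)

lemma norm_word_op_le:
  assumes "\<And>i. norm (X i) \<le> c"
  shows "norm (word_op id_blinfun X \<alpha>) \<le> c ^ length \<alpha>"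
proof (induction \<alpha>)
  case (Cons i \<alpha>)
  have "norm (X i o\<^sub>L word_op id_blinfun X \<alpha>) \<le> norm (X i) * norm (word_op id_blinfun X \<alpha>)"
    by (rule norm_blinfun_compose)
  also have "\<dots> \<le> c * c ^ length \<alpha>"
    using Cons assms[of i] by (intro mult_mono) (auto intro: order_trans[OF norm_ge_zero])
  finally show ?case
    by simp
qed (simp add: norm_blinfun_id_le)

text \<open>Equal length matters: cancelling first letters ends at two empty words, whereas for a
  proper prefix \<alpha> of \<beta> the range of S_\<beta> lies inside that of S_\<alpha>.\<close>

lemma orthogonal_isometries_fock_word: "orthogonal_isometries (words k) fock_word"
proof -
  have "cinner (fock_word \<alpha> f) (fock_word \<beta> g) = (if \<alpha> = \<beta> then cinner f g else 0)"
    if "length \<alpha> = length \<beta>" for \<alpha> \<beta> :: "'a list" and f g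
    using that by (induction \<alpha> \<beta> rule: list_induct2) (auto simp: cinner_creation)
  then show ?thesis
    by (simp add: orthogonal_isometries_def words_def word_op_cbounded creation_cbounded cbounded_id)
qed

section \<open>Embedding the Fock space into a given l2 space\<close>

lift_definition ket :: "'j \<Rightarrow> 'j ell2" is "\<lambda>j i. if i = j then 1 else 0"
  by (rule finite_nonzero_values_imp_summable_on) simp

lemma cinner_ket: "cinner (ket i) (ket j) = (if i = j then 1 else 0)"
proof -
  have "(\<Sum>\<^sub>\<infinity>l. cinner (l2_nth (ket i) l) (l2_nth (ket j) l)) =
      (\<Sum>\<^sub>\<infinity>l\<in>{i}. if i = j then 1 else 0)"
    by (rule infsum_cong_neutral) (auto simp: ket.rep_eq cinner_complex_def)
  then show ?thesis
    by (simp add: cinner_l2_def)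
qed

lemma creation_ket: "creation i (ket \<beta>) = ket (i # \<beta>)"
  unfolding creation.rep_eq by transfer (auto split: list.splits)

lift_definition ell2_reindex :: "('j \<Rightarrow> 'i) \<Rightarrow> 'j ell2 \<Rightarrow> 'i ell2" is
  "\<lambda>\<iota> f i. if i \<in> range \<iota> then f (inv \<iota> i) else 0"
proof -
  fix \<iota> :: "'j \<Rightarrow> 'i" and f :: "'j \<Rightarrow> complex"
  assume "(\<lambda>j. (norm (f j))\<^sup>2) summable_on UNIV"
  then have "(\<lambda>j. (norm (f j))\<^sup>2) summable_on inv \<iota> ` range \<iota>"
    by (rule summable_on_subset_banach) simp
  then have "(\<lambda>i. (norm (f (inv \<iota> i)))\<^sup>2) summable_on range \<iota>"
    by (subst (asm) summable_on_reindex) (auto simp: o_def inj_on_inv_into)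
  then show "(\<lambda>i. (norm (if i \<in> range \<iota> then f (inv \<iota> i) else 0))\<^sup>2) summable_on UNIV"
    by (rule summable_on_cong_neutral[THEN iffD1, rotated -1]) auto
qed

lemma cinner_ell2_reindex:
  assumes "inj \<iota>"
  shows "cinner (ell2_reindex \<iota> f) (ell2_reindex \<iota> g) = cinner f g"
proof -
  have "(\<Sum>\<^sub>\<infinity>i. cinner (l2_nth (ell2_reindex \<iota> f) i) (l2_nth (ell2_reindex \<iota> g) i)) =
      (\<Sum>\<^sub>\<infinity>i\<in>range \<iota>. cinner (l2_nth f (inv \<iota> i)) (l2_nth g (inv \<iota> i)))"
    by (rule infsum_cong_neutral) (auto simp: ell2_reindex.rep_eq)
  also have "\<dots> = (\<Sum>\<^sub>\<infinity>j. cinner (l2_nth f j) (l2_nth g j))"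
    using assms by (subst infsum_reindex) (auto simp: o_def)
  finally show ?thesis
    by (simp add: cinner_l2_def)
qed

lemma ell2_isometry_exists:
  assumes \<iota>: "inj (\<iota> :: 'j \<Rightarrow> 'i)"
  shows "\<exists>J :: 'j ell2 \<Rightarrow>\<^sub>L 'i ell2. J \<in> cbounded \<and> (\<forall>f g. cinner (J f) (J g) = cinner f g)"
proof -
  let ?J = "ell2_reindex \<iota>"
  have "norm (?J f) = norm f" for f
    by (simp add: norm_eq_sqrt_inner inner_eq_Re_cinner cinner_ell2_reindex[OF \<iota>])
  moreover have "?J (f + g) = ?J f + ?J g" "?J (r *\<^sub>R f) = r *\<^sub>R ?J f" "?J (c *\<^sub>C f) = c *\<^sub>C ?J f"
    for f g r c
    by (transfer; auto)+
  ultimately have "bounded_linear ?J"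
    by (intro bounded_linear_intro[where K = 1]) auto
  with \<open>\<And>f c. ?J (c *\<^sub>C f) = c *\<^sub>C ?J f\<close> show ?thesis
    by (intro exI[of _ "Blinfun ?J"])
       (simp add: bounded_linear_Blinfun_apply cbounded_def cinner_ell2_reindex[OF \<iota>])
qed

text \<open>Words over a finite alphabet are countable, and every infinite type contains a copy of
  the natural numbers. So the hypothesis on subspaces of \<open>'i ell2\<close> reaches the Fock
  space.\<close>

lemma fock_isometry_exists:
  "\<exists>J :: 'n :: finite fock \<Rightarrow>\<^sub>L 'i :: infinite ell2.
     J \<in> cbounded \<and> (\<forall>f g. cinner (J f) (J g) = cinner f g)"
proof -
  obtain e :: "nat \<Rightarrow> 'i" where "inj e"
    using infinite_countable_subset[OF infinite_UNIV[where 'a = 'i]] by auto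
  then have "inj (e \<circ> (to_nat :: 'n list \<Rightarrow> nat))"
    by (intro inj_compose inj_to_nat)
  then show ?thesis
    by (rule ell2_isometry_exists)
qed

section \<open>The coefficient inequality\<close>

lemma proj_UNIV: "proj UNIV = id_blinfun"
proof (rule blinfun_eqI)
  fix x :: 'a
  have "x - proj UNIV x = 0"
    by (rule cinner_eq_0_all) (rule proj_apply(2)[OF hilbert_subspace_UNIV UNIV_I])
  then show "proj UNIV x = id_blinfun x"
    by simp
qed

lemma inner_Re_op: "T \<in> cbounded \<Longrightarrow> inner x (blinfun_apply (Re_op T) x) = inner x (T x)"
  by (simp add: Re_op_def blinfun.scaleR_left blinfun.add_left inner_add_right inner_adj_op
      inner_commute)

lemma op_le_inner: "S \<preceq> T \<Longrightarrow> inner x (blinfun_apply S x) \<le> inner x (T x)"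
proof -
  assume "S \<preceq> T"
  then have "cinner x ((T - S) x) \<in> \<real>\<^sub>\<ge>\<^sub>0"
    unfolding op_le_def pos_op_def by blast
  then show ?thesis
    by (simp add: complex_nonneg_Reals_iff inner_eq_Re_cinner blinfun.diff_left cinner_diff_right)
qed

lemma words_0: "words 0 = {[]}"
  by (auto simp: words_def)

section \<open>Rescaled creation operators as a point of the row ball\<close>

locale shift_model =
  fixes J :: "'n :: finite fock \<Rightarrow>\<^sub>L 'i :: infinite ell2" and r :: real
  assumes J: "J \<in> cbounded" "\<And>f g. cinner (J f) (J g) = cinner f g"
    and r: "0 \<le> r" "r < 1"
begin

text \<open>The operator r S_i carried over by J. It vanishes on the orthogonal complement of the
  range of J, so it acts on all of \<open>'i ell2\<close> and M = UNIV can be used.\<close>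

definition X :: "'n \<Rightarrow> 'i ell2 \<Rightarrow>\<^sub>L 'i ell2" where
  "X i = r *\<^sub>R (J o\<^sub>L creation i o\<^sub>L adj_op J)"

lemma adj_J_J: "adj_op J (J f) = f"
proof -
  have "adj_op J (J f) - f = 0"
    by (rule cinner_eq_0_all) (simp add: cinner_diff_right cinner_adj_op J)
  then show ?thesis
    by simp
qed

lemma norm_J: "norm (J f) = norm f"
  by (simp add: norm_eq_sqrt_inner inner_eq_Re_cinner J)

lemma X_cbounded: "X i \<in> cbounded"
  unfolding X_def by (intro cbounded_scaleR cbounded_compose creation_cbounded cbounded_adj_op J)

text \<open>The operators J S_i are isometries with orthogonal ranges, so Bessel's inequality bounds
  the form of the row product by r^2 < 1. For M = UNIV the orthogonal complement in
  \<open>ops_on\<close> is trivial.\<close>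

lemma X_row_ball: "X \<in> row_ball UNIV"
proof -
  let ?V = "\<lambda>i. J o\<^sub>L creation i"
  let ?Q = "\<Sum>i\<in>UNIV. X i o\<^sub>L adj_op (X i)"
  have V: "?V i \<in> cbounded" for i
    by (intro cbounded_compose creation_cbounded J)
  have orth: "orthogonal_isometries UNIV ?V"
    by (simp add: orthogonal_isometries_def V J cinner_creation)
  have "adj_op (X i) = r *\<^sub>R (J o\<^sub>L adj_op (?V i))" for i
    unfolding X_def by (simp add: adj_op_scaleR adj_op_compose adj_adj_op cbounded_compose
        creation_cbounded cbounded_adj_op J V)
  then have norm_adj_X: "norm (adj_op (X i) u) = r * norm (adj_op (?V i) u)" for i u
    using r by (simp add: blinfun.scaleR_left norm_J)
  have form: "inner u (?Q u) = (\<Sum>i\<in>UNIV. (norm (adj_op (X i) u))\<^sup>2)" for u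
  proof -
    have "inner u (X i (adj_op (X i) u)) = (norm (adj_op (X i) u))\<^sup>2" for i
      using inner_adj_op[OF X_cbounded, of "adj_op (X i) u" i u]
      by (simp add: power2_norm_eq_inner inner_commute)
    then show ?thesis
      by (simp add: blinfun.sum_left inner_sum_right)
  qed
  have "norm ?Q \<le> r\<^sup>2"
  proof (rule norm_positive_le)
    have "selfadjoint (X i o\<^sub>L adj_op (X i))" for i
      using selfadjoint_adj_compose[OF cbounded_adj_op[OF X_cbounded[of i]]]
      by (simp only: adj_adj_op[OF X_cbounded])
    then show "selfadjoint ?Q"
      by (rule selfadjoint_sum)
    fix u
    show "0 \<le> inner u (?Q u)"
      unfolding form by (simp add: sum_nonneg)
    have "inner u (?Q u) = r\<^sup>2 * (\<Sum>i\<in>UNIV. (norm (adj_op (?V i) u))\<^sup>2)"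
      unfolding form norm_adj_X by (simp only: power_mult_distrib sum_distrib_left)
    also have "\<dots> \<le> r\<^sup>2 * (norm u)\<^sup>2"
      by (intro mult_left_mono orthogonal_isometries_bessel orth) auto
    finally show "inner u (?Q u) \<le> r\<^sup>2 * (norm u)\<^sup>2" .
  qed simp
  also have "r\<^sup>2 < 1"
    using r by (simp add: power_less_one_iff abs_square_less_1)
  finally have "norm ?Q < 1" .
  moreover have "X i x = 0" if "\<forall>y. cinner y x = 0" for i x
  proof -
    have "x = 0"
      by (rule cinner_eq_0_all) (rule that[rule_format])
    then show ?thesis
      by simp
  qed
  ultimately show ?thesis
    by (simp add: row_ball_def ops_on_def X_cbounded)
qed

lemma word_op_X_ket:
  "word_op id_blinfun X \<alpha> (J (ket \<beta>)) = r ^ length \<alpha> *\<^sub>R J (ket (\<alpha> @ \<beta>))"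
  by (induction \<alpha>)
     (simp_all add: X_def blinfun.scaleR_left blinfun.scaleR_right adj_J_J creation_ket mult.commute)

lemma homogeneous_part_cbounded:
  "(\<And>\<alpha>. A \<alpha> \<in> cbounded) \<Longrightarrow> homogeneous_part UNIV A X k \<in> cbounded"
  unfolding homogeneous_part_def proj_UNIV
  by (intro cbounded_sum cbounded_tensor_op word_op_cbounded cbounded_id X_cbounded)

end

text \<open>The test vector u lives on words of length 0 and k, and X_\<alpha> prepends \<alpha>.
  Hence in <u, F(X) u> only the degrees 0 and k survive, and degree k pairs x with the g_\<alpha>
  alone.\<close>

lemma coefficient_form_bound:
  fixes A :: "'n :: finite list \<Rightarrow> 'h :: chilbert_space \<Rightarrow>\<^sub>L 'h"
  assumes coeffs: "\<And>\<alpha>. A \<alpha> \<in> cbounded"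
    and holomorphic: "free_holomorphic TYPE('i :: infinite) A"
    and Re_F: "\<And>(M :: 'i ell2 set) X. hilbert_subspace M \<Longrightarrow> X \<in> row_ball M \<Longrightarrow>
      Re_op (free_eval M A X) \<preceq> proj M \<otimes>\<^sub>o id_blinfun"
    and k: "1 \<le> k"
  shows "(\<Sum>\<alpha>\<in>words k. inner (g \<alpha>) (A \<alpha> x)) \<le>
    inner x ((id_blinfun - A []) x) + (\<Sum>\<alpha>\<in>words k. inner (g \<alpha>) ((id_blinfun - A []) (g \<alpha>)))"
proof -
  obtain J :: "'n fock \<Rightarrow>\<^sub>L 'i ell2"
    where J: "J \<in> cbounded" "\<And>f g. cinner (J f) (J g) = cinner f g"
    using fock_isometry_exists by blast
  define B where "B = insert [] (words k :: 'n list set)"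
  have B: "finite B" "[] \<notin> (words k :: 'n list set)" "finite (words k :: 'n list set)"
    using k by (auto simp: B_def words_def finite_words[unfolded words_def])
  \<comment> \<open>The value 0 at all other words makes \<open>inner_u\<close> below valid for
    every word \<gamma>, including those outside B.\<close>
  define h where "h \<beta> = (if \<beta> = [] then x else if length \<beta> = k then g \<beta> else 0)" for \<beta>
  define u where "u = (\<Sum>\<beta>\<in>B. J (ket \<beta>) \<otimes> h \<beta>)"
  have inner_u: "inner u (J (ket \<gamma>) \<otimes> y) = inner (h \<gamma>) y" for \<gamma> y
  proof -
    have "inner u (J (ket \<gamma>) \<otimes> y) = (\<Sum>\<beta>\<in>B. if \<beta> = \<gamma> then inner (h \<beta>) y else 0)"
      unfolding u_def inner_sum_left
      by (intro sum.cong refl) (simp add: inner_eq_Re_cinner cinner_tensor J cinner_ket)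
    also have "\<dots> = (if \<gamma> \<in> B then inner (h \<gamma>) y else 0)"
      by (simp add: B)
    also have "\<dots> = inner (h \<gamma>) y"
      by (auto simp: B_def h_def words_def)
    finally show ?thesis .
  qed
  have norm_u: "inner u u = (\<Sum>\<beta>\<in>B. inner (h \<beta>) (h \<beta>))"
    by (subst (2) u_def) (simp only: inner_sum_right inner_u)
  have "r ^ k * (\<Sum>\<alpha>\<in>words k. inner (g \<alpha>) (A \<alpha> x)) \<le>
      inner x ((id_blinfun - A []) x) + (\<Sum>\<alpha>\<in>words k. inner (g \<alpha>) ((id_blinfun - A []) (g \<alpha>)))"
    (is "_ * ?a \<le> ?b") if r: "0 < r" "r < 1" for r
  proof -
    interpret shift_model J r
      using J r by unfold_locales auto
    let ?P = "homogeneous_part UNIV A X"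
    have sm: "summable ?P"
      using holomorphic X_row_ball hilbert_subspace_UNIV unfolding free_holomorphic_def by blast
    have part: "inner u (?P j u) =
        r ^ j * (\<Sum>\<alpha>\<in>words j. \<Sum>\<beta>\<in>B. inner (h (\<alpha> @ \<beta>)) (A \<alpha> (h \<beta>)))" for j
    proof -
      have "?P j u = (\<Sum>\<alpha>\<in>words j. \<Sum>\<beta>\<in>B. r ^ j *\<^sub>R (J (ket (\<alpha> @ \<beta>)) \<otimes> A \<alpha> (h \<beta>)))"
        unfolding homogeneous_part_def proj_UNIV blinfun.sum_left
        by (intro sum.cong refl, subst u_def)
           (simp add: blinfun.sum_right tensor_op_apply word_op_cbounded cbounded_id X_cbounded
             coeffs word_op_X_ket tensor_scaleR_left words_def)
      then show ?thesis
        by (simp add: inner_sum_right inner_u sum_distrib_left)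
    qed
    have part0: "inner u (?P 0 u) = (\<Sum>\<beta>\<in>B. inner (h \<beta>) (A [] (h \<beta>)))"
      unfolding part words_0 by simp
    have partk: "inner u (?P k u) = r ^ k * ?a"
    proof -
      \<comment> \<open>For \<beta> of length k the word \<alpha> @ \<beta> has length 2 k, where h
        is 0; only the empty \<beta> remains.\<close>
      have "(\<Sum>\<beta>\<in>B. inner (h (\<alpha> @ \<beta>)) (A \<alpha> (h \<beta>))) = inner (g \<alpha>) (A \<alpha> x)"
        if "\<alpha> \<in> words k" for \<alpha>
        using that k B by (simp add: B_def, subst sum.neutral) (auto simp: h_def words_def)
      then show ?thesis
        unfolding part by simp
    qed
    \<comment> \<open>The possible lengths j and j + k of \<alpha> @ \<beta> both differ from 0 and
      k.\<close>
    have part_other: "inner u (?P j u) = 0" if "j \<notin> {0, k}" for j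
      unfolding part using that k
      by (auto simp: B_def h_def words_def intro!: sum.neutral)
    have "bounded_linear (\<lambda>T. inner u (blinfun_apply T u))"
      by (rule bounded_linear_compose[OF bounded_linear_inner_right blinfun.bounded_linear_left])
    from bounded_linear.suminf[OF this sm]
    have "inner u (free_eval UNIV A X u) = (\<Sum>j. inner u (?P j u))"
      by (simp add: free_eval_def)
    also have "\<dots> = (\<Sum>j\<in>{0, k}. inner u (?P j u))"
      by (rule suminf_finite) (use part_other in auto)
    also have "\<dots> = (\<Sum>\<beta>\<in>B. inner (h \<beta>) (A [] (h \<beta>))) + r ^ k * ?a"
      using k by (simp add: part0 partk)
    finally have F: "inner u (free_eval UNIV A X u) = \<dots>" .
    have "free_eval UNIV A X \<in> cbounded"
      unfolding free_eval_def by (intro cbounded_suminf sm homogeneous_part_cbounded coeffs)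
    \<comment> \<open>Re F can be replaced by F, since \<open>inner\<close> already takes the real
      part.\<close>
    then have "inner u (free_eval UNIV A X u) \<le> inner u u"
      using op_le_inner[OF Re_F[OF hilbert_subspace_UNIV X_row_ball], of u]
      by (simp add: inner_Re_op proj_UNIV tensor_op_id)
    then have "r ^ k * ?a \<le> (\<Sum>\<beta>\<in>B. inner (h \<beta>) (h \<beta>)) - (\<Sum>\<beta>\<in>B. inner (h \<beta>) (A [] (h \<beta>)))"
      unfolding F norm_u by simp
    also have "\<dots> = (\<Sum>\<beta>\<in>B. inner (h \<beta>) ((id_blinfun - A []) (h \<beta>)))"
      by (simp add: sum_subtractf blinfun.diff_left inner_diff_right)
    also have "\<dots> = inner x ((id_blinfun - A []) x) +
        (\<Sum>\<beta>\<in>words k. inner (h \<beta>) ((id_blinfun - A []) (h \<beta>)))"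
      unfolding B_def using B by (simp add: h_def)
    also have "\<dots> = ?b"
      using k by (intro arg_cong2[of _ _ _ _ "(+)"] sum.cong refl) (auto simp: h_def words_def)
    finally show ?thesis .
  qed
  \<comment> \<open>Only the factor r^k still depends on r, so r can tend to 1 from below.\<close>
  then have "\<forall>\<^sub>F r in at_left 1. r ^ k * (\<Sum>\<alpha>\<in>words k. inner (g \<alpha>) (A \<alpha> x)) \<le>
      inner x ((id_blinfun - A []) x) + (\<Sum>\<alpha>\<in>words k. inner (g \<alpha>) ((id_blinfun - A []) (g \<alpha>)))"
    by (intro eventually_at_leftI[of 0 1]) auto
  moreover have "((\<lambda>r. r ^ k * (\<Sum>\<alpha>\<in>words k. inner (g \<alpha>) (A \<alpha> x))) \<longlongrightarrow>
      1 ^ k * (\<Sum>\<alpha>\<in>words k. inner (g \<alpha>) (A \<alpha> x))) (at_left (1 :: real))"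
    by (intro tendsto_intros)
  ultimately show ?thesis
    using tendsto_upperbound[of _ _ "at_left (1 :: real)"] by fastforce
qed

section \<open>Series of operators and inverses\<close>

lemma geometric_tail_sums: "0 \<le> r \<Longrightarrow> r < 1 \<Longrightarrow> (\<lambda>k. r ^ Suc k) sums (r / (1 - r :: real))"
  using sums_mult[OF geometric_sums[of r], of r] by simp

lemma summable_geometric_bound:
  fixes T :: "nat \<Rightarrow> 'a :: banach"
  assumes "0 \<le> r" "r < 1" and bound: "\<And>k. norm (T k) \<le> r ^ Suc k * c"
  shows "summable T"
  by (rule summable_comparison_test'[OF summable_mult2[OF sums_summable[OF geometric_tail_sums]]])
     (rule assms)+

text \<open>T k stands for the term of degree k + 1: degree 0 is always split off, so the geometric
  series starts with r and sums to r / (1 - r).\<close>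

lemma inner_suminf_le:
  fixes T :: "nat \<Rightarrow> 'a :: real_normed_vector \<Rightarrow>\<^sub>L 'b :: real_inner"
  assumes r: "0 \<le> r" "r < 1" and T: "summable T"
    and bound: "\<And>k. inner x (T k y) \<le> r ^ Suc k * c"
  shows "inner x (suminf T y) \<le> r / (1 - r) * c"
proof (rule sums_le[OF bound])
  have "bounded_linear (\<lambda>T. inner x (blinfun_apply T y))"
    by (rule bounded_linear_compose[OF bounded_linear_inner_right blinfun.bounded_linear_left])
  from bounded_linear.sums[OF this summable_sums[OF T]]
  show "(\<lambda>k. inner x (T k y)) sums inner x (suminf T y)" .
  show "(\<lambda>k. r ^ Suc k * c) sums (r / (1 - r) * c)"
    by (intro sums_mult2 geometric_tail_sums r)
qed

text \<open>The contraction R \<mapsto> I + T R has a fixed point, a right inverse of I - T. It is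
  also a left inverse because I - T is injective.\<close>

lemma neumann_inverse_exists:
  fixes T :: "'a :: banach \<Rightarrow>\<^sub>L 'a"
  assumes T: "norm T < 1"
  shows "\<exists>R. R o\<^sub>L (id_blinfun - T) = id_blinfun \<and> (id_blinfun - T) o\<^sub>L R = id_blinfun"
proof -
  have "\<exists>!R. id_blinfun + (T o\<^sub>L R) = R"
  proof (rule banach_fix_type[OF norm_ge_zero T], intro allI)
    fix R R' :: "'a \<Rightarrow>\<^sub>L 'a"
    have "(id_blinfun + (T o\<^sub>L R)) - (id_blinfun + (T o\<^sub>L R')) = T o\<^sub>L (R - R')"
      by (intro blinfun_eqI) (simp add: blinfun.diff_left blinfun.diff_right blinfun.add_left)
    then show "dist (id_blinfun + (T o\<^sub>L R)) (id_blinfun + (T o\<^sub>L R')) \<le> norm T * dist R R'"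
      by (simp only: dist_norm norm_blinfun_compose)
  qed
  then obtain R where R: "id_blinfun + (T o\<^sub>L R) = R"
    by blast
  have right: "R x = x + T (R x)" for x
    by (subst R[symmetric]) (simp add: blinfun.add_left)
  have inj: "x = 0" if "x = T x" for x
  proof (rule ccontr)
    assume "x \<noteq> 0"
    then have "norm T * norm x < 1 * norm x"
      using T by (intro mult_strict_right_mono) auto
    moreover have "norm x \<le> norm T * norm x"
      using norm_blinfun[of T x] that by simp
    ultimately show False
      by simp
  qed
  have "R (x - T x) - x = 0" for x
    by (rule inj, subst right) (simp add: blinfun.diff_right)
  then show ?thesis
    using right
    by (intro exI[of _ R] conjI blinfun_eqI) (simp_all add: blinfun.diff_left algebra_simps)
qed

lemma inv_op_eqI:
  assumes "R o\<^sub>L T = id_blinfun" "T o\<^sub>L R = id_blinfun"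
  shows "inv_op T = R"
  unfolding inv_op_def
proof (rule the_equality)
  fix R' assume R': "R' o\<^sub>L T = id_blinfun \<and> T o\<^sub>L R' = id_blinfun"
  show "R' = R"
  proof (rule blinfun_eqI)
    fix x
    have "R' x = R' (T (R x))"
      using arg_cong[OF assms(2), of "\<lambda>S. blinfun_apply S x"] by simp
    also have "\<dots> = R x"
      using arg_cong[OF R'[THEN conjunct1], of "\<lambda>S. blinfun_apply S (R x)"] by simp
    finally show "R' x = R x" .
  qed
qed (use assms in simp)

section \<open>Bohr type inequalities for the coefficients\<close>

text \<open>From here on F enters only through its bounded coefficients, the positivity of A_0 and
  \<open>form_bound\<close>.\<close>

locale bohr_coefficients =
  fixes A :: "'n :: finite list \<Rightarrow> 'h :: chilbert_space \<Rightarrow>\<^sub>L 'h" and D :: "'h \<Rightarrow>\<^sub>L 'h"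
  assumes coeffs: "A \<alpha> \<in> cbounded"
    and A0_pos: "pos_op (A [])"
    and D_eq: "D = id_blinfun - A []"
    and form_bound: "1 \<le> k \<Longrightarrow> (\<Sum>\<alpha>\<in>words k. inner (g \<alpha>) (A \<alpha> x)) \<le>
      inner x (D x) + (\<Sum>\<alpha>\<in>words k. inner (g \<alpha>) (D (g \<alpha>)))"
begin

lemma A0: "selfadjoint (A [])" "0 \<le> inner x (A [] x)"
  using A0_pos coeffs pos_op_iff by blast+

lemma D_selfadjoint: "selfadjoint D"
  unfolding D_eq by (intro selfadjoint_diff selfadjoint_id A0)

lemma D_cbounded: "D \<in> cbounded"
  by (rule selfadjoint_cbounded[OF D_selfadjoint])

lemma A0_form: "inner x (A [] x) = (norm x)\<^sup>2 - inner x (D x)"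
  by (simp add: D_eq blinfun.diff_left inner_diff_right power2_norm_eq_inner)

lemma D_nonneg: "0 \<le> inner x (D x)"
  using form_bound[of 1 "\<lambda>_. 0" x] by simp

lemma D_le: "inner x (D x) \<le> (norm x)\<^sup>2"
  using A0_form[of x] A0(2)[of x] by simp

text \<open>Scaling the vectors g by t changes the left side linearly and the last term
  quadratically; the estimates in a single degree choose t to balance the two.\<close>

lemma scaled_form_bound:
  assumes "1 \<le> k"
  shows "t * (\<Sum>\<alpha>\<in>words k. inner (g \<alpha>) (A \<alpha> x)) \<le>
    inner x (D x) + t\<^sup>2 * (\<Sum>\<alpha>\<in>words k. inner (g \<alpha>) (D (g \<alpha>)))"
  using form_bound[OF assms, of "\<lambda>\<alpha>. t *\<^sub>R g \<alpha>" x]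
  by (simp add: blinfun.scaleR_right sum_distrib_left power2_eq_square mult.assoc)

section \<open>Estimates in a single degree: (ii) and (iii)\<close>

lemma gram_form: "inner x (gram A k x) = (\<Sum>\<alpha>\<in>words k. (norm (A \<alpha> x))\<^sup>2)"
  by (simp add: gram_def blinfun.sum_left inner_sum_right inner_adj_op coeffs power2_norm_eq_inner)

lemma gram_selfadjoint: "selfadjoint (gram A k)"
  unfolding gram_def by (intro selfadjoint_sum selfadjoint_adj_compose coeffs)

lemma gram_nonneg: "0 \<le> inner x (gram A k x)"
  unfolding gram_form by (simp add: sum_nonneg)

lemma gram_form_le:
  assumes "1 \<le> k"
  shows "inner x (gram A k x) \<le> 4 * inner x (D x)"
proof -
  \<comment> \<open>With s the form of \<open>gram A k\<close>, the choice t = 1/2 and D \<le> I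
    give s/2 \<le> <x, D x> + s/4.\<close>
  have "(1 / 2) * inner x (gram A k x) \<le>
      inner x (D x) + (1 / 2)\<^sup>2 * (\<Sum>\<alpha>\<in>words k. inner (A \<alpha> x) (D (A \<alpha> x)))"
    using scaled_form_bound[OF assms, of "1 / 2" "\<lambda>\<alpha>. A \<alpha> x" x]
    by (simp add: gram_form power2_norm_eq_inner)
  also have "(\<Sum>\<alpha>\<in>words k. inner (A \<alpha> x) (D (A \<alpha> x))) \<le> inner x (gram A k x)"
    unfolding gram_form by (intro sum_mono D_le)
  finally show ?thesis
    by (simp add: power2_eq_square)
qed

lemma gram_form_le_norm:
  assumes k: "1 \<le> k"
  shows "inner x (gram A k x) \<le> (2 * norm D)\<^sup>2 * (norm x)\<^sup>2"
proof (cases "D = 0")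
  case True
  then show ?thesis
    using gram_form_le[OF k, of x] by simp
next
  case False
  then have d: "norm D > 0"
    by simp
  \<comment> \<open>With d the norm of D and n the squared norm of x, bounding both D terms by d
    gives s / (2 d) \<le> d n + s / (4 d), that is s \<le> 4 d^2 n.\<close>
  let ?s = "inner x (gram A k x)" and ?t = "1 / (2 * norm D)"
  have "?t * ?s \<le> inner x (D x) + ?t\<^sup>2 * (\<Sum>\<alpha>\<in>words k. inner (A \<alpha> x) (D (A \<alpha> x)))"
    using scaled_form_bound[OF k, of ?t "\<lambda>\<alpha>. A \<alpha> x" x]
    by (simp add: gram_form power2_norm_eq_inner)
  also have "\<dots> \<le> norm D * (norm x)\<^sup>2 + ?t\<^sup>2 * (norm D * ?s)"
    unfolding gram_form sum_distrib_left[of "norm D"]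
    by (intro add_mono mult_left_mono sum_mono inner_blinfun_le) simp
  finally show ?thesis
    using d by (simp add: field_simps power2_eq_square)
qed

lemma sqrt_norm_gram_le:
  assumes "1 \<le> k"
  shows "sqrt (norm (gram A k)) \<le> 2 * norm D"
proof (rule real_le_lsqrt)
  show "norm (gram A k) \<le> (2 * norm D)\<^sup>2"
    by (rule norm_positive_le[OF gram_selfadjoint gram_nonneg gram_form_le_norm[OF assms]]) simp
qed simp

text \<open>Positivity of A_0 enters here: \<open>gram A 0\<close> is the square of A_0, and its
  positive root is A_0 itself.\<close>

lemma sqrt_op_gram_0: "sqrt_op (gram A 0) = A []"
  by (rule sqrt_op_eqI[OF A0]) (simp add: gram_def words_0 adj_op_selfadjoint A0)

lemma sqrt_norm_gram_0_le: "sqrt (norm (gram A 0)) \<le> norm (A [])"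
  using norm_blinfun_compose[of "A []" "A []"]
  by (intro real_le_lsqrt) (simp_all add: gram_def words_0 adj_op_selfadjoint A0 power2_eq_square)

section \<open>The series of square roots: (iv)\<close>

lemma summable_sqrt_gram:
  assumes r: "0 \<le> r" "r < 1"
  shows "summable (\<lambda>k. r ^ Suc k *\<^sub>R sqrt_op (gram A (Suc k)))"
proof (rule summable_geometric_bound[OF r])
  fix k
  have "norm (sqrt_op (gram A (Suc k))) \<le> 2 * norm D"
    using norm_sqrt_op_le[OF gram_selfadjoint gram_nonneg] sqrt_norm_gram_le[of "Suc k"]
    by (rule order_trans) simp
  then show "norm (r ^ Suc k *\<^sub>R sqrt_op (gram A (Suc k))) \<le> r ^ Suc k * (2 * norm D)"
    using r by (simp add: mult_left_mono)
qed

text \<open>Degree 0 contributes I - D exactly. In every other degree \<open>sqrt_op_form_le\<close>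
  is combined with G \<le> 4 D, with the same s throughout so that the series stays
  geometric.\<close>

lemma sum_sqrt_gram_form_le:
  assumes r: "0 \<le> r" "r < 1" and s: "0 < s"
  shows "inner x ((\<Sum>k. r ^ k *\<^sub>R sqrt_op (gram A k)) x) \<le>
    (norm x)\<^sup>2 - inner x (D x) + r / (1 - r) * (2 * inner x (D x) / s + s * (norm x)\<^sup>2 / 2)"
proof -
  let ?T = "\<lambda>k. r ^ k *\<^sub>R sqrt_op (gram A k)"
  have "suminf ?T = A [] + (\<Sum>k. ?T (Suc k))"
    using suminf_split_head[of ?T] summable_Suc_iff[of ?T] summable_sqrt_gram[OF r]
    by (simp add: sqrt_op_gram_0)
  then have "inner x (suminf ?T x) = inner x (A [] x) + inner x ((\<Sum>k. ?T (Suc k)) x)"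
    by (simp only: blinfun.add_left inner_add_right)
  also have "\<dots> \<le> inner x (A [] x) +
      r / (1 - r) * (2 * inner x (D x) / s + s * (norm x)\<^sup>2 / 2)"
  proof (intro add_left_mono inner_suminf_le[OF r summable_sqrt_gram[OF r]])
    fix k
    have "inner x (sqrt_op (gram A (Suc k)) x) \<le>
        (inner x (gram A (Suc k) x) / s + s * (norm x)\<^sup>2) / 2"
      by (rule sqrt_op_form_le[OF gram_selfadjoint gram_nonneg s])
    also have "\<dots> \<le> (4 * inner x (D x) / s + s * (norm x)\<^sup>2) / 2"
      using s by (intro divide_right_mono add_right_mono gram_form_le) auto
    finally show "inner x (?T (Suc k) x) \<le>
        r ^ Suc k * (2 * inner x (D x) / s + s * (norm x)\<^sup>2 / 2)"
      using r by (simp add: blinfun.scaleR_left mult_left_mono add_divide_distrib)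
  qed
  finally show ?thesis
    by (simp add: A0_form)
qed

lemma sum_sqrt_gram_le:
  assumes r: "0 \<le> r" "r < 1"
  shows "(\<Sum>k. r ^ k *\<^sub>R sqrt_op (gram A k)) \<preceq>
    (if r \<le> 1 / 2 then 1 + r\<^sup>2 / (1 - r)\<^sup>2 else 2 * r / (1 - r)) *\<^sub>R id_blinfun"
proof (rule op_leI)
  have "summable (\<lambda>k. r ^ k *\<^sub>R sqrt_op (gram A k))"
    using summable_sqrt_gram[OF r] summable_Suc_iff by blast
  then show "selfadjoint (\<Sum>k. r ^ k *\<^sub>R sqrt_op (gram A k))"
    by (intro selfadjoint_suminf selfadjoint_scaleR selfadjoint_sqrt_op gram_selfadjoint gram_nonneg)
  fix x
  define q where "q = r / (1 - r)"
  let ?F = "inner x ((\<Sum>k. r ^ k *\<^sub>R sqrt_op (gram A k)) x)"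
  let ?n = "(norm x)\<^sup>2" and ?d = "inner x (D x)"
  have F: "?F \<le> ?n - ?d + q * (2 * ?d / s + s * ?n / 2)" if "0 < s" for s
    using sum_sqrt_gram_form_le[OF r that] by (simp add: q_def)
  have "?F \<le> (if r \<le> 1 / 2 then 1 + r\<^sup>2 / (1 - r)\<^sup>2 else 2 * r / (1 - r)) * ?n"
  proof (cases "r \<le> 1 / 2")
    case True
    have "?F \<le> (1 + q\<^sup>2) * ?n"
    \<comment> \<open>The case q = 0 is separate because s = 2 q must be positive.\<close>
    proof (cases "q = 0")
      case True
      then show ?thesis
        using F[of 1] D_nonneg[of x] by simp
    next
      case False
      then have "0 < q"
        using r by (simp add: q_def)
      \<comment> \<open>The choice s = 2 q makes the D term of the series equal to
        \<open>?d\<close>, which cancels the deficit of degree 0.\<close>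
      moreover from this have "q * (2 * ?d / (2 * q) + 2 * q * ?n / 2) = ?d + q\<^sup>2 * ?n"
        by (simp add: field_simps power2_eq_square)
      ultimately show ?thesis
        using F[of "2 * q"] by (simp add: algebra_simps power2_eq_square[of q])
    qed
    then show ?thesis
      using True by (simp add: q_def power_divide)
  next
    case False
    then have "1 \<le> q"
      using r by (simp add: q_def)
    \<comment> \<open>For s = 2 the bound is \<open>(1 + q) * ?n + (q - 1) * ?d\<close>; as q \<ge>
      1, D \<le> I may be used on the last term.\<close>
    then have "(q - 1) * ?d \<le> (q - 1) * ?n"
      by (intro mult_left_mono D_le) simp
    then have "?F \<le> 2 * q * ?n"
      using F[of 2] by (simp add: algebra_simps)
    then show ?thesis
      using False by (simp add: q_def)
  qed
  then show "?F \<le> inner x (((if r \<le> 1 / 2 then 1 + r\<^sup>2 / (1 - r)\<^sup>2 else 2 * r / (1 - r)) *\<^sub>R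
      id_blinfun) x)"
    by (simp add: blinfun.scaleR_left power2_norm_eq_inner)
qed (intro selfadjoint_scaleR selfadjoint_id)

section \<open>The series weighted by the inverse of D: (v)\<close>

definition inv_gram :: "nat \<Rightarrow> 'h \<Rightarrow>\<^sub>L 'h" where
  "inv_gram k = (\<Sum>\<alpha>\<in>words k. adj_op (A \<alpha>) o\<^sub>L inv_op D o\<^sub>L A \<alpha>)"

context
  assumes A0_norm: "norm (A []) < 1"
begin

lemma inv_D: "inv_op D (D x) = x" "D (inv_op D x) = x"
proof -
  obtain R where "R o\<^sub>L D = id_blinfun" "D o\<^sub>L R = id_blinfun"
    using neumann_inverse_exists[OF A0_norm] unfolding D_eq by blast
  moreover from this have "inv_op D = R"
    by (rule inv_op_eqI)
  ultimately have *: "inv_op D o\<^sub>L D = id_blinfun" "D o\<^sub>L inv_op D = id_blinfun"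
    by simp_all
  show "inv_op D (D x) = x" "D (inv_op D x) = x"
    using *[THEN arg_cong, of "\<lambda>S. blinfun_apply S x"] by simp_all
qed

lemma inv_D_selfadjoint: "selfadjoint (inv_op D)"
  unfolding selfadjoint_def by (metis D_selfadjoint inv_D(2) selfadjoint_def)

lemma inv_D_nonneg: "0 \<le> inner x (inv_op D x)"
  using D_nonneg[of "inv_op D x"] by (simp add: inv_D inner_commute)

lemma inv_gram_selfadjoint: "selfadjoint (inv_gram k)"
  unfolding inv_gram_def by (intro selfadjoint_sum selfadjoint_conjugate coeffs inv_D_selfadjoint)

lemma inv_gram_form: "inner x (inv_gram k x) = (\<Sum>\<alpha>\<in>words k. inner (A \<alpha> x) (inv_op D (A \<alpha> x)))"
  by (simp add: inv_gram_def blinfun.sum_left inner_sum_right inner_adj_op coeffs)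

lemma inv_gram_nonneg: "0 \<le> inner x (inv_gram k x)"
  unfolding inv_gram_form by (intro sum_nonneg inv_D_nonneg)

text \<open>For g_\<alpha> = D^-1 A_\<alpha> x both sums in \<open>scaled_form_bound\<close> equal
  the form s of \<open>inv_gram k\<close>; t = 1/2 gives s/2 \<le> <x, D x> + s/4.\<close>

lemma inv_gram_form_le:
  assumes "1 \<le> k"
  shows "inner x (inv_gram k x) \<le> 4 * inner x (D x)"
  using scaled_form_bound[OF assms, of "1 / 2" "\<lambda>\<alpha>. inv_op D (A \<alpha> x)" x]
  by (simp add: inv_gram_form inv_D inner_commute power2_eq_square)

lemma norm_inv_gram_le:
  assumes "1 \<le> k"
  shows "norm (inv_gram k) \<le> 4"
proof (rule norm_positive_le[OF inv_gram_selfadjoint inv_gram_nonneg])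
  show "inner x (inv_gram k x) \<le> 4 * (norm x)\<^sup>2" for x
    using inv_gram_form_le[OF assms, of x] D_le[of x] by simp
qed simp

lemma summable_inv_gram:
  assumes r: "0 \<le> r" "r < 1"
  shows "summable (\<lambda>k. r ^ Suc k *\<^sub>R inv_gram (Suc k))"
  using r norm_inv_gram_le
  by (intro summable_geometric_bound[OF r, of _ 4]) (simp add: mult_left_mono)

lemma sum_inv_gram_le:
  assumes r: "0 \<le> r" "r < 1"
  shows "A [] + (\<Sum>k. r ^ Suc k *\<^sub>R inv_gram (Suc k)) \<preceq>
    (if r \<le> 1 / 5 then 1 else 4 * r / (1 - r)) *\<^sub>R id_blinfun"
proof (rule op_leI)
  show "selfadjoint (A [] + (\<Sum>k. r ^ Suc k *\<^sub>R inv_gram (Suc k)))"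
    by (intro selfadjoint_add A0 selfadjoint_suminf summable_inv_gram r selfadjoint_scaleR
        inv_gram_selfadjoint)
  fix x
  define q where "q = r / (1 - r)"
  let ?n = "(norm x)\<^sup>2" and ?d = "inner x (D x)"
  let ?F = "inner x ((A [] + (\<Sum>k. r ^ Suc k *\<^sub>R inv_gram (Suc k))) x)"
  have "inner x ((\<Sum>k. r ^ Suc k *\<^sub>R inv_gram (Suc k)) x) \<le> q * (4 * ?d)"
    unfolding q_def
  proof (rule inner_suminf_le[OF r summable_inv_gram[OF r]])
    fix k
    show "inner x ((r ^ Suc k *\<^sub>R inv_gram (Suc k)) x) \<le> r ^ Suc k * (4 * ?d)"
      unfolding blinfun.scaleR_left inner_scaleR_right
      using r by (intro mult_left_mono inv_gram_form_le) auto
  qed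
  then have F: "?F \<le> ?n + (4 * q - 1) * ?d"
    by (simp add: blinfun.add_left inner_add_right A0_form algebra_simps)
  have "?F \<le> (if r \<le> 1 / 5 then 1 else 4 * r / (1 - r)) * ?n"
  \<comment> \<open>The sign of 4 q - 1 changes at r = 1/5: below, D \<ge> 0 discards the last term
    of F; above, D \<le> I bounds it.\<close>
  proof (cases "r \<le> 1 / 5")
    case True
    then have "4 * q - 1 \<le> 0"
      using r by (simp add: q_def field_simps)
    then have "(4 * q - 1) * ?d \<le> 0"
      using D_nonneg by (rule mult_nonpos_nonneg)
    then show ?thesis
      using F True by simp
  next
    case False
    then have "0 \<le> 4 * q - 1"
      using r by (simp add: q_def field_simps)
    then have "(4 * q - 1) * ?d \<le> (4 * q - 1) * ?n"
      by (intro mult_left_mono D_le)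
    then have "?F \<le> 4 * q * ?n"
      using F by (simp add: algebra_simps)
    then show ?thesis
      using False by (simp add: q_def)
  qed
  then show "?F \<le> inner x (((if r \<le> 1 / 5 then 1 else 4 * r / (1 - r)) *\<^sub>R id_blinfun) x)"
    by (simp add: blinfun.scaleR_left power2_norm_eq_inner)
qed (intro selfadjoint_scaleR selfadjoint_id)

end

section \<open>The series of norms: (vi)\<close>

lemma sum_sqrt_norm_gram_le:
  assumes r: "0 \<le> r" "r \<le> 1 / 3"
  shows "summable (\<lambda>k. r ^ k * sqrt (norm (gram A k)))"
    and "(\<Sum>k. r ^ k * sqrt (norm (gram A k))) \<le> norm (A []) + norm D"
proof -
  let ?c = "\<lambda>k. r ^ k * sqrt (norm (gram A k))"
  have r': "r < 1"
    using r by simp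
  have le: "?c (Suc k) \<le> r ^ Suc k * (2 * norm D)" for k
    using r by (intro mult_left_mono sqrt_norm_gram_le) auto
  have "summable (\<lambda>k. ?c (Suc k))"
    using le r by (intro summable_geometric_bound[OF r(1) r', of _ "2 * norm D"]) simp
  then show sm: "summable ?c"
    using summable_Suc_iff by blast
  have "(\<Sum>k. ?c (Suc k)) \<le> r / (1 - r) * (2 * norm D)"
    by (rule sums_le[OF le summable_sums[OF \<open>summable (\<lambda>k. ?c (Suc k))\<close>]
          sums_mult2[OF geometric_tail_sums[OF r(1) r']]])
  \<comment> \<open>The condition r \<le> 1/3 means r / (1 - r) \<le> 1/2, which absorbs the factor
    2 from (iii).\<close>
  also have "\<dots> \<le> (1 / 2) * (2 * norm D)"
    using r by (intro mult_right_mono) (auto simp: field_simps)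
  finally have "(\<Sum>k. ?c (Suc k)) \<le> norm D"
    by simp
  then show "suminf ?c \<le> norm (A []) + norm D"
    using suminf_split_head[OF sm] sqrt_norm_gram_0_le by simp
qed

section \<open>Evaluation at the operators S_i \<otimes> Y_i: (i)\<close>

lemma fock_part_form_le:
  fixes Y :: "'n \<Rightarrow> 'k :: chilbert_space \<Rightarrow>\<^sub>L 'k"
  assumes Y: "\<And>i. Y i \<in> cbounded" "\<And>i. norm (Y i) \<le> 1 / 3" and k: "1 \<le> k"
  shows "inner g (fock_part A Y k f) \<le>
    (1 / 3) ^ k * (inner f ((id_blinfun \<otimes>\<^sub>o D) f) + inner g ((id_blinfun \<otimes>\<^sub>o D) g))"
proof -
  let ?I = "id_blinfun :: 'h \<Rightarrow>\<^sub>L 'h"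
  let ?L = "id_blinfun :: ('n fock, 'k) htensor \<Rightarrow>\<^sub>L ('n fock, 'k) htensor"
  let ?S = "fock_word :: 'n list \<Rightarrow> _"
  let ?Y = "word_op id_blinfun Y"
  let ?T = "\<lambda>\<alpha>. ?S \<alpha> \<otimes>\<^sub>o ?Y \<alpha>"
  let ?W = "\<lambda>\<alpha>. (?S \<alpha> \<otimes>\<^sub>o (id_blinfun :: 'k \<Rightarrow>\<^sub>L 'k)) \<otimes>\<^sub>o ?I"
  let ?G = "\<lambda>\<alpha>. adj_op (?T \<alpha> \<otimes>\<^sub>o ?I) g"
  \<comment> \<open>The root of D writes the form of I \<otimes> D as a squared norm, to which
    operator norm bounds and Bessel's inequality apply.\<close>
  define R where "R = sqrt_op D"
  have R: "selfadjoint R" "\<And>x. R (R x) = D x"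
    unfolding R_def using selfadjoint_sqrt_op sqrt_op_square D_selfadjoint D_nonneg by blast+
  note cb = cbounded_id coeffs D_cbounded selfadjoint_cbounded[OF R(1)]
  have S_cb: "?S \<alpha> \<in> cbounded" and Y_cb: "?Y \<alpha> \<in> cbounded" for \<alpha>
    by (intro word_op_cbounded cbounded_id creation_cbounded Y)+
  note cb' = cb S_cb Y_cb cbounded_tensor_op cbounded_adj_op cbounded_compose
  have D_form: "inner u ((?L \<otimes>\<^sub>o D) u) = (norm ((?L \<otimes>\<^sub>o R) u))\<^sup>2" for u
  proof -
    have "R o\<^sub>L R = D"
      by (intro blinfun_eqI) (simp add: R)
    then have "?L \<otimes>\<^sub>o D = (?L \<otimes>\<^sub>o R) o\<^sub>L (?L \<otimes>\<^sub>o R)"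
      by (simp only: tensor_op_compose cb id_blinfun_compose)
    then have "(?L \<otimes>\<^sub>o D) u = (?L \<otimes>\<^sub>o R) ((?L \<otimes>\<^sub>o R) u)"
      by (simp only: blinfun_apply_blinfun_compose)
    then show ?thesis
      using selfadjoint_inner[OF selfadjoint_tensor_op[OF selfadjoint_id R(1)],
          of u "(?L \<otimes>\<^sub>o R) u"]
      by (simp add: power2_norm_eq_inner)
  qed
  have fock: "inner g (fock_part A Y k f) = (\<Sum>\<alpha>\<in>words k. inner (?G \<alpha>) ((?L \<otimes>\<^sub>o A \<alpha>) f))"
  proof -
    \<comment> \<open>Splitting off the coefficient A_\<alpha> lets S_\<alpha> \<otimes> Y_\<alpha>
      be moved onto g by an adjoint.\<close>
    have "?T \<alpha> \<otimes>\<^sub>o A \<alpha> = (?T \<alpha> \<otimes>\<^sub>o ?I) o\<^sub>L (?L \<otimes>\<^sub>o A \<alpha>)" for \<alpha>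
      by (simp add: tensor_op_compose cb' id_blinfun_compose)
    then have "inner g ((?T \<alpha> \<otimes>\<^sub>o A \<alpha>) f) = inner (?G \<alpha>) ((?L \<otimes>\<^sub>o A \<alpha>) f)" for \<alpha>
      using inner_adj_op[of "adj_op (?T \<alpha> \<otimes>\<^sub>o ?I)" g "(?L \<otimes>\<^sub>o A \<alpha>) f"]
      by (simp add: adj_adj_op cb')
    then show ?thesis
      by (simp add: fock_part_def blinfun.sum_left inner_sum_right)
  qed
  have G: "norm ((?L \<otimes>\<^sub>o R) (?G \<alpha>)) \<le> (1 / 3) ^ k * norm (adj_op (?W \<alpha>) ((?L \<otimes>\<^sub>o R) g))"
    if \<alpha>: "\<alpha> \<in> words k" for \<alpha>
  proof -
    let ?U = "(id_blinfun :: 'n fock \<Rightarrow>\<^sub>L 'n fock) \<otimes>\<^sub>o adj_op (?Y \<alpha>)"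
    let ?V = "?U \<otimes>\<^sub>o ?I"
    \<comment> \<open>I \<otimes> R acts on the last factor only and so passes through. What remains
      splits into the adjoint of Y_\<alpha>, of norm at most 3^-k, and the adjoint of S_\<alpha>,
      kept for Bessel's inequality.\<close>
    have "(?L \<otimes>\<^sub>o R) o\<^sub>L adj_op (?T \<alpha> \<otimes>\<^sub>o ?I) = ?V o\<^sub>L adj_op (?W \<alpha>) o\<^sub>L (?L \<otimes>\<^sub>o R)"
      by (simp add: adj_tensor_op tensor_op_compose cb' adj_op_selfadjoint selfadjoint_id
          id_blinfun_compose)
    from arg_cong[OF this, of "\<lambda>T. blinfun_apply T g"]
    have "(?L \<otimes>\<^sub>o R) (?G \<alpha>) = ?V (adj_op (?W \<alpha>) ((?L \<otimes>\<^sub>o R) g))"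
      by (simp only: blinfun_apply_blinfun_compose)
    also have "norm \<dots> \<le> norm ?V * norm (adj_op (?W \<alpha>) ((?L \<otimes>\<^sub>o R) g))"
      by (rule norm_blinfun)
    also have "norm ?V \<le> (1 / 3) ^ k"
    proof -
      have "norm ?V \<le> norm ?U * norm ?I"
        by (intro norm_tensor_op_le cb')
      also have "\<dots> \<le> norm ?U * 1"
        by (intro mult_left_mono norm_blinfun_id_le) auto
      also have "\<dots> \<le> norm (id_blinfun :: 'n fock \<Rightarrow>\<^sub>L 'n fock) * norm (adj_op (?Y \<alpha>))"
        by (simp add: norm_tensor_op_le cb')
      also have "\<dots> \<le> 1 * norm (?Y \<alpha>)"
        by (intro mult_mono norm_blinfun_id_le norm_adj_op_le Y_cb) auto
      also have "\<dots> \<le> (1 / 3) ^ k"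
        using norm_word_op_le[of Y "1 / 3" \<alpha>] Y(2) \<alpha> by (simp add: words_def)
      finally show ?thesis .
    qed
    finally show ?thesis
      by (simp add: mult_right_mono)
  qed
  \<comment> \<open>Scaling the vectors by 3^k compensates exactly the factor in G.\<close>
  have "3 ^ k * inner g (fock_part A Y k f) =
      (\<Sum>\<alpha>\<in>words k. inner (3 ^ k *\<^sub>R ?G \<alpha>) ((?L \<otimes>\<^sub>o A \<alpha>) f))"
    by (simp add: fock sum_distrib_left)
  also have "\<dots> \<le> inner f ((?L \<otimes>\<^sub>o D) f) +
      (\<Sum>\<alpha>\<in>words k. inner (3 ^ k *\<^sub>R ?G \<alpha>) ((?L \<otimes>\<^sub>o D) (3 ^ k *\<^sub>R ?G \<alpha>)))"
    by (intro form_bound_amplification finite_words D_cbounded coeffs form_bound k)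
  also have "(\<Sum>\<alpha>\<in>words k. inner (3 ^ k *\<^sub>R ?G \<alpha>) ((?L \<otimes>\<^sub>o D) (3 ^ k *\<^sub>R ?G \<alpha>))) =
      (\<Sum>\<alpha>\<in>words k. (3 ^ k * norm ((?L \<otimes>\<^sub>o R) (?G \<alpha>)))\<^sup>2)"
    unfolding D_form by (simp add: blinfun.scaleR_right)
  also have "\<dots> \<le> (\<Sum>\<alpha>\<in>words k. (norm (adj_op (?W \<alpha>) ((?L \<otimes>\<^sub>o R) g)))\<^sup>2)"
    using G by (intro sum_mono power_mono) (auto simp: field_simps power_divide)
  also have "\<dots> \<le> (norm ((?L \<otimes>\<^sub>o R) g))\<^sup>2"
    by (intro orthogonal_isometries_bessel finite_words orthogonal_isometries_tensor_id
        orthogonal_isometries_fock_word)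
  finally show ?thesis
    unfolding D_form[symmetric] by (simp add: field_simps power_divide)
qed

lemma tensor_id_D_form:
  fixes f :: "('l :: chilbert_space, 'h) htensor"
  shows "inner f ((id_blinfun \<otimes>\<^sub>o A []) f) = (norm f)\<^sup>2 - inner f ((id_blinfun \<otimes>\<^sub>o D) f)"
proof -
  have "(id_blinfun :: 'l \<Rightarrow>\<^sub>L 'l) \<otimes>\<^sub>o A [] + id_blinfun \<otimes>\<^sub>o D = id_blinfun"
    using tensor_op_add_right[of "id_blinfun :: 'l \<Rightarrow>\<^sub>L 'l" "A []" D]
    by (simp add: cbounded_id coeffs D_cbounded) (simp add: D_eq tensor_op_id)
  then have "inner f (((id_blinfun \<otimes>\<^sub>o A []) + (id_blinfun \<otimes>\<^sub>o D)) f) = inner f f"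
    by simp
  then show ?thesis
    by (simp add: blinfun.add_left inner_add_right power2_norm_eq_inner)
qed

lemma fock_series:
  fixes Y :: "'n \<Rightarrow> 'k :: chilbert_space \<Rightarrow>\<^sub>L 'k"
  assumes Y: "\<And>i. Y i \<in> cbounded" "\<And>i. norm (Y i) \<le> 1 / 3"
  shows "summable (fock_part A Y)" and "norm (suminf (fock_part A Y)) \<le> 1"
proof -
  let ?Z = "fock_part A Y"
  let ?L = "id_blinfun :: ('n fock, 'k) htensor \<Rightarrow>\<^sub>L ('n fock, 'k) htensor"
  have Z0: "?Z 0 = ?L \<otimes>\<^sub>o A []"
    by (simp add: fock_part_def words_0 tensor_op_id)
  have A0_nonneg: "0 \<le> inner f ((?L \<otimes>\<^sub>o A []) f)" for f
    by (rule tensor_op_id_form_nonneg[OF coeffs A0(2)])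
  have D_form_le: "inner f ((?L \<otimes>\<^sub>o D) f) \<le> (norm f)\<^sup>2" for f
    using A0_nonneg[of f] tensor_id_D_form[of f] by simp
  \<comment> \<open>The cruder bound obtained from D \<le> I serves summability; the final norm
    estimate keeps the forms of D.\<close>
  have norm_Z: "norm (?Z (Suc k)) \<le> (1 / 3) ^ Suc k * 2" for k
  proof (rule norm_le_of_form_bound)
    fix g f
    have "inner g (?Z (Suc k) f) \<le>
        (1 / 3) ^ Suc k * (inner f ((?L \<otimes>\<^sub>o D) f) + inner g ((?L \<otimes>\<^sub>o D) g))"
      by (intro fock_part_form_le Y) simp
    also have "\<dots> \<le> (1 / 3) ^ Suc k * ((norm f)\<^sup>2 + (norm g)\<^sup>2)"
      by (intro mult_left_mono add_mono D_form_le) simp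
    finally show "2 * inner g (?Z (Suc k) f) \<le> (1 / 3) ^ Suc k * 2 * ((norm g)\<^sup>2 + (norm f)\<^sup>2)"
      by (simp add: algebra_simps)
  qed simp
  have sm: "summable (\<lambda>k. ?Z (Suc k))"
    by (rule summable_geometric_bound[OF _ _ norm_Z]) auto
  then show "summable ?Z"
    using summable_Suc_iff by blast
  then have split: "suminf ?Z = (?L \<otimes>\<^sub>o A []) + (\<Sum>k. ?Z (Suc k))"
    using suminf_split_head[of ?Z] Z0 by (simp add: algebra_simps)
  show "norm (suminf ?Z) \<le> 1"
  proof (rule norm_le_of_form_bound)
    fix g f
    let ?d = "inner f ((?L \<otimes>\<^sub>o D) f) + inner g ((?L \<otimes>\<^sub>o D) g)"
    \<comment> \<open>The geometric factor is 1/2, so twice the tail is at most \<open>?d\<close>,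
      the amount by which the forms of I \<otimes> A_0 fall short of the squared norms.\<close>
    have "inner g ((\<Sum>k. ?Z (Suc k)) f) \<le> (1 / 3) / (1 - 1 / 3) * ?d"
      by (rule inner_suminf_le[OF _ _ sm]; (intro fock_part_form_le Y)?; simp)
    moreover have "2 * inner g ((?L \<otimes>\<^sub>o A []) f) \<le>
        inner g ((?L \<otimes>\<^sub>o A []) g) + inner f ((?L \<otimes>\<^sub>o A []) f)"
      by (rule inner_le_half_sum[OF selfadjoint_tensor_op[OF selfadjoint_id A0(1)] A0_nonneg])
    ultimately show "2 * inner g (suminf ?Z f) \<le> 1 * ((norm g)\<^sup>2 + (norm f)\<^sup>2)"
      by (simp add: split blinfun.add_left inner_add_right tensor_id_D_form)
  qed simp
qed

end

section \<open>Specialization to the coefficients of F\<close>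

theorem theorem2p5:
  fixes A :: "'n :: finite list \<Rightarrow> 'h :: chilbert_space \<Rightarrow>\<^sub>L 'h"
  assumes coeffs: "\<And>\<alpha>. A \<alpha> \<in> cbounded"
    and holomorphic: "free_holomorphic TYPE('i :: infinite) A"
    and F0: "pos_op (A [])"
    and Re_F: "\<And>(M :: 'i ell2 set) X. hilbert_subspace M \<Longrightarrow> X \<in> row_ball M \<Longrightarrow>
      Re_op (free_eval M A X) \<preceq> proj M \<otimes>\<^sub>o id_blinfun"
  shows
    "(\<forall>Y :: 'n \<Rightarrow> 'k :: chilbert_space \<Rightarrow>\<^sub>L 'k.
        (\<forall>i. Y i \<in> cbounded) \<and> row_norm (\<lambda>i. adj_op (Y i)) \<le> 1 / 3 \<longrightarrow>
        summable (fock_part A Y) \<and> norm (\<Sum>k. fock_part A Y k) \<le> 1)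
   \<and> (\<forall>k\<ge>1. gram A k \<preceq> 4 *\<^sub>R (id_blinfun - A []))
   \<and> (\<forall>k\<ge>1. sqrt (norm (gram A k)) \<le> 2 * norm (id_blinfun - A []))
   \<and> (\<forall>r::real. 0 \<le> r \<and> r < 1 \<longrightarrow>
        summable (\<lambda>k. r ^ k *\<^sub>R sqrt_op (gram A k)) \<and>
        (\<Sum>k. r ^ k *\<^sub>R sqrt_op (gram A k)) \<preceq>
          (if r \<le> 1 / 2 then 1 + r\<^sup>2 / (1 - r)\<^sup>2 else 2 * r / (1 - r)) *\<^sub>R id_blinfun)
   \<and> (\<forall>r::real. norm (A []) < 1 \<and> 0 \<le> r \<and> r < 1 \<longrightarrow>
        (let B = (\<lambda>k. \<Sum>\<alpha>\<in>words k.
            r ^ k *\<^sub>R (adj_op (A \<alpha>) o\<^sub>L inv_op (id_blinfun - A []) o\<^sub>L A \<alpha>))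
         in summable (\<lambda>k. B (Suc k)) \<and>
            A [] + (\<Sum>k. B (Suc k)) \<preceq>
              (if r \<le> 1 / 5 then 1 else 4 * r / (1 - r)) *\<^sub>R id_blinfun))
   \<and> (\<forall>r::real. 0 \<le> r \<and> r \<le> 1 / 3 \<longrightarrow>
        summable (\<lambda>k. r ^ k * sqrt (norm (gram A k))) \<and>
        (\<Sum>k. r ^ k * sqrt (norm (gram A k))) \<le> norm (A []) + norm (id_blinfun - A []))"
proof -
  let ?D = "id_blinfun - A []"
  interpret bohr_coefficients A ?D
    by unfold_locales
       (simp_all only: coeffs F0 coefficient_form_bound[OF coeffs holomorphic Re_F])
  have fock: "\<forall>Y :: 'n \<Rightarrow> 'k \<Rightarrow>\<^sub>L 'k. (\<forall>i. Y i \<in> cbounded) \<and> row_norm (\<lambda>i. adj_op (Y i)) \<le> 1 / 3 \<longrightarrow>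
      summable (fock_part A Y) \<and> norm (\<Sum>k. fock_part A Y k) \<le> 1"
  proof (intro allI impI, elim conjE)
    fix Y :: "'n \<Rightarrow> 'k \<Rightarrow>\<^sub>L 'k"
    assume Y: "\<forall>i. Y i \<in> cbounded" "row_norm (\<lambda>i. adj_op (Y i)) \<le> 1 / 3"
    have "norm (Y i) \<le> 1 / 3" for i
    proof -
      \<comment> \<open>The row condition concerns the adjoints; a second adjoint returns to
        Y_i.\<close>
      have "norm (adj_op (adj_op (Y i))) \<le> norm (adj_op (Y i))"
        by (intro norm_adj_op_le cbounded_adj_op Y(1)[rule_format])
      also have "\<dots> \<le> 1 / 3"
        using norm_le_row_norm[of "\<lambda>i. adj_op (Y i)" i] Y(2) by (rule order_trans)
      finally show ?thesis
        by (simp add: adj_adj_op Y)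
    qed
    then show "summable (fock_part A Y) \<and> norm (\<Sum>k. fock_part A Y k) \<le> 1"
      using fock_series[of Y] Y(1) by blast
  qed
  have gram_le: "gram A k \<preceq> 4 *\<^sub>R ?D" if "1 \<le> k" for k
    by (rule op_leI[OF gram_selfadjoint selfadjoint_scaleR[OF D_selfadjoint]])
       (use gram_form_le[OF that] in \<open>simp add: blinfun.scaleR_left\<close>)
  have summable_sqrt: "summable (\<lambda>k. r ^ k *\<^sub>R sqrt_op (gram A k))" if "0 \<le> r" "r < 1" for r
    using summable_sqrt_gram[OF that] summable_Suc_iff by blast
  \<comment> \<open>In (v) the weight r^k sits inside the sum over words; pulling it out identifies
    the terms with multiples of \<open>inv_gram\<close>.\<close>
  have inv_sum: "(\<Sum>\<alpha>\<in>words k. r ^ k *\<^sub>R (adj_op (A \<alpha>) o\<^sub>L inv_op ?D o\<^sub>L A \<alpha>)) =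
      r ^ k *\<^sub>R inv_gram k" for r :: real and k
    by (simp only: inv_gram_def scaleR_sum_right)
  show ?thesis
    unfolding Let_def inv_sum
    by (rule conjI[OF fock], intro conjI allI impI)
       (simp_all only: gram_le sqrt_norm_gram_le summable_sqrt sum_sqrt_gram_le
         sum_sqrt_norm_gram_le summable_inv_gram sum_inv_gram_le)
qed

end
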